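(* Let $p\ge 3$ be a prime and let $X$ be a circulant $p$-graph, with orbits $\mathcal{O}_i^s$ ($i\in\mathbb{Z}_p$, $0\le s\le r$). Suppose that there exist $s_1,s_2\in\{1,\dots,r\}$ such that $|\mathcal{O}_0^{s_1}\cap\mathcal{O}_1^{s_2}|=1$. Then $X$ has no quantum symmetry.
   Context: A circulant $p$-graph is a graph $C_p(k_1,\dots,k_m)$ with $m\ge 0$, $1<k_1<\dots<k_m\le\lfloor p/2\rfloor$ integers: its vertex set is $\mathbb{Z}_p=\mathbb{Z}/p\mathbb{Z}=\{0,\dots,p-1\}$ and $i\sim j$ iff $j-i\in S$, where $S=\{\pm1,\pm k_1,\dots,\pm k_m\}\subset\mathbb{Z}_p$. Let $E=\{a\in\mathbb{Z}_p^*: aS=S\}$, a subgroup of $\mathbb{Z}_p^*$, of order $k$. The orbits on $\mathbb{Z}_p$ of the stabilizer $\mathrm{Aut}_0(X)$ of $0$ in $\mathrm{Aut}(X)$ are $\mathcal{O}_0^0=\{0\}$ and the cosets $\mathcal{O}_0^s=y_sE$, $1\le s\le r$, where $p=1+rk$ and the representatives are chosen with $1=y_1<y_2<\dots<y_r$; for $i\in\mathbb{Z}_p$ one has $\mathcal{O}_i^0=\{i\}$ and $\mathcal{O}_i^s=i+y_sE$. Quantum symmetry: a matrix $u=(u_{ij})$ over a unital $C^*$-algebra is magic unitary if its entries are projections, distinct entries in the same row or the same column are orthogonal, and each row and column sums to $1$. $A_s(n)$ is the universal unital $C^*$-algebra generated by the entries of an $n\times n$ magic unitary matrix $u$. For a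 finite graph $X$ with $n$ vertices and adjacency matrix $d_X$, $A(X)=A_s(n)/\langle d_Xu=ud_X\rangle$. $X$ has no quantum symmetry if $A(X)$ is commutative. *)

theory Defs
  imports
    "HOL-Analysis.Analysis"
    "HOL-Algebra.QuotRing"
    "HOL-Algebra.Module"
    "HOL-Library.Poly_Mapping"
    "HOL-Computational_Algebra.Primes"
    "Graph_Theory.Pair_Digraph"
begin

section \<open>Unital C*-algebras\<close>

record 'b star_alg = "(complex, 'b) module" +
  star :: "'b \<Rightarrow> 'b"

record 'b normed_star_alg = "'b star_alg" +
  nrm :: "'b \<Rightarrow> real"

locale star_algebra = ring A for A (structure) +
  assumes smult_closed [simp, intro]: "x \<in> carrier A \<Longrightarrow> c \<odot> x \<in> carrier A"
    and smult_l_distr: "x \<in> carrier A \<Longrightarrow> (c + d) \<odot> x = c \<odot> x \<oplus> d \<odot> x"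
    and smult_r_distr: "\<lbrakk>x \<in> carrier A; y \<in> carrier A\<rbrakk> \<Longrightarrow> c \<odot> (x \<oplus> y) = c \<odot> x \<oplus> c \<odot> y"
    and smult_assoc: "x \<in> carrier A \<Longrightarrow> (c * d) \<odot> x = c \<odot> (d \<odot> x)"
    and smult_one: "x \<in> carrier A \<Longrightarrow> 1 \<odot> x = x"
    and smult_mult_l: "\<lbrakk>x \<in> carrier A; y \<in> carrier A\<rbrakk> \<Longrightarrow> (c \<odot> x) \<otimes> y = c \<odot> (x \<otimes> y)"
    and smult_mult_r: "\<lbrakk>x \<in> carrier A; y \<in> carrier A\<rbrakk> \<Longrightarrow> x \<otimes> (c \<odot> y) = c \<odot> (x \<otimes> y)"
    and star_closed [simp, intro]: "x \<in> carrier A \<Longrightarrow> star A x \<in> carrier A"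
    and star_star: "x \<in> carrier A \<Longrightarrow> star A (star A x) = x"
    and star_add: "\<lbrakk>x \<in> carrier A; y \<in> carrier A\<rbrakk> \<Longrightarrow> star A (x \<oplus> y) = star A x \<oplus> star A y"
    and star_smult: "x \<in> carrier A \<Longrightarrow> star A (c \<odot> x) = cnj c \<odot> star A x"
    and star_mult: "\<lbrakk>x \<in> carrier A; y \<in> carrier A\<rbrakk> \<Longrightarrow> star A (x \<otimes> y) = star A y \<otimes> star A x"

definition cstar_seminorm :: "('b, 'm) star_alg_scheme \<Rightarrow> ('b \<Rightarrow> real) \<Rightarrow> bool" where
  "cstar_seminorm A q \<longleftrightarrow>
     (\<forall>x\<in>carrier A. 0 \<le> q x) \<and>
     (\<forall>x\<in>carrier A. \<forall>y\<in>carrier A. q (x \<oplus>\<^bsub>A\<^esub> y) \<le> q x + q y) \<and>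
     (\<forall>c. \<forall>x\<in>carrier A. q (c \<odot>\<^bsub>A\<^esub> x) = cmod c * q x) \<and>
     (\<forall>x\<in>carrier A. \<forall>y\<in>carrier A. q (x \<otimes>\<^bsub>A\<^esub> y) \<le> q x * q y) \<and>
     (\<forall>x\<in>carrier A. q (star A x \<otimes>\<^bsub>A\<^esub> x) = (q x)\<^sup>2)"

definition cauchy_seqs :: "('b, 'm) normed_star_alg_scheme \<Rightarrow> (nat \<Rightarrow> 'b) set" where
  "cauchy_seqs A = {X. (\<forall>n. X n \<in> carrier A) \<and>
     (\<forall>e>0. \<exists>N. \<forall>m\<ge>N. \<forall>n\<ge>N. nrm A (X m \<ominus>\<^bsub>A\<^esub> X n) < e)}"

locale cstar_seminormed_algebra = star_algebra A for A (structure) +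
  assumes nrm_cstar: "cstar_seminorm A (nrm A)"

locale unital_cstar_algebra = cstar_seminormed_algebra A for A (structure) +
  assumes nrm_definite: "\<lbrakk>x \<in> carrier A; nrm A x = 0\<rbrakk> \<Longrightarrow> x = \<zero>"
    and nrm_complete: "X \<in> cauchy_seqs A \<Longrightarrow> \<exists>x\<in>carrier A. (\<lambda>n. nrm A (X n \<ominus> x)) \<longlonglongrightarrow> 0"

definition commutative_alg :: "('b, 'm) monoid_scheme \<Rightarrow> bool" where
  "commutative_alg A \<longleftrightarrow> (\<forall>x\<in>carrier A. \<forall>y\<in>carrier A. x \<otimes>\<^bsub>A\<^esub> y = y \<otimes>\<^bsub>A\<^esub> x)"


subsection \<open>Quotients and completions\<close>

text \<open>The operations \<open>smult\<close> and \<open>star\<close> are given as unions over representatives, in the style of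
  \<^const>\<open>rcoset_mult\<close>; the norm is the quotient seminorm.  The ideal is meant to be a *-ideal.\<close>

definition quot_alg :: "('b, 'm) normed_star_alg_scheme \<Rightarrow> 'b set \<Rightarrow> 'b set normed_star_alg" where
  "quot_alg A I = \<lparr>carrier = carrier (A Quot I), mult = mult (A Quot I), one = one (A Quot I),
     zero = zero (A Quot I), add = add (A Quot I),
     smult = (\<lambda>c C. \<Union>x\<in>C. I +>\<^bsub>A\<^esub> (c \<odot>\<^bsub>A\<^esub> x)),
     star = (\<lambda>C. \<Union>x\<in>C. I +>\<^bsub>A\<^esub> star A x),
     nrm = (\<lambda>C. Inf (nrm A ` C))\<rparr>"

definition closed_star_ideal :: "('b, 'm) normed_star_alg_scheme \<Rightarrow> 'b set \<Rightarrow> bool" where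
  "closed_star_ideal A J \<longleftrightarrow> ideal J A \<and> (\<forall>x\<in>J. star A x \<in> J) \<and>
     (\<forall>X. \<forall>x\<in>carrier A. (\<forall>n. X n \<in> J) \<and> (\<lambda>n. nrm A (X n \<ominus>\<^bsub>A\<^esub> x)) \<longlonglongrightarrow> 0 \<longrightarrow> x \<in> J)"

definition gen_closed_star_ideal :: "('b, 'm) normed_star_alg_scheme \<Rightarrow> 'b set \<Rightarrow> 'b set" where
  "gen_closed_star_ideal A T = \<Inter>{J. closed_star_ideal A J \<and> T \<subseteq> J}"

definition cauchy_alg :: "('b, 'm) normed_star_alg_scheme \<Rightarrow> (nat \<Rightarrow> 'b) normed_star_alg" where
  "cauchy_alg A = \<lparr>carrier = cauchy_seqs A, mult = (\<lambda>X Y n. X n \<otimes>\<^bsub>A\<^esub> Y n), one = (\<lambda>n. \<one>\<^bsub>A\<^esub>),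
     zero = (\<lambda>n. \<zero>\<^bsub>A\<^esub>), add = (\<lambda>X Y n. X n \<oplus>\<^bsub>A\<^esub> Y n),
     smult = (\<lambda>c X n. c \<odot>\<^bsub>A\<^esub> X n), star = (\<lambda>X n. star A (X n)),
     nrm = (\<lambda>X. lim (\<lambda>n. nrm A (X n)))\<rparr>"

definition null_set :: "('b, 'm) normed_star_alg_scheme \<Rightarrow> 'b set" where
  "null_set A = {x \<in> carrier A. nrm A x = 0}"

definition hausdorff_completion :: "('b, 'm) normed_star_alg_scheme \<Rightarrow> (nat \<Rightarrow> 'b) set normed_star_alg" where
  "hausdorff_completion A = quot_alg (cauchy_alg A) (null_set (cauchy_alg A))"

definition to_completion ::
    "('b, 'm) normed_star_alg_scheme \<Rightarrow> 'b \<Rightarrow> (nat \<Rightarrow> 'b) set" where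
  "to_completion A a = null_set (cauchy_alg A) +>\<^bsub>cauchy_alg A\<^esub> (\<lambda>n. a)"


subsection \<open>Universal C*-algebras given by generators and relations\<close>

datatype 'g letter = Gen 'g | Adj 'g

fun adj_letter :: "'g letter \<Rightarrow> 'g letter" where
  "adj_letter (Gen g) = Adj g"
| "adj_letter (Adj g) = Gen g"

fun base :: "'g letter \<Rightarrow> 'g" where
  "base (Gen g) = g"
| "base (Adj g) = g"

datatype 'g word = Word (letters: "'g letter list")

text \<open>The free monoid is written additively because the convolution product on
  polynomial mappings expects an additive monoid of exponents.\<close>

instantiation word :: (type) monoid_add
begin
definition zero_word :: "'a word" where "zero_word = Word []"
definition plus_word :: "'a word \<Rightarrow> 'a word \<Rightarrow> 'a word" where
  "plus_word v w = Word (letters v @ letters w)"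
instance by standard (auto simp: zero_word_def plus_word_def)
end

definition adj_word :: "'g word \<Rightarrow> 'g word" where
  "adj_word w = Word (rev (map adj_letter (letters w)))"

type_synonym 'g star_poly = "'g word \<Rightarrow>\<^sub>0 complex"

definition adj_poly :: "'g star_poly \<Rightarrow> 'g star_poly" where
  "adj_poly x = Poly_Mapping.map cnj (Poly_Mapping.map_key adj_word x)"

definition gen_poly :: "'g \<Rightarrow> 'g star_poly" where
  "gen_poly g = Poly_Mapping.single (Word [Gen g]) 1"

definition free_star_alg :: "'g set \<Rightarrow> 'g star_poly star_alg" where
  "free_star_alg G = \<lparr>carrier = {x. \<forall>w\<in>Poly_Mapping.keys x. base ` set (letters w) \<subseteq> G},
     mult = (*), one = 1, zero = 0, add = (+),
     smult = (\<lambda>c x. Poly_Mapping.single 0 c * x), star = adj_poly\<rparr>"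

text \<open>The universal C*-algebra on generators \<^term>\<open>G\<close> subject to the relations \<open>r = 0\<close> for
  \<open>r\<close> in \<^term>\<open>R\<close>: the completion of the free unital *-algebra for the largest C*-seminorm
  that vanishes on the relations.  It exists only if the C*-seminorms in question are pointwise
  bounded; otherwise the supremum below is a junk value.\<close>

definition rel_seminorms :: "'g set \<Rightarrow> 'g star_poly set \<Rightarrow> ('g star_poly \<Rightarrow> real) set" where
  "rel_seminorms G R = {q. cstar_seminorm (free_star_alg G) q \<and> (\<forall>r\<in>R. q r = 0)}"

definition with_norm :: "'b star_alg \<Rightarrow> ('b \<Rightarrow> real) \<Rightarrow> 'b normed_star_alg" where
  "with_norm A q = star_alg.extend A (normed_star_alg.fields q)"

definition presented_alg :: "'g set \<Rightarrow> 'g star_poly set \<Rightarrow> 'g star_poly normed_star_alg" where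
  "presented_alg G R = with_norm (free_star_alg G) (\<lambda>x. SUP q\<in>rel_seminorms G R. q x)"

definition universal_cstar ::
    "'g set \<Rightarrow> 'g star_poly set \<Rightarrow> (nat \<Rightarrow> 'g star_poly) set normed_star_alg" where
  "universal_cstar G R = hausdorff_completion (presented_alg G R)"

definition universal_gen ::
    "'g set \<Rightarrow> 'g star_poly set \<Rightarrow> 'g \<Rightarrow> (nat \<Rightarrow> 'g star_poly) set" where
  "universal_gen G R g = to_completion (presented_alg G R) (gen_poly g)"


section \<open>Quantum permutation algebras and quantum automorphism groups of graphs\<close>

definition magic_unitary ::
    "('b, 'm) star_alg_scheme \<Rightarrow> 'v set \<Rightarrow> ('v \<Rightarrow> 'v \<Rightarrow> 'b) \<Rightarrow> bool" where
  "magic_unitary A V u \<longleftrightarrow>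
     (\<forall>i\<in>V. \<forall>j\<in>V. u i j \<in> carrier A \<and> star A (u i j) = u i j \<and> u i j \<otimes>\<^bsub>A\<^esub> u i j = u i j) \<and>
     (\<forall>i\<in>V. \<forall>j\<in>V. \<forall>k\<in>V. j \<noteq> k \<longrightarrow>
        u i j \<otimes>\<^bsub>A\<^esub> u i k = \<zero>\<^bsub>A\<^esub> \<and> u j i \<otimes>\<^bsub>A\<^esub> u k i = \<zero>\<^bsub>A\<^esub>) \<and>
     (\<forall>i\<in>V. (\<Oplus>\<^bsub>A\<^esub>j\<in>V. u i j) = \<one>\<^bsub>A\<^esub> \<and> (\<Oplus>\<^bsub>A\<^esub>j\<in>V. u j i) = \<one>\<^bsub>A\<^esub>)"

definition magic_relations :: "'v set \<Rightarrow> ('v \<times> 'v) star_poly set" where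
  "magic_relations V = (let u = (\<lambda>i j. gen_poly (i, j)) in
     {adj_poly (u i j) - u i j | i j. i \<in> V \<and> j \<in> V} \<union>
     {u i j * u i j - u i j | i j. i \<in> V \<and> j \<in> V} \<union>
     {u i j * u i k | i j k. i \<in> V \<and> j \<in> V \<and> k \<in> V \<and> j \<noteq> k} \<union>
     {u j i * u k i | i j k. i \<in> V \<and> j \<in> V \<and> k \<in> V \<and> j \<noteq> k} \<union>
     {(\<Sum>j\<in>V. u i j) - 1 | i. i \<in> V} \<union>
     {(\<Sum>j\<in>V. u j i) - 1 | i. i \<in> V})"

text \<open>\<open>A\<^sub>s(n)\<close>, with rows and columns indexed by a set \<^term>\<open>V\<close> of \<open>n\<close> elements.\<close>

definition A_s :: "'v set \<Rightarrow> (nat \<Rightarrow> ('v \<times> 'v) star_poly) set normed_star_alg" where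
  "A_s V = universal_cstar (V \<times> V) (magic_relations V)"

definition A_s_gen :: "'v set \<Rightarrow> 'v \<Rightarrow> 'v \<Rightarrow> (nat \<Rightarrow> ('v \<times> 'v) star_poly) set" where
  "A_s_gen V i j = universal_gen (V \<times> V) (magic_relations V) (i, j)"

definition adj_matrix :: "'v pair_pre_digraph \<Rightarrow> 'v \<Rightarrow> 'v \<Rightarrow> complex" where
  "adj_matrix X i j = (if (i, j) \<in> parcs X then 1 else 0)"

definition graph_relations ::
    "'v pair_pre_digraph \<Rightarrow> (nat \<Rightarrow> ('v \<times> 'v) star_poly) set set" where
  "graph_relations X = (let V = pverts X; A = A_s V; u = A_s_gen V; d = adj_matrix X in
     {(\<Oplus>\<^bsub>A\<^esub>k\<in>V. d i k \<odot>\<^bsub>A\<^esub> u k j) \<ominus>\<^bsub>A\<^esub> (\<Oplus>\<^bsub>A\<^esub>k\<in>V. d k j \<odot>\<^bsub>A\<^esub> u i k) | i j. i \<in> V \<and> j \<in> V})"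

definition A_graph ::
    "'v pair_pre_digraph \<Rightarrow> (nat \<Rightarrow> ('v \<times> 'v) star_poly) set set normed_star_alg" where
  "A_graph X =
     quot_alg (A_s (pverts X)) (gen_closed_star_ideal (A_s (pverts X)) (graph_relations X))"

definition no_quantum_symmetry :: "'v pair_pre_digraph \<Rightarrow> bool" where
  "no_quantum_symmetry X \<longleftrightarrow> commutative_alg (A_graph X)"


section \<open>Circulant graphs\<close>

text \<open>\<open>\<int>/p\<close> is represented by \<open>{0..<int p}\<close> with arithmetic modulo \<open>p\<close>.\<close>

definition circulant_jumps :: "nat \<Rightarrow> int list \<Rightarrow> bool" where
  "circulant_jumps p ks \<longleftrightarrow> sorted_wrt (<) ks \<and> (\<forall>k\<in>set ks. 1 < k \<and> k \<le> int p div 2)"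

definition connection_set :: "nat \<Rightarrow> int list \<Rightarrow> int set" where
  "connection_set p ks = (\<lambda>s. s mod int p) ` ({1, -1} \<union> set ks \<union> uminus ` set ks)"

definition circulant_graph :: "nat \<Rightarrow> int list \<Rightarrow> int pair_pre_digraph" where
  "circulant_graph p ks = \<lparr>pverts = {0..<int p},
     parcs = {(i, j). i \<in> {0..<int p} \<and> j \<in> {0..<int p} \<and>
                      (j - i) mod int p \<in> connection_set p ks}\<rparr>"

definition mult_stabilizer :: "nat \<Rightarrow> int list \<Rightarrow> int set" where
  "mult_stabilizer p ks =
     {a \<in> {0..<int p}. coprime a (int p) \<and>
        (\<lambda>s. (a * s) mod int p) ` connection_set p ks = connection_set p ks}"

text \<open>\<open>coset_reps p ks r y\<close>: the values \<open>1 = y 1 < \<dots> < y r\<close> represent each coset of the subgroup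
  \<open>E = mult_stabilizer p ks\<close> of the units modulo \<open>p\<close> exactly once.  The values of \<open>y\<close> outside
  \<open>{1..r}\<close> are irrelevant.\<close>

definition coset_reps :: "nat \<Rightarrow> int list \<Rightarrow> nat \<Rightarrow> (nat \<Rightarrow> int) \<Rightarrow> bool" where
  "coset_reps p ks r y \<longleftrightarrow>
     p = 1 + r * card (mult_stabilizer p ks) \<and>
     y 1 = 1 \<and> strict_mono_on {1..r} y \<and> y ` {1..r} \<subseteq> {1..<int p} \<and>
     (\<forall>a\<in>{1..<int p}. \<exists>!s. s \<in> {1..r} \<and>
        a \<in> (\<lambda>b. (y s * b) mod int p) ` mult_stabilizer p ks)"

text \<open>\<open>O\<^sub>i\<^sup>0 = {i}\<close> and \<open>O\<^sub>i\<^sup>s = i + y\<^sub>s E\<close>; for \<open>i = 0\<close> these are the orbits of the stabilizer of \<open>0\<close>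
  in the automorphism group of the circulant graph.\<close>

definition circulant_orbit :: "nat \<Rightarrow> int list \<Rightarrow> (nat \<Rightarrow> int) \<Rightarrow> int \<Rightarrow> nat \<Rightarrow> int set" where
  "circulant_orbit p ks y i s =
     (if s = 0 then {i} else (\<lambda>b. (i + y s * b) mod int p) ` mult_stabilizer p ks)"


section \<open>The constructions have the intended properties\<close>

text \<open>\<^const>\<open>A_s\<close> is a unital C*-algebra, its generators form a magic unitary, and it is
  universal for this: see \<open>A_s_is_cstar\<close>, \<open>A_s_magic\<close> and \<open>A_s_universal\<close> below.\<close>

context cstar_seminormed_algebra begin

lemma nrm_nonneg [simp]: "x \<in> carrier A \<Longrightarrow> 0 \<le> nrm A x"
  and nrm_triangle: "\<lbrakk>x \<in> carrier A; y \<in> carrier A\<rbrakk> \<Longrightarrow> nrm A (x \<oplus> y) \<le> nrm A x + nrm A y"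
  and nrm_smult: "x \<in> carrier A \<Longrightarrow> nrm A (c \<odot> x) = cmod c * nrm A x"
  and nrm_mult: "\<lbrakk>x \<in> carrier A; y \<in> carrier A\<rbrakk> \<Longrightarrow> nrm A (x \<otimes> y) \<le> nrm A x * nrm A y"
  and nrm_cstar_id: "x \<in> carrier A \<Longrightarrow> nrm A (star A x \<otimes> x) = (nrm A x)\<^sup>2"
  using nrm_cstar by (auto simp: cstar_seminorm_def)

end

context star_algebra begin

lemma smult_zero_left [simp]: "x \<in> carrier A \<Longrightarrow> 0 \<odot> x = \<zero>"
  using smult_l_distr[of x 0 0] by (simp add: add.l_cancel_one')

lemma smult_minus_one: "x \<in> carrier A \<Longrightarrow> (-1) \<odot> x = \<ominus> x"
  using smult_l_distr[of x "-1" 1] by (simp add: smult_one minus_equality)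

lemma star_minus: "x \<in> carrier A \<Longrightarrow> star A (\<ominus> x) = \<ominus> star A x"
  using star_smult[of x "-1"] by (simp add: smult_minus_one)

lemma smult_minus: "x \<in> carrier A \<Longrightarrow> c \<odot> (\<ominus> x) = \<ominus> (c \<odot> x)"
  by (simp flip: smult_minus_one smult_assoc)

lemma smult_diff: "x \<in> carrier A \<Longrightarrow> y \<in> carrier A \<Longrightarrow> c \<odot> (x \<ominus> y) = c \<odot> x \<ominus> c \<odot> y"
  by (simp add: a_minus_def smult_r_distr smult_minus)

lemma star_diff: "x \<in> carrier A \<Longrightarrow> y \<in> carrier A \<Longrightarrow> star A (x \<ominus> y) = star A x \<ominus> star A y"
  by (simp add: a_minus_def star_add star_minus)

end

context cstar_seminormed_algebra begin

lemma nrm_zero [simp]: "nrm A \<zero> = 0"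
  using nrm_smult[of \<zero> 0] by simp

lemma nrm_minus [simp]: "x \<in> carrier A \<Longrightarrow> nrm A (\<ominus> x) = nrm A x"
  using nrm_smult[of x "-1"] by (simp add: smult_minus_one)

lemma nrm_diff_triangle: "x \<in> carrier A \<Longrightarrow> y \<in> carrier A \<Longrightarrow> nrm A (x \<ominus> y) \<le> nrm A x + nrm A y"
  using nrm_triangle[of x "\<ominus> y"] by (simp add: a_minus_def)

lemma nrm_diff_commute:
  assumes "x \<in> carrier A" "y \<in> carrier A"
  shows "nrm A (x \<ominus> y) = nrm A (y \<ominus> x)"
proof -
  have "\<ominus> (x \<ominus> y) = y \<ominus> x"
    using assms by (simp add: a_minus_def minus_add a_comm)
  then show ?thesis using nrm_minus[of "x \<ominus> y"] assms by simp
qed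

lemma diff_split:
  assumes "x \<in> carrier A" "y \<in> carrier A" "z \<in> carrier A"
  shows "x \<ominus> z = (x \<ominus> y) \<oplus> (y \<ominus> z)"
  using assms by (simp add: a_minus_def a_assoc r_neg1)

lemma nrm_triangle3:
  assumes "x \<in> carrier A" "y \<in> carrier A" "z \<in> carrier A"
  shows "nrm A (x \<ominus> z) \<le> nrm A (x \<ominus> y) + nrm A (y \<ominus> z)"
  using assms nrm_triangle[of "x \<ominus> y" "y \<ominus> z"] diff_split[of x y z] by simp

lemma nrm_le_diff:
  assumes "x \<in> carrier A" "y \<in> carrier A"
  shows "nrm A x \<le> nrm A (x \<ominus> y) + nrm A y"
proof -
  have "x = (x \<ominus> y) \<oplus> y" using assms by (simp add: a_minus_def a_assoc l_neg)
  then show ?thesis using nrm_triangle[of "x \<ominus> y" y] assms by simp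
qed

lemma nrm_reverse_triangle:
  assumes "x \<in> carrier A" "y \<in> carrier A"
  shows "\<bar>nrm A x - nrm A y\<bar> \<le> nrm A (x \<ominus> y)"
  using nrm_le_diff[OF assms] nrm_le_diff[OF assms(2,1)] nrm_diff_commute[OF assms] by simp

lemma nrm_star:
  assumes "x \<in> carrier A" shows "nrm A (star A x) = nrm A x"
proof -
  have *: "nrm A y \<le> nrm A (star A y)" if "y \<in> carrier A" for y
  proof (cases "nrm A y = 0")
    case False
    then have "nrm A y > 0" using nrm_nonneg[OF that] by linarith
    moreover have "nrm A y * nrm A y \<le> nrm A (star A y) * nrm A y"
      using nrm_mult[of "star A y" y] nrm_cstar_id[OF that] that by (simp add: power2_eq_square)
    ultimately show ?thesis by simp
  qed (use that in simp)
  show ?thesis using *[OF assms] *[of "star A x"] assms by (simp add: star_star)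
qed

lemma nrm_one_le: "nrm A \<one> \<le> 1"
proof -
  have "star A \<one> = \<one>"
    by (metis l_one one_closed r_one star_closed star_mult star_star)
  then have "nrm A \<one> = (nrm A \<one>)\<^sup>2" using nrm_cstar_id[of \<one>] by simp
  then show ?thesis by (auto simp: power2_eq_square)
qed

lemma mult_diff:
  assumes "x \<in> carrier A" "y \<in> carrier A" "x' \<in> carrier A" "y' \<in> carrier A"
  shows "x \<otimes> y \<ominus> x' \<otimes> y' = (x \<ominus> x') \<otimes> y \<oplus> x' \<otimes> (y \<ominus> y')"
  using assms by (simp add: a_minus_def l_distr r_distr a_assoc l_minus r_minus r_neg1)

lemma nrm_mult_diff:
  assumes "x \<in> carrier A" "y \<in> carrier A" "x' \<in> carrier A" "y' \<in> carrier A"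
  shows "nrm A (x \<otimes> y \<ominus> x' \<otimes> y') \<le> nrm A (x \<ominus> x') * nrm A y + nrm A x' * nrm A (y \<ominus> y')"
  using assms mult_diff[OF assms] nrm_triangle[of "(x \<ominus> x') \<otimes> y" "x' \<otimes> (y \<ominus> y')"]
    nrm_mult[of "x \<ominus> x'" y] nrm_mult[of "x'" "y \<ominus> y'"] by simp

lemma add_diff:
  assumes "x \<in> carrier A" "y \<in> carrier A" "x' \<in> carrier A" "y' \<in> carrier A"
  shows "(x \<oplus> y) \<ominus> (x' \<oplus> y') = (x \<ominus> x') \<oplus> (y \<ominus> y')"
  using assms by (simp add: a_minus_def minus_add a_ac)

end

subsection \<open>Algebraic quotients\<close>

lemma quot_simps:
  "carrier (quot_alg A I) = carrier (A Quot I)"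
  "mult (quot_alg A I) = mult (A Quot I)"
  "one (quot_alg A I) = one (A Quot I)"
  "zero (quot_alg A I) = zero (A Quot I)"
  "add (quot_alg A I) = add (A Quot I)"
  by (simp_all add: quot_alg_def)

lemma ring_quot_alg:
  assumes "ideal I A" shows "ring (quot_alg A I)"
proof -
  interpret R: ring "A Quot I" by (rule ideal.quotient_is_ring[OF assms])
  show ?thesis
  proof (rule ringI)
    show "abelian_group (quot_alg A I)"
    proof (rule abelian_groupI)
      show "\<exists>y\<in>carrier (quot_alg A I). y \<oplus>\<^bsub>quot_alg A I\<^esub> x = \<zero>\<^bsub>quot_alg A I\<^esub>"
        if "x \<in> carrier (quot_alg A I)" for x
        using that R.l_neg[of x] by (auto simp: quot_simps intro!: bexI[of _ "\<ominus>\<^bsub>A Quot I\<^esub> x"])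
    qed (simp_all add: quot_simps R.a_assoc, simp add: R.add.m_comm)
    show "Group.monoid (quot_alg A I)"
      by (rule monoidI) (simp_all add: quot_simps R.m_assoc)
  qed (simp_all add: quot_simps R.l_distr R.r_distr)
qed

locale star_ideal = star_algebra A + I: ideal I A for I and A :: "('b, 'm) normed_star_alg_scheme" (structure) +
  assumes star_mem: "x \<in> I \<Longrightarrow> star A x \<in> I"
begin

lemma smult_mem: "x \<in> I \<Longrightarrow> c \<odot> x \<in> I"
proof -
  assume "x \<in> I"
  then have "(c \<odot> \<one>) \<otimes> x \<in> I" "x \<in> carrier A"
    using I.I_l_closed I.a_Hcarr by auto
  then show ?thesis by (simp add: smult_mult_l)
qed

lemma coset_eq_iff: "x \<in> carrier A \<Longrightarrow> y \<in> carrier A \<Longrightarrow> I +> x = I +> y \<longleftrightarrow> x \<ominus> y \<in> I"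
  using quotient_eq_iff_same_a_r_cos[OF I.ideal_axioms] by simp

lemma q_carrier: "carrier (quot_alg A I) = {I +> x | x. x \<in> carrier A}"
  by (auto simp: quot_simps FactRing_def A_RCOSETS_def' a_r_coset_def')

lemma q_in [simp]: "x \<in> carrier A \<Longrightarrow> I +> x \<in> carrier (quot_alg A I)"
  by (auto simp: q_carrier)

lemma coset_memD:
  assumes "x \<in> carrier A" "y \<in> I +> x"
  shows "y \<in> carrier A" "I +> y = I +> x"
proof -
  obtain h where h: "h \<in> I" "y = h \<oplus> x" using assms(2) by (auto simp: a_r_coset_def')
  then have hc: "h \<in> carrier A" using I.a_Hcarr by blast
  then show y: "y \<in> carrier A" using h assms by simp
  have "y \<ominus> x = h" using h hc assms(1) by (simp add: a_minus_def a_assoc r_neg)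
  then show "I +> y = I +> x" using coset_eq_iff y assms(1) h by simp
qed

lemma coset_self: "x \<in> carrier A \<Longrightarrow> x \<in> I +> x"
  by (auto simp: a_r_coset_def' intro!: bexI[of _ \<zero>])

lemma q_mult [simp]: "\<lbrakk>x \<in> carrier A; y \<in> carrier A\<rbrakk> \<Longrightarrow>
    (I +> x) \<otimes>\<^bsub>quot_alg A I\<^esub> (I +> y) = I +> (x \<otimes> y)"
  by (simp add: quot_simps FactRing_def I.rcoset_mult_add)

lemma q_add [simp]: "\<lbrakk>x \<in> carrier A; y \<in> carrier A\<rbrakk> \<Longrightarrow>
    (I +> x) \<oplus>\<^bsub>quot_alg A I\<^esub> (I +> y) = I +> (x \<oplus> y)"
  by (simp add: quot_simps FactRing_def I.a_rcos_sum)

lemma q_one: "\<one>\<^bsub>quot_alg A I\<^esub> = I +> \<one>"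
  by (simp add: quot_simps FactRing_def)

lemma q_zero: "\<zero>\<^bsub>quot_alg A I\<^esub> = I +> \<zero>"
  by (simp add: quot_simps FactRing_def a_coset_add_zero I.a_subset)

lemma UN_coset:
  assumes x: "x \<in> carrier A" and f: "\<And>y. y \<in> carrier A \<Longrightarrow> I +> y = I +> x \<Longrightarrow> I +> f y = I +> f x"
  shows "(\<Union>y\<in>I +> x. I +> f y) = I +> f x"
proof -
  have "I +> f y = I +> f x" if "y \<in> I +> x" for y
    using f coset_memD[OF x that] by blast
  then show ?thesis using coset_self[OF x] by blast
qed

lemma q_smult [simp]: "x \<in> carrier A \<Longrightarrow> c \<odot>\<^bsub>quot_alg A I\<^esub> (I +> x) = I +> (c \<odot> x)"
  unfolding quot_alg_def
  by simp (rule UN_coset, auto simp: coset_eq_iff smult_mem simp flip: smult_diff)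

lemma q_star [simp]: "x \<in> carrier A \<Longrightarrow> star (quot_alg A I) (I +> x) = I +> star A x"
  unfolding quot_alg_def
  by simp (rule UN_coset, auto simp: coset_eq_iff star_mem simp flip: star_diff)

lemma star_algebra_quot: "star_algebra (quot_alg A I)"
proof -
  interpret Q: ring "quot_alg A I" by (rule ring_quot_alg) (rule I.ideal_axioms)
  show ?thesis
    by unfold_locales
      (auto simp: q_carrier smult_l_distr smult_r_distr smult_assoc smult_one smult_mult_l
         smult_mult_r star_star star_add star_smult star_mult)
qed

lemma q_minus [simp]:
  assumes "x \<in> carrier A" shows "\<ominus>\<^bsub>quot_alg A I\<^esub> (I +> x) = I +> (\<ominus> x)"
proof -
  interpret Q: star_algebra "quot_alg A I" by (rule star_algebra_quot)
  show ?thesis using assms Q.smult_minus_one[of "I +> x"] by (simp add: smult_minus_one)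
qed

lemma q_diff [simp]: "\<lbrakk>x \<in> carrier A; y \<in> carrier A\<rbrakk> \<Longrightarrow>
    (I +> x) \<ominus>\<^bsub>quot_alg A I\<^esub> (I +> y) = I +> (x \<ominus> y)"
  by (simp add: a_minus_def)

end

subsection \<open>The Hausdorff quotient by the null ideal\<close>

context cstar_seminormed_algebra begin

lemma null_add: "\<lbrakk>x \<in> carrier A; y \<in> carrier A; nrm A y = 0\<rbrakk> \<Longrightarrow> nrm A (x \<oplus> y) = nrm A x"
proof -
  assume *: "x \<in> carrier A" "y \<in> carrier A" "nrm A y = 0"
  have "x = (x \<oplus> y) \<oplus> (\<ominus> y)" using * by (simp add: a_assoc r_neg)
  then show ?thesis using nrm_triangle[of x y] nrm_triangle[of "x \<oplus> y" "\<ominus> y"] * by simp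
qed

lemma null_ideal: "star_ideal (null_set A) A"
proof -
  have "ideal (null_set A) A"
  proof (rule idealI)
    show "ring A" by (rule ring_axioms)
    show "subgroup (null_set A) (add_monoid A)"
    proof (rule add.subgroupI)
      show "null_set A \<subseteq> carrier A" "null_set A \<noteq> {}" by (auto simp: null_set_def intro: exI[of _ \<zero>])
    qed (auto simp: null_set_def null_add)
    show "x \<otimes> a \<in> null_set A" "a \<otimes> x \<in> null_set A" if "a \<in> null_set A" "x \<in> carrier A" for a x
      using that nrm_mult[of a x] nrm_mult[of x a] nrm_nonneg[of "a \<otimes> x"] nrm_nonneg[of "x \<otimes> a"]
      by (auto simp: null_set_def intro: antisym)
  qed
  then show ?thesis
    by (auto simp: star_ideal_def star_ideal_axioms_def star_algebra_axioms null_set_def nrm_star)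
qed

end

context cstar_seminormed_algebra begin

interpretation N: star_ideal "null_set A" A by (rule null_ideal)

lemma nrm_coset_mem:
  assumes y: "y \<in> null_set A +> x" and x: "x \<in> carrier A" shows "nrm A y = nrm A x"
proof -
  have "\<exists>h. h \<in> carrier A \<and> nrm A h = 0 \<and> y = h \<oplus> x"
    using y unfolding a_r_coset_def' null_set_def by blast
  then obtain h where h: "h \<in> carrier A" "nrm A h = 0" "y = h \<oplus> x" by blast
  then have "y = x \<oplus> h" using a_comm[OF x h(1)] by simp
  with null_add[OF x h(1,2)] show ?thesis by simp
qed

lemma nrm_coset [simp]:
  assumes x: "x \<in> carrier A"
  shows "nrm (quot_alg A (null_set A)) (null_set A +> x) = nrm A x"
proof -
  have "nrm A ` (null_set A +> x) = (\<lambda>_. nrm A x) ` (null_set A +> x)"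
    by (rule image_cong[OF refl nrm_coset_mem[OF _ x]])
  also have "\<dots> = {nrm A x}" by (rule image_constant[OF N.coset_self[OF x]])
  finally have "Inf (nrm A ` (null_set A +> x)) = nrm A x" by (simp only: cInf_singleton)
  then show ?thesis by (simp add: quot_alg_def)
qed

lemma haus_cstar: "cstar_seminormed_algebra (quot_alg A (null_set A))"
proof -
  interpret Q: star_algebra "quot_alg A (null_set A)" by (rule N.star_algebra_quot)
  have "cstar_seminorm (quot_alg A (null_set A)) (nrm (quot_alg A (null_set A)))"
    unfolding cstar_seminorm_def
    by (auto simp: N.q_carrier nrm_triangle nrm_smult nrm_mult nrm_cstar_id)
  then show ?thesis by unfold_locales
qed

lemma haus_definite: "C \<in> carrier (quot_alg A (null_set A)) \<Longrightarrow> nrm (quot_alg A (null_set A)) C = 0 \<Longrightarrow> C = \<zero>\<^bsub>quot_alg A (null_set A)\<^esub>"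
proof -
  assume "C \<in> carrier (quot_alg A (null_set A))" and *: "nrm (quot_alg A (null_set A)) C = 0"
  then obtain x where x: "x \<in> carrier A" "C = null_set A +> x" by (auto simp: N.q_carrier)
  have x0: "x \<ominus> \<zero> = x" using x(1) by (simp add: a_minus_def)
  have "nrm A x = 0" using nrm_coset[OF x(1)] x(2) * by metis
  then have "x \<ominus> \<zero> \<in> null_set A" unfolding x0 using x(1) unfolding null_set_def by blast
  then have "null_set A +> x = null_set A +> \<zero>" using x(1) by (simp only: N.coset_eq_iff zero_closed)
  then show ?thesis using x(2) N.q_zero by metis
qed

end

subsection \<open>Cauchy sequences\<close>

lemma cauchy_seqsD: "X \<in> cauchy_seqs A \<Longrightarrow> X n \<in> carrier A"
  by (simp add: cauchy_seqs_def)

lemma cauchy_seqsE: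
  assumes "X \<in> cauchy_seqs A" "e > 0"
  obtains N where "\<And>m n. m \<ge> N \<Longrightarrow> n \<ge> N \<Longrightarrow> nrm A (X m \<ominus>\<^bsub>A\<^esub> X n) < e"
  using assms unfolding cauchy_seqs_def by blast

context cstar_seminormed_algebra begin

lemma cauchy_seqsI:
  assumes c: "\<And>n. X n \<in> carrier A"
    and b: "\<And>e. e > 0 \<Longrightarrow> \<exists>N. \<forall>m\<ge>N. \<forall>n\<ge>N. nrm A (X m \<ominus> X n) < e"
  shows "X \<in> cauchy_seqs A"
  using assms by (simp add: cauchy_seqs_def)

lemma cauchy_const: "a \<in> carrier A \<Longrightarrow> (\<lambda>n. a) \<in> cauchy_seqs A"
  by (rule cauchy_seqsI) (auto simp: a_minus_def r_neg)

lemma cauchy_nrm: 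
  assumes X: "X \<in> cauchy_seqs A" shows "Cauchy (\<lambda>n. nrm A (X n))"
proof (rule metric_CauchyI)
  fix e :: real assume "e > 0"
  from X this obtain N where N: "\<And>m n. m \<ge> N \<Longrightarrow> n \<ge> N \<Longrightarrow> nrm A (X m \<ominus> X n) < e"
    by (rule cauchy_seqsE) blast
  have "dist (nrm A (X m)) (nrm A (X n)) < e" if "m \<ge> N" "n \<ge> N" for m n
    using N[OF that] nrm_reverse_triangle[OF cauchy_seqsD[OF X, of m] cauchy_seqsD[OF X, of n]]
    by (simp add: dist_real_def)
  then show "\<exists>M. \<forall>m\<ge>M. \<forall>n\<ge>M. dist (nrm A (X m)) (nrm A (X n)) < e" by blast
qed

lemma cauchy_nrm_lim:
  assumes X: "X \<in> cauchy_seqs A"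
  shows "(\<lambda>n. nrm A (X n)) \<longlonglongrightarrow> nrm (cauchy_alg A) X"
  using Cauchy_convergent[OF cauchy_nrm[OF X]]
  by (simp add: cauchy_alg_def convergent_LIMSEQ_iff)

lemma cauchy_bounded:
  assumes X: "X \<in> cauchy_seqs A"
  obtains K where "K > 0" "\<And>n. nrm A (X n) \<le> K"
proof -
  have "Bseq (\<lambda>n. nrm A (X n))" using cauchy_nrm[OF X] by (rule Cauchy_Bseq)
  then obtain K where "K > 0" "\<And>n. norm (nrm A (X n)) \<le> K" by (auto simp: Bseq_def)
  then show ?thesis by (intro that[of K]) (auto simp: abs_le_iff)
qed

lemma cauchy_add:
  assumes X: "X \<in> cauchy_seqs A" and Y: "Y \<in> cauchy_seqs A"
  shows "(\<lambda>n. X n \<oplus> Y n) \<in> cauchy_seqs A"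
proof (rule cauchy_seqsI)
  note [simp] = cauchy_seqsD[OF X] cauchy_seqsD[OF Y]
  show "X n \<oplus> Y n \<in> carrier A" for n by simp
  fix e :: real assume "e > 0"
  then have e: "e / 2 > 0" by simp
  from X e obtain N where N: "\<And>m n. m \<ge> N \<Longrightarrow> n \<ge> N \<Longrightarrow> nrm A (X m \<ominus> X n) < e/2"
    by (rule cauchy_seqsE) blast
  from Y e obtain M where M: "\<And>m n. m \<ge> M \<Longrightarrow> n \<ge> M \<Longrightarrow> nrm A (Y m \<ominus> Y n) < e/2"
    by (rule cauchy_seqsE) blast
  have "nrm A ((X m \<oplus> Y m) \<ominus> (X n \<oplus> Y n)) < e" if "m \<ge> max N M" "n \<ge> max N M" for m n
    using N[of m n] M[of m n] that nrm_triangle[of "X m \<ominus> X n" "Y m \<ominus> Y n"]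
    by (simp add: add_diff)
  then show "\<exists>N. \<forall>m\<ge>N. \<forall>n\<ge>N. nrm A ((X m \<oplus> Y m) \<ominus> (X n \<oplus> Y n)) < e" by blast
qed

lemma cauchy_smult:
  assumes X: "X \<in> cauchy_seqs A"
  shows "(\<lambda>n. c \<odot> X n) \<in> cauchy_seqs A"
proof (rule cauchy_seqsI)
  note [simp] = cauchy_seqsD[OF X]
  show "c \<odot> X n \<in> carrier A" for n by simp
  fix e :: real assume "e > 0"
  then have e: "e / (cmod c + 1) > 0" by (simp add: add_nonneg_pos)
  from X e obtain N where
    N: "\<And>m n. m \<ge> N \<Longrightarrow> n \<ge> N \<Longrightarrow> nrm A (X m \<ominus> X n) < e / (cmod c + 1)"
    by (rule cauchy_seqsE) blast
  have "nrm A (c \<odot> X m \<ominus> c \<odot> X n) < e" if "m \<ge> N" "n \<ge> N" for m n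
  proof -
    have "nrm A (c \<odot> X m \<ominus> c \<odot> X n) = cmod c * nrm A (X m \<ominus> X n)"
      by (simp add: nrm_smult flip: smult_diff)
    also have "\<dots> \<le> (cmod c + 1) * nrm A (X m \<ominus> X n)" by (simp add: mult_right_mono)
    also have "\<dots> < e" using N[OF that] by (simp add: pos_less_divide_eq add_nonneg_pos mult.commute)
    finally show ?thesis .
  qed
  then show "\<exists>N. \<forall>m\<ge>N. \<forall>n\<ge>N. nrm A (c \<odot> X m \<ominus> c \<odot> X n) < e" by blast
qed

lemma cauchy_star:
  assumes X: "X \<in> cauchy_seqs A"
  shows "(\<lambda>n. star A (X n)) \<in> cauchy_seqs A"
  using X by (simp add: cauchy_seqs_def nrm_star flip: star_diff)

lemma cauchy_mult:
  assumes X: "X \<in> cauchy_seqs A" and Y: "Y \<in> cauchy_seqs A"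
  shows "(\<lambda>n. X n \<otimes> Y n) \<in> cauchy_seqs A"
proof (rule cauchy_seqsI)
  note [simp] = cauchy_seqsD[OF X] cauchy_seqsD[OF Y]
  show "X n \<otimes> Y n \<in> carrier A" for n by simp
  obtain K where K: "K > 0" "\<And>n. nrm A (X n) \<le> K" using cauchy_bounded[OF X] by blast
  obtain L where L: "L > 0" "\<And>n. nrm A (Y n) \<le> L" using cauchy_bounded[OF Y] by blast
  fix e :: real assume "e > 0"
  then have e1: "e / (2 * L) > 0" and e2: "e / (2 * K) > 0" using K L by simp_all
  from X e1 obtain N where N: "\<And>m n. m \<ge> N \<Longrightarrow> n \<ge> N \<Longrightarrow> nrm A (X m \<ominus> X n) < e / (2 * L)"
    by (rule cauchy_seqsE) blast
  from Y e2 obtain M where M: "\<And>m n. m \<ge> M \<Longrightarrow> n \<ge> M \<Longrightarrow> nrm A (Y m \<ominus> Y n) < e / (2 * K)"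
    by (rule cauchy_seqsE) blast
  have "nrm A (X m \<otimes> Y m \<ominus> X n \<otimes> Y n) < e" if "m \<ge> max N M" "n \<ge> max N M" for m n
  proof -
    have "nrm A (X m \<ominus> X n) * nrm A (Y m) \<le> nrm A (X m \<ominus> X n) * L"
      using L by (intro mult_left_mono) simp_all
    also have "\<dots> < e / (2 * L) * L"
      using N[of m n] that L by (intro mult_strict_right_mono) simp_all
    finally have 1: "nrm A (X m \<ominus> X n) * nrm A (Y m) < e / 2" using L by simp
    have "nrm A (X n) * nrm A (Y m \<ominus> Y n) \<le> K * nrm A (Y m \<ominus> Y n)"
      using K by (intro mult_right_mono) simp_all
    also have "\<dots> < K * (e / (2 * K))"
      using M[of m n] that K by (intro mult_strict_left_mono) simp_all
    finally have 2: "nrm A (X n) * nrm A (Y m \<ominus> Y n) < e / 2" using K by simp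
    show ?thesis using 1 2 nrm_mult_diff[of "X m" "Y m" "X n" "Y n"] by simp
  qed
  then show "\<exists>N. \<forall>m\<ge>N. \<forall>n\<ge>N. nrm A (X m \<otimes> Y m \<ominus> X n \<otimes> Y n) < e" by blast
qed

lemma cauchy_alg_simps:
  "carrier (cauchy_alg A) = cauchy_seqs A"
  "X \<otimes>\<^bsub>cauchy_alg A\<^esub> Y = (\<lambda>n. X n \<otimes> Y n)"
  "X \<oplus>\<^bsub>cauchy_alg A\<^esub> Y = (\<lambda>n. X n \<oplus> Y n)"
  "\<one>\<^bsub>cauchy_alg A\<^esub> = (\<lambda>n. \<one>)" "\<zero>\<^bsub>cauchy_alg A\<^esub> = (\<lambda>n. \<zero>)"
  "c \<odot>\<^bsub>cauchy_alg A\<^esub> X = (\<lambda>n. c \<odot> X n)" "star (cauchy_alg A) X = (\<lambda>n. star A (X n))"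
  by (simp_all add: cauchy_alg_def)

lemma star_algebra_cauchy: "star_algebra (cauchy_alg A)"
proof -
  note s [simp] = cauchy_alg_simps cauchy_seqsD cauchy_add cauchy_mult cauchy_smult cauchy_star cauchy_const
  have "ring (cauchy_alg A)"
  proof (rule ringI)
    show "abelian_group (cauchy_alg A)"
    proof (rule abelian_groupI)
      fix X assume "X \<in> carrier (cauchy_alg A)"
      then have "(\<lambda>n. \<ominus> X n) \<in> cauchy_seqs A" "\<And>n. X n \<in> carrier A"
        using cauchy_smult[of X "-1"] by (simp_all add: smult_minus_one)
      then show "\<exists>Y\<in>carrier (cauchy_alg A). Y \<oplus>\<^bsub>cauchy_alg A\<^esub> X = \<zero>\<^bsub>cauchy_alg A\<^esub>"
        by (intro bexI[of _ "\<lambda>n. \<ominus> X n"]) (auto simp: l_neg)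
    qed (auto simp: fun_eq_iff a_assoc intro: a_comm)
    show "Group.monoid (cauchy_alg A)"
      by (rule monoidI) (auto simp: fun_eq_iff m_assoc)
  qed (auto simp: fun_eq_iff l_distr r_distr)
  then interpret C: ring "cauchy_alg A" .
  show ?thesis
    by unfold_locales
      (auto simp: fun_eq_iff smult_l_distr smult_r_distr smult_assoc smult_one smult_mult_l
         smult_mult_r star_star star_add star_smult star_mult)
qed

lemma cauchy_alg_diff:
  assumes X: "X \<in> cauchy_seqs A" and Y: "Y \<in> cauchy_seqs A"
  shows "X \<ominus>\<^bsub>cauchy_alg A\<^esub> Y = (\<lambda>n. X n \<ominus> Y n)"
proof -
  interpret C: star_algebra "cauchy_alg A" by (rule star_algebra_cauchy)
  have "\<ominus>\<^bsub>cauchy_alg A\<^esub> Y = (\<lambda>n. \<ominus> Y n)"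
    using C.smult_minus_one[of Y] Y cauchy_seqsD[OF Y] by (simp add: cauchy_alg_simps smult_minus_one)
  then show ?thesis by (simp add: a_minus_def cauchy_alg_simps)
qed

lemma cauchy_cstar: "cstar_seminormed_algebra (cauchy_alg A)"
proof -
  interpret C: star_algebra "cauchy_alg A" by (rule star_algebra_cauchy)
  have "cstar_seminorm (cauchy_alg A) (nrm (cauchy_alg A))"
    unfolding cstar_seminorm_def cauchy_alg_simps
  proof (intro conjI ballI allI)
    fix X assume X: "X \<in> cauchy_seqs A"
    note [simp] = cauchy_seqsD[OF X]
    note lX = cauchy_nrm_lim[OF X]
    show "0 \<le> nrm (cauchy_alg A) X" by (rule LIMSEQ_le_const[OF lX]) simp
    show "nrm (cauchy_alg A) (\<lambda>n. c \<odot> X n) = cmod c * nrm (cauchy_alg A) X" for c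
      using cauchy_nrm_lim[OF cauchy_smult[OF X, of c]] tendsto_mult_left[OF lX, of "cmod c"]
      by (intro LIMSEQ_unique) (simp_all add: nrm_smult)
    show "nrm (cauchy_alg A) (\<lambda>n. star A (X n) \<otimes> X n) = (nrm (cauchy_alg A) X)\<^sup>2"
      using cauchy_nrm_lim[OF cauchy_mult[OF cauchy_star[OF X] X]] tendsto_power[OF lX, of 2]
      by (intro LIMSEQ_unique) (simp_all add: nrm_cstar_id)
    fix Y assume Y: "Y \<in> cauchy_seqs A"
    note [simp] = cauchy_seqsD[OF Y]
    note lY = cauchy_nrm_lim[OF Y]
    show "nrm (cauchy_alg A) (\<lambda>n. X n \<oplus> Y n) \<le> nrm (cauchy_alg A) X + nrm (cauchy_alg A) Y"
      by (rule LIMSEQ_le[OF cauchy_nrm_lim[OF cauchy_add[OF X Y]] tendsto_add[OF lX lY]])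
        (simp add: nrm_triangle)
    show "nrm (cauchy_alg A) (\<lambda>n. X n \<otimes> Y n) \<le> nrm (cauchy_alg A) X * nrm (cauchy_alg A) Y"
      by (rule LIMSEQ_le[OF cauchy_nrm_lim[OF cauchy_mult[OF X Y]] tendsto_mult[OF lX lY]])
        (simp add: nrm_mult)
  qed
  then show ?thesis by unfold_locales
qed

subsection \<open>The completion\<close>

interpretation C: cstar_seminormed_algebra "cauchy_alg A" by (rule cauchy_cstar)
interpretation CN: star_ideal "null_set (cauchy_alg A)" "cauchy_alg A" by (rule C.null_ideal)

lemma completion_cstar: "cstar_seminormed_algebra (hausdorff_completion A)"
  unfolding hausdorff_completion_def by (rule C.haus_cstar)

interpretation D: cstar_seminormed_algebra "hausdorff_completion A" by (rule completion_cstar)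

lemma to_completion_closed [simp]: "a \<in> carrier A \<Longrightarrow> to_completion A a \<in> carrier (hausdorff_completion A)"
  by (simp add: to_completion_def hausdorff_completion_def cauchy_const cauchy_alg_simps)

lemma to_completion_add: "a \<in> carrier A \<Longrightarrow> b \<in> carrier A \<Longrightarrow>
    to_completion A (a \<oplus> b) = to_completion A a \<oplus>\<^bsub>hausdorff_completion A\<^esub> to_completion A b"
  and to_completion_mult: "a \<in> carrier A \<Longrightarrow> b \<in> carrier A \<Longrightarrow>
    to_completion A (a \<otimes> b) = to_completion A a \<otimes>\<^bsub>hausdorff_completion A\<^esub> to_completion A b"
  and to_completion_smult: "a \<in> carrier A \<Longrightarrow>
    to_completion A (c \<odot> a) = c \<odot>\<^bsub>hausdorff_completion A\<^esub> to_completion A a"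
  and to_completion_star: "a \<in> carrier A \<Longrightarrow>
    to_completion A (star A a) = star (hausdorff_completion A) (to_completion A a)"
  and to_completion_one: "to_completion A \<one> = \<one>\<^bsub>hausdorff_completion A\<^esub>"
  and to_completion_zero: "to_completion A \<zero> = \<zero>\<^bsub>hausdorff_completion A\<^esub>"
  by (simp_all add: to_completion_def hausdorff_completion_def cauchy_const cauchy_alg_simps CN.q_one CN.q_zero)

lemma to_completion_diff: "a \<in> carrier A \<Longrightarrow> b \<in> carrier A \<Longrightarrow>
    to_completion A (a \<ominus> b) = to_completion A a \<ominus>\<^bsub>hausdorff_completion A\<^esub> to_completion A b"
  by (simp add: to_completion_def hausdorff_completion_def cauchy_const cauchy_alg_simps cauchy_alg_diff)

lemma nrm_to_completion: "a \<in> carrier A \<Longrightarrow> nrm (hausdorff_completion A) (to_completion A a) = nrm A a"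
proof -
  assume a: "a \<in> carrier A"
  then have "nrm (cauchy_alg A) (\<lambda>n. a) = nrm A a"
    using cauchy_nrm_lim[OF cauchy_const[OF a]] by (simp add: LIMSEQ_const_iff)
  then show ?thesis using a
    by (simp add: to_completion_def hausdorff_completion_def cauchy_const cauchy_alg_simps)
qed

lemma to_completion_dense:
  assumes C: "C \<in> carrier (hausdorff_completion A)" and e: "e > 0"
  obtains a where "a \<in> carrier A" "nrm (hausdorff_completion A) (C \<ominus>\<^bsub>hausdorff_completion A\<^esub> to_completion A a) < e"
proof -
  obtain X where X: "X \<in> cauchy_seqs A" and CX: "C = null_set (cauchy_alg A) +>\<^bsub>cauchy_alg A\<^esub> X"
    using C by (auto simp: hausdorff_completion_def CN.q_carrier cauchy_alg_simps)
  note [simp] = cauchy_seqsD[OF X]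
  from e have "e / 2 > 0" by simp
  from X this obtain N where N: "\<And>m n. m \<ge> N \<Longrightarrow> n \<ge> N \<Longrightarrow> nrm A (X m \<ominus> X n) < e/2"
    by (rule cauchy_seqsE) blast
  have cN: "(\<lambda>n. X N) \<in> cauchy_seqs A" by (rule cauchy_const) simp
  have *: "X \<ominus>\<^bsub>cauchy_alg A\<^esub> (\<lambda>n. X N) = (\<lambda>n. X n \<ominus> X N)" by (rule cauchy_alg_diff[OF X cN])
  have **: "(\<lambda>n. X n \<ominus> X N) \<in> cauchy_seqs A"
    using C.minus_closed[of X "\<lambda>n. X N"] X cN * by (simp add: cauchy_alg_simps)
  have "nrm (hausdorff_completion A) (C \<ominus>\<^bsub>hausdorff_completion A\<^esub> to_completion A (X N)) = nrm (cauchy_alg A) (\<lambda>n. X n \<ominus> X N)"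
    using X cN ** by (simp add: CX to_completion_def hausdorff_completion_def cauchy_alg_simps *)
  also have "\<dots> \<le> e / 2"
    by (rule LIMSEQ_le_const2[OF cauchy_nrm_lim[OF **]]) (use N in \<open>auto intro!: exI[of _ N] less_imp_le\<close>)
  finally show ?thesis using e by (intro that[of "X N"]) auto
qed

lemma to_completion_lim:
  assumes X: "X \<in> cauchy_seqs A"
  shows "(\<lambda>n. nrm (hausdorff_completion A) (to_completion A (X n) \<ominus>\<^bsub>hausdorff_completion A\<^esub>
           (null_set (cauchy_alg A) +>\<^bsub>cauchy_alg A\<^esub> X))) \<longlonglongrightarrow> 0" (is "?f \<longlonglongrightarrow> 0")
proof (rule metric_LIMSEQ_I)
  note [simp] = cauchy_seqsD[OF X]
  fix e :: real assume "e > 0"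
  then have e: "e / 2 > 0" by simp
  from X this obtain N where N: "\<And>m n. m \<ge> N \<Longrightarrow> n \<ge> N \<Longrightarrow> nrm A (X m \<ominus> X n) < e/2"
    by (rule cauchy_seqsE) blast
  have "dist (?f m) 0 < e" if m: "m \<ge> N" for m
  proof -
    have cm: "(\<lambda>n. X m) \<in> cauchy_seqs A" by (rule cauchy_const) simp
    have *: "(\<lambda>n. X m) \<ominus>\<^bsub>cauchy_alg A\<^esub> X = (\<lambda>n. X m \<ominus> X n)" by (rule cauchy_alg_diff[OF cm X])
    have **: "(\<lambda>n. X m \<ominus> X n) \<in> cauchy_seqs A"
      using C.minus_closed[of "\<lambda>n. X m" X] X cm * by (simp add: cauchy_alg_simps)
    have f: "?f m = nrm (cauchy_alg A) (\<lambda>n. X m \<ominus> X n)"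
      using X cm ** by (simp add: to_completion_def hausdorff_completion_def cauchy_alg_simps *)
    have "\<dots> \<le> e / 2"
      by (rule LIMSEQ_le_const2[OF cauchy_nrm_lim[OF **]])
        (use N m in \<open>auto intro!: exI[of _ N] less_imp_le\<close>)
    moreover have "0 \<le> nrm (cauchy_alg A) (\<lambda>n. X m \<ominus> X n)"
      using ** by (simp add: cauchy_alg_simps)
    ultimately show ?thesis using e f by (simp add: dist_real_def)
  qed
  then show "\<exists>no. \<forall>n\<ge>no. dist (?f n) 0 < e" by blast
qed

theorem completion_is_cstar: "unital_cstar_algebra (hausdorff_completion A)"
proof unfold_locales
  show "x = \<zero>\<^bsub>hausdorff_completion A\<^esub>" if "x \<in> carrier (hausdorff_completion A)" "nrm (hausdorff_completion A) x = 0" for x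
    using that C.haus_definite unfolding hausdorff_completion_def by blast
next
  fix F assume F: "F \<in> cauchy_seqs (hausdorff_completion A)"
  note [simp] = cauchy_seqsD[OF F]
  have "\<exists>a. a \<in> carrier A \<and> nrm (hausdorff_completion A) (F n \<ominus>\<^bsub>hausdorff_completion A\<^esub> to_completion A a) < 1 / real (Suc n)" for n
    by (rule to_completion_dense[of "F n" "1 / real (Suc n)"]) auto
  then obtain a where a [simp]: "\<And>n. a n \<in> carrier A"
    and an: "\<And>n. nrm (hausdorff_completion A) (F n \<ominus>\<^bsub>hausdorff_completion A\<^esub> to_completion A (a n)) < 1 / real (Suc n)"
    by metis
  define i where "i n = to_completion A (a n)" for n
  have [simp]: "i n \<in> carrier (hausdorff_completion A)" for n by (simp add: i_def)
  have iF: "nrm (hausdorff_completion A) (F n \<ominus>\<^bsub>hausdorff_completion A\<^esub> i n) < 1 / real (Suc n)" for n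
    using an[of n] by (simp add: i_def)
  have aC: "a \<in> cauchy_seqs A"
  proof (rule cauchy_seqsI)
    fix e :: real assume "e > 0"
    then have e: "e / 3 > 0" by simp
    from F e obtain N where N: "\<And>m n. m \<ge> N \<Longrightarrow> n \<ge> N \<Longrightarrow> nrm (hausdorff_completion A) (F m \<ominus>\<^bsub>hausdorff_completion A\<^esub> F n) < e/3"
      by (rule cauchy_seqsE) blast
    obtain M where M: "1 / real (Suc M) < e / 3" using nat_approx_posE[OF e] by (auto simp: inverse_eq_divide)
    have "nrm A (a m \<ominus> a n) < e" if mn: "m \<ge> max N M" "n \<ge> max N M" for m n
    proof -
      have b: "1 / real (Suc k) < e / 3" if "k \<ge> M" for k
        using M that by (smt (verit, best) frac_le of_nat_0_less_iff of_nat_mono Suc_le_mono zero_less_Suc)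
      have "nrm A (a m \<ominus> a n) = nrm (hausdorff_completion A) (i m \<ominus>\<^bsub>hausdorff_completion A\<^esub> i n)"
        using nrm_to_completion[of "a m \<ominus> a n"] by (simp add: to_completion_diff i_def)
      also have "\<dots> \<le> nrm (hausdorff_completion A) (i m \<ominus>\<^bsub>hausdorff_completion A\<^esub> F m) + nrm (hausdorff_completion A) (F m \<ominus>\<^bsub>hausdorff_completion A\<^esub> i n)"
        by (rule D.nrm_triangle3) simp_all
      also have "nrm (hausdorff_completion A) (F m \<ominus>\<^bsub>hausdorff_completion A\<^esub> i n) \<le>
          nrm (hausdorff_completion A) (F m \<ominus>\<^bsub>hausdorff_completion A\<^esub> F n) + nrm (hausdorff_completion A) (F n \<ominus>\<^bsub>hausdorff_completion A\<^esub> i n)"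
        by (rule D.nrm_triangle3) simp_all
      finally show ?thesis
        using N[of m n] b[of m] b[of n] iF[of m] iF[of n] mn D.nrm_diff_commute[of "i m" "F m"] by simp
    qed
    then show "\<exists>N. \<forall>m\<ge>N. \<forall>n\<ge>N. nrm A (a m \<ominus> a n) < e" by blast
  qed simp
  define Z where "Z = null_set (cauchy_alg A) +>\<^bsub>cauchy_alg A\<^esub> a"
  have Z [simp]: "Z \<in> carrier (hausdorff_completion A)"
    using aC by (simp add: Z_def hausdorff_completion_def cauchy_alg_simps)
  have iZ: "(\<lambda>n. nrm (hausdorff_completion A) (i n \<ominus>\<^bsub>hausdorff_completion A\<^esub> Z)) \<longlonglongrightarrow> 0"
    unfolding i_def Z_def by (rule to_completion_lim[OF aC])
  have "(\<lambda>n. 1 / real (Suc n) + nrm (hausdorff_completion A) (i n \<ominus>\<^bsub>hausdorff_completion A\<^esub> Z)) \<longlonglongrightarrow> 0 + 0"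
    by (intro tendsto_add iZ LIMSEQ_Suc lim_1_over_n)
  then have lim: "(\<lambda>n. 1 / real (Suc n) + nrm (hausdorff_completion A) (i n \<ominus>\<^bsub>hausdorff_completion A\<^esub> Z)) \<longlonglongrightarrow> 0"
    by simp
  have le: "nrm (hausdorff_completion A) (F n \<ominus>\<^bsub>hausdorff_completion A\<^esub> Z) \<le>
      1 / real (Suc n) + nrm (hausdorff_completion A) (i n \<ominus>\<^bsub>hausdorff_completion A\<^esub> Z)" for n
    using iF[of n] D.nrm_triangle3[of "F n" "i n" Z] by simp
  have e1: "\<forall>\<^sub>F n in sequentially. 0 \<le> nrm (hausdorff_completion A) (F n \<ominus>\<^bsub>hausdorff_completion A\<^esub> Z)"
    by (intro always_eventually allI) simp
  have e2: "\<forall>\<^sub>F n in sequentially. nrm (hausdorff_completion A) (F n \<ominus>\<^bsub>hausdorff_completion A\<^esub> Z) \<le>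
      1 / real (Suc n) + nrm (hausdorff_completion A) (i n \<ominus>\<^bsub>hausdorff_completion A\<^esub> Z)"
    by (intro always_eventually allI le)
  have "(\<lambda>n. nrm (hausdorff_completion A) (F n \<ominus>\<^bsub>hausdorff_completion A\<^esub> Z)) \<longlonglongrightarrow> 0"
    by (rule tendsto_sandwich[OF e1 e2 tendsto_const lim])
  then show "\<exists>x\<in>carrier (hausdorff_completion A). (\<lambda>n. nrm (hausdorff_completion A) (F n \<ominus>\<^bsub>hausdorff_completion A\<^esub> x)) \<longlonglongrightarrow> 0"
    using Z by blast
qed

end

lemma ring_cong:
  assumes "ring R" "carrier S = carrier R" "mult S = mult R" "one S = one R" "zero S = zero R" "add S = add R"
  shows "ring S"
proof -
  interpret R: ring R by fact
  show ?thesis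
  proof (rule ringI)
    show "abelian_group S"
    proof (rule abelian_groupI)
      show "\<exists>y\<in>carrier S. y \<oplus>\<^bsub>S\<^esub> x = \<zero>\<^bsub>S\<^esub>" if "x \<in> carrier S" for x
        using that assms R.l_neg[of x] by (intro bexI[of _ "\<ominus>\<^bsub>R\<^esub> x"]) simp_all
    qed (simp_all add: assms R.a_assoc, simp add: R.add.m_comm)
    show "Group.monoid S"
      by (rule monoidI) (simp_all add: assms R.m_assoc)
  qed (simp_all add: assms R.l_distr R.r_distr)
qed

subsection \<open>Limits and extension of contractive homomorphisms\<close>

definition star_hom ::
    "('b, 'm) star_alg_scheme \<Rightarrow> ('c, 'n) star_alg_scheme \<Rightarrow> ('b \<Rightarrow> 'c) set" where
  "star_hom A B = {f \<in> ring_hom A B.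
     (\<forall>c. \<forall>x\<in>carrier A. f (c \<odot>\<^bsub>A\<^esub> x) = c \<odot>\<^bsub>B\<^esub> f x) \<and>
     (\<forall>x\<in>carrier A. f (star A x) = star B (f x))}"

lemma star_homD:
  assumes "f \<in> star_hom A B"
  shows "x \<in> carrier A \<Longrightarrow> f x \<in> carrier B"
    and "x \<in> carrier A \<Longrightarrow> y \<in> carrier A \<Longrightarrow> f (x \<oplus>\<^bsub>A\<^esub> y) = f x \<oplus>\<^bsub>B\<^esub> f y"
    and "x \<in> carrier A \<Longrightarrow> y \<in> carrier A \<Longrightarrow> f (x \<otimes>\<^bsub>A\<^esub> y) = f x \<otimes>\<^bsub>B\<^esub> f y"
    and "f \<one>\<^bsub>A\<^esub> = \<one>\<^bsub>B\<^esub>"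
    and "x \<in> carrier A \<Longrightarrow> f (c \<odot>\<^bsub>A\<^esub> x) = c \<odot>\<^bsub>B\<^esub> f x"
    and "x \<in> carrier A \<Longrightarrow> f (star A x) = star B (f x)"
  using assms by (auto simp: star_hom_def ring_hom_def)

lemma star_hom_diff:
  assumes f: "f \<in> star_hom A B" and A: "star_algebra A" and B: "star_algebra B"
    and x: "x \<in> carrier A" and y: "y \<in> carrier A"
  shows "f (x \<ominus>\<^bsub>A\<^esub> y) = f x \<ominus>\<^bsub>B\<^esub> f y"
proof -
  interpret A: star_algebra A by fact
  interpret B: star_algebra B by fact
  have "f (\<ominus>\<^bsub>A\<^esub> y) = \<ominus>\<^bsub>B\<^esub> f y"
    using star_homD(5)[OF f y, of "-1"] star_homD(1)[OF f y] y
    by (simp add: A.smult_minus_one B.smult_minus_one)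
  then show ?thesis using star_homD(2)[OF f x, of "\<ominus>\<^bsub>A\<^esub> y"] y by (simp add: a_minus_def)
qed

context cstar_seminormed_algebra begin

definition conv_to :: "(nat \<Rightarrow> 'a) \<Rightarrow> 'a \<Rightarrow> bool" where
  "conv_to Z a \<longleftrightarrow> (\<forall>n. Z n \<in> carrier A) \<and> a \<in> carrier A \<and> (\<lambda>n. nrm A (Z n \<ominus> a)) \<longlonglongrightarrow> 0"

lemma conv_toI:
  assumes "\<And>n. Z n \<in> carrier A" "a \<in> carrier A" "f \<longlonglongrightarrow> 0" "\<And>n. nrm A (Z n \<ominus> a) \<le> f n"
  shows "conv_to Z a"
proof -
  have e1: "\<forall>\<^sub>F n in sequentially. 0 \<le> nrm A (Z n \<ominus> a)"
    by (intro always_eventually allI) (simp add: assms(1,2))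
  have e2: "\<forall>\<^sub>F n in sequentially. nrm A (Z n \<ominus> a) \<le> f n"
    by (intro always_eventually allI assms)
  have "(\<lambda>n. nrm A (Z n \<ominus> a)) \<longlonglongrightarrow> 0"
    by (rule tendsto_sandwich[OF e1 e2 tendsto_const assms(3)])
  then show ?thesis using assms by (simp add: conv_to_def)
qed

lemma conv_const: "a \<in> carrier A \<Longrightarrow> conv_to (\<lambda>n. a) a"
  by (simp add: conv_to_def a_minus_def r_neg)

lemma conv_add:
  assumes "conv_to Z a" "conv_to W b" shows "conv_to (\<lambda>n. Z n \<oplus> W n) (a \<oplus> b)"
proof (rule conv_toI)
  have c [simp]: "Z n \<in> carrier A" "W n \<in> carrier A" "a \<in> carrier A" "b \<in> carrier A" for n
    using assms by (auto simp: conv_to_def)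
  show "(\<lambda>n. nrm A (Z n \<ominus> a) + nrm A (W n \<ominus> b)) \<longlonglongrightarrow> 0"
    using assms tendsto_add[of "\<lambda>n. nrm A (Z n \<ominus> a)" 0 _ "\<lambda>n. nrm A (W n \<ominus> b)" 0] by (simp add: conv_to_def)
  show "nrm A (Z n \<oplus> W n \<ominus> (a \<oplus> b)) \<le> nrm A (Z n \<ominus> a) + nrm A (W n \<ominus> b)" for n
    by (simp add: add_diff nrm_triangle)
qed (use assms in \<open>auto simp: conv_to_def\<close>)

lemma conv_smult:
  assumes "conv_to Z a" shows "conv_to (\<lambda>n. c \<odot> Z n) (c \<odot> a)"
proof (rule conv_toI)
  have [simp]: "Z n \<in> carrier A" "a \<in> carrier A" for n
    using assms by (auto simp: conv_to_def)
  show "(\<lambda>n. cmod c * nrm A (Z n \<ominus> a)) \<longlonglongrightarrow> 0"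
    using assms by (auto simp: conv_to_def intro: tendsto_mult_right_zero)
  show "nrm A (c \<odot> Z n \<ominus> c \<odot> a) \<le> cmod c * nrm A (Z n \<ominus> a)" for n
    by (simp add: nrm_smult flip: smult_diff)
qed (use assms in \<open>auto simp: conv_to_def\<close>)

lemma conv_star: "conv_to Z a \<Longrightarrow> conv_to (\<lambda>n. star A (Z n)) (star A a)"
  by (simp add: conv_to_def nrm_star flip: star_diff)

lemma conv_nrm:
  assumes "conv_to Z a" shows "(\<lambda>n. nrm A (Z n)) \<longlonglongrightarrow> nrm A a"
proof (rule LIM_zero_cancel, rule tendsto_rabs_zero_cancel)
  have c: "Z n \<in> carrier A" "a \<in> carrier A" for n using assms by (auto simp: conv_to_def)
  have e1: "\<forall>\<^sub>F n in sequentially. 0 \<le> \<bar>nrm A (Z n) - nrm A a\<bar>" by simp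
  have e2: "\<forall>\<^sub>F n in sequentially. \<bar>nrm A (Z n) - nrm A a\<bar> \<le> nrm A (Z n \<ominus> a)"
    by (intro always_eventually allI nrm_reverse_triangle c)
  show "(\<lambda>n. \<bar>nrm A (Z n) - nrm A a\<bar>) \<longlonglongrightarrow> 0"
    using assms by (intro tendsto_sandwich[OF e1 e2 tendsto_const]) (simp add: conv_to_def)
qed

lemma conv_mult:
  assumes "conv_to Z a" "conv_to W b" shows "conv_to (\<lambda>n. Z n \<otimes> W n) (a \<otimes> b)"
proof (rule conv_toI)
  have c [simp]: "Z n \<in> carrier A" "W n \<in> carrier A" "a \<in> carrier A" "b \<in> carrier A" for n
    using assms by (auto simp: conv_to_def)
  have z: "(\<lambda>n. nrm A (Z n \<ominus> a)) \<longlonglongrightarrow> 0" and w: "(\<lambda>n. nrm A (W n \<ominus> b)) \<longlonglongrightarrow> 0"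
    using assms by (auto simp: conv_to_def)
  have "(\<lambda>n. nrm A (Z n \<ominus> a) * nrm A (W n) + nrm A a * nrm A (W n \<ominus> b)) \<longlonglongrightarrow> 0 * nrm A b + nrm A a * 0"
    by (intro tendsto_intros z w conv_nrm[OF assms(2)])
  then show "(\<lambda>n. nrm A (Z n \<ominus> a) * nrm A (W n) + nrm A a * nrm A (W n \<ominus> b)) \<longlonglongrightarrow> 0" by simp
  show "nrm A (Z n \<otimes> W n \<ominus> a \<otimes> b) \<le> nrm A (Z n \<ominus> a) * nrm A (W n) + nrm A a * nrm A (W n \<ominus> b)" for n
    by (rule nrm_mult_diff) simp_all
qed (use assms in \<open>auto simp: conv_to_def\<close>)

end

lemma (in unital_cstar_algebra) conv_unique:
  assumes "conv_to Z a" "conv_to W b" "(\<lambda>n. nrm A (Z n \<ominus> W n)) \<longlonglongrightarrow> 0" shows "a = b"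
proof -
  have c [simp]: "Z n \<in> carrier A" "W n \<in> carrier A" "a \<in> carrier A" "b \<in> carrier A" for n
    using assms by (auto simp: conv_to_def)
  have z: "(\<lambda>n. nrm A (Z n \<ominus> a)) \<longlonglongrightarrow> 0" and w: "(\<lambda>n. nrm A (W n \<ominus> b)) \<longlonglongrightarrow> 0"
    using assms by (auto simp: conv_to_def)
  have lim: "(\<lambda>n. nrm A (Z n \<ominus> a) + (nrm A (Z n \<ominus> W n) + nrm A (W n \<ominus> b))) \<longlonglongrightarrow> 0 + (0 + 0)"
    by (intro tendsto_add z w assms(3))
  have le: "nrm A (a \<ominus> b) \<le> nrm A (Z n \<ominus> a) + (nrm A (Z n \<ominus> W n) + nrm A (W n \<ominus> b))" for n
    using nrm_triangle3[of a "Z n" b] nrm_triangle3[of "Z n" "W n" b] nrm_diff_commute[of a "Z n"] by simp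
  have "nrm A (a \<ominus> b) \<le> 0"
    using LIMSEQ_le_const[OF lim] le by simp
  then have "nrm A (a \<ominus> b) = 0" by (intro antisym) simp_all
  then have "a \<ominus> b = \<zero>" by (intro nrm_definite) simp_all
  moreover have "a = (a \<ominus> b) \<oplus> b" by (simp add: a_minus_def a_assoc l_neg)
  ultimately show ?thesis by (metis c(4) l_zero)
qed

lemma (in unital_cstar_algebra) cauchy_conv:
  assumes "X \<in> cauchy_seqs A" obtains a where "conv_to X a"
  using nrm_complete[OF assms] cauchy_seqsD[OF assms] unfolding conv_to_def by blast

theorem completion_extend:
  assumes A: "cstar_seminormed_algebra A" and B: "unital_cstar_algebra B"
    and f: "f \<in> star_hom A B" and le: "\<And>x. x \<in> carrier A \<Longrightarrow> nrm B (f x) \<le> nrm A x"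
  shows "\<exists>F \<in> star_hom (hausdorff_completion A) B.
           (\<forall>a\<in>carrier A. F (to_completion A a) = f a) \<and>
           (\<forall>C\<in>carrier (hausdorff_completion A). nrm B (F C) \<le> nrm (hausdorff_completion A) C)"
proof -
  interpret A: cstar_seminormed_algebra A by fact
  interpret B: unital_cstar_algebra B by fact
  interpret C: cstar_seminormed_algebra "cauchy_alg A" by (rule A.cauchy_cstar)
  interpret N: star_ideal "null_set (cauchy_alg A)" "cauchy_alg A" by (rule C.null_ideal)
  note fc [simp] = star_homD(1)[OF f]
  have fdiff: "f (x \<ominus>\<^bsub>A\<^esub> y) = f x \<ominus>\<^bsub>B\<^esub> f y" if "x \<in> carrier A" "y \<in> carrier A" for x y
    by (rule star_hom_diff[OF f A.star_algebra_axioms B.star_algebra_axioms that])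
  define L where "L X = (SOME b. B.conv_to (\<lambda>n. f (X n)) b)" for X
  have L: "B.conv_to (\<lambda>n. f (X n)) (L X)" if X: "X \<in> cauchy_seqs A" for X
  proof -
    note [simp] = cauchy_seqsD[OF X]
    have "(\<lambda>n. f (X n)) \<in> cauchy_seqs B"
    proof (rule B.cauchy_seqsI)
      fix e :: real assume "e > 0"
      with X obtain M where M: "\<And>m n. m \<ge> M \<Longrightarrow> n \<ge> M \<Longrightarrow> nrm A (X m \<ominus>\<^bsub>A\<^esub> X n) < e"
        by (rule cauchy_seqsE) blast
      have "nrm B (f (X m) \<ominus>\<^bsub>B\<^esub> f (X n)) < e" if "m \<ge> M" "n \<ge> M" for m n
        using M[OF that] le[of "X m \<ominus>\<^bsub>A\<^esub> X n"] by (simp add: fdiff)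
      then show "\<exists>N. \<forall>m\<ge>N. \<forall>n\<ge>N. nrm B (f (X m) \<ominus>\<^bsub>B\<^esub> f (X n)) < e" by blast
    qed simp
    then obtain b where "B.conv_to (\<lambda>n. f (X n)) b" by (rule B.cauchy_conv)
    then show ?thesis unfolding L_def by (rule someI)
  qed
  have Lc [simp]: "L X \<in> carrier B" if "X \<in> cauchy_seqs A" for X
    using L[OF that] by (simp add: B.conv_to_def)
  have Lu: "L X = b" if "X \<in> cauchy_seqs A" "B.conv_to (\<lambda>n. f (X n)) b" for X b
  proof (rule B.conv_unique[OF L[OF that(1)] that(2)])
    show "(\<lambda>n. nrm B (f (X n) \<ominus>\<^bsub>B\<^esub> f (X n))) \<longlonglongrightarrow> 0"
      using cauchy_seqsD[OF that(1)] by (simp add: a_minus_def B.r_neg)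
  qed
  have Lnull: "L X = L Y" if X: "X \<in> cauchy_seqs A" and Y: "Y \<in> cauchy_seqs A"
    and eq: "null_set (cauchy_alg A) +>\<^bsub>cauchy_alg A\<^esub> X = null_set (cauchy_alg A) +>\<^bsub>cauchy_alg A\<^esub> Y" for X Y
  proof (rule B.conv_unique[OF L[OF X] L[OF Y]])
    note [simp] = cauchy_seqsD[OF X] cauchy_seqsD[OF Y]
    have "X \<ominus>\<^bsub>cauchy_alg A\<^esub> Y \<in> null_set (cauchy_alg A)"
      using eq X Y N.coset_eq_iff[of X Y] by (simp add: A.cauchy_alg_simps)
    then have *: "(\<lambda>n. X n \<ominus>\<^bsub>A\<^esub> Y n) \<in> cauchy_seqs A" "nrm (cauchy_alg A) (\<lambda>n. X n \<ominus>\<^bsub>A\<^esub> Y n) = 0"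
      by (simp_all add: null_set_def A.cauchy_alg_diff[OF X Y] A.cauchy_alg_simps)
    have lim: "(\<lambda>n. nrm A (X n \<ominus>\<^bsub>A\<^esub> Y n)) \<longlonglongrightarrow> 0"
      using A.cauchy_nrm_lim[OF *(1)] *(2) by simp
    have e1: "\<forall>\<^sub>F n in sequentially. 0 \<le> nrm B (f (X n) \<ominus>\<^bsub>B\<^esub> f (Y n))"
      by (intro always_eventually allI) simp
    have e2: "\<forall>\<^sub>F n in sequentially. nrm B (f (X n) \<ominus>\<^bsub>B\<^esub> f (Y n)) \<le> nrm A (X n \<ominus>\<^bsub>A\<^esub> Y n)"
      using le[of "X _ \<ominus>\<^bsub>A\<^esub> Y _"] by (intro always_eventually allI) (simp add: fdiff)
    show "(\<lambda>n. nrm B (f (X n) \<ominus>\<^bsub>B\<^esub> f (Y n))) \<longlonglongrightarrow> 0"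
      by (rule tendsto_sandwich[OF e1 e2 tendsto_const lim])
  qed
  define F where "F K = L (SOME X. X \<in> K)" for K
  have F: "F (null_set (cauchy_alg A) +>\<^bsub>cauchy_alg A\<^esub> X) = L X" if X: "X \<in> cauchy_seqs A" for X
  proof -
    let ?K = "null_set (cauchy_alg A) +>\<^bsub>cauchy_alg A\<^esub> X"
    have XC: "X \<in> carrier (cauchy_alg A)" using X by (simp add: A.cauchy_alg_simps)
    have "(SOME X. X \<in> ?K) \<in> ?K" by (rule someI[of _ X]) (rule N.coset_self[OF XC])
    from N.coset_memD[OF XC this] show ?thesis
      unfolding F_def by (intro Lnull X) (simp_all add: A.cauchy_alg_simps)
  qed
  have car: "carrier (hausdorff_completion A) =
      {null_set (cauchy_alg A) +>\<^bsub>cauchy_alg A\<^esub> X | X. X \<in> cauchy_seqs A}"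
    by (simp add: hausdorff_completion_def N.q_carrier A.cauchy_alg_simps)
  have Ladd: "L (\<lambda>n. X n \<oplus>\<^bsub>A\<^esub> Y n) = L X \<oplus>\<^bsub>B\<^esub> L Y"
    and Lmult: "L (\<lambda>n. X n \<otimes>\<^bsub>A\<^esub> Y n) = L X \<otimes>\<^bsub>B\<^esub> L Y"
    if X: "X \<in> cauchy_seqs A" and Y: "Y \<in> cauchy_seqs A" for X Y
    using B.conv_add[OF L[OF X] L[OF Y]] B.conv_mult[OF L[OF X] L[OF Y]]
      cauchy_seqsD[OF X] cauchy_seqsD[OF Y]
    by (auto intro!: Lu A.cauchy_add A.cauchy_mult X Y simp: star_homD(2,3)[OF f])
  have Lsmult: "L (\<lambda>n. c \<odot>\<^bsub>A\<^esub> X n) = c \<odot>\<^bsub>B\<^esub> L X" and Lstar: "L (\<lambda>n. star A (X n)) = star B (L X)"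
    if X: "X \<in> cauchy_seqs A" for X c
    using B.conv_smult[OF L[OF X]] B.conv_star[OF L[OF X]] cauchy_seqsD[OF X]
    by (auto intro!: Lu A.cauchy_smult A.cauchy_star X simp: star_homD(5,6)[OF f])
  have Lconst: "L (\<lambda>n. a) = f a" if a: "a \<in> carrier A" for a
    using a by (intro Lu A.cauchy_const B.conv_const) simp_all
  have "F \<in> star_hom (hausdorff_completion A) B"
    unfolding star_hom_def ring_hom_def car
    by (auto simp: hausdorff_completion_def A.cauchy_alg_simps N.q_one F A.cauchy_add A.cauchy_mult
        A.cauchy_smult A.cauchy_star Ladd Lmult Lsmult Lstar Lconst A.cauchy_const star_homD(4)[OF f])
  moreover have "F (to_completion A a) = f a" if "a \<in> carrier A" for a
    using that by (simp add: to_completion_def F A.cauchy_const Lconst)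
  moreover have "nrm B (F K) \<le> nrm (hausdorff_completion A) K" if K: "K \<in> carrier (hausdorff_completion A)" for K
  proof -
    obtain X where X: "X \<in> cauchy_seqs A" "K = null_set (cauchy_alg A) +>\<^bsub>cauchy_alg A\<^esub> X"
      using K by (auto simp: car)
    have "nrm B (L X) \<le> nrm (cauchy_alg A) X"
      by (rule LIMSEQ_le[OF B.conv_nrm[OF L[OF X(1)]] A.cauchy_nrm_lim[OF X(1)]])
        (use cauchy_seqsD[OF X(1)] le in blast)
    then show ?thesis using X by (simp add: F hausdorff_completion_def A.cauchy_alg_simps)
  qed
  ultimately show ?thesis by blast
qed

lemma with_norm_simps [simp]:
  "carrier (with_norm A q) = carrier A" "mult (with_norm A q) = mult A" "one (with_norm A q) = one A"
  "zero (with_norm A q) = zero A" "add (with_norm A q) = add A" "smult (with_norm A q) = smult A"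
  "star (with_norm A q) = star A" "nrm (with_norm A q) = q"
  by (simp_all add: with_norm_def star_alg.extend_def normed_star_alg.fields_def)

lemma star_algebra_with_norm:
  assumes "star_algebra A" shows "star_algebra (with_norm A q)"
proof -
  interpret A: star_algebra A by fact
  have "ring (with_norm A q)"
    by (rule ring_cong[OF A.ring_axioms]) simp_all
  then interpret B: ring "with_norm A q" .
  show ?thesis
    by unfold_locales
      (auto simp: A.smult_l_distr A.smult_r_distr A.smult_assoc A.smult_one A.smult_mult_l
         A.smult_mult_r A.star_star A.star_add A.star_smult A.star_mult)
qed

lemma cstar_seminormed_with_norm:
  assumes "star_algebra A" "cstar_seminorm A q"
  shows "cstar_seminormed_algebra (with_norm A q)"
  using star_algebra_with_norm[OF assms(1), of q] assms(2)
  by (simp add: cstar_seminormed_algebra_def cstar_seminormed_algebra_axioms_def cstar_seminorm_def)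

subsection \<open>The free *-algebra\<close>

lemma adj_letter_adj [simp]: "adj_letter (adj_letter l) = l"
  by (cases l) simp_all

lemma base_adj [simp]: "base (adj_letter l) = base l"
  by (cases l) simp_all

lemma adj_word_adj [simp]: "adj_word (adj_word w) = w"
  by (cases w) (simp add: adj_word_def rev_map comp_def)

lemma adj_word_plus: "adj_word (v + w) = adj_word w + adj_word v"
  by (simp add: adj_word_def plus_word_def)

lemma adj_word_zero [simp]: "adj_word 0 = 0"
  by (simp add: adj_word_def zero_word_def)

lemma inj_adj_word: "inj adj_word"
  by (rule inj_on_inverseI[of _ adj_word]) simp

lemma lookup_adj: "Poly_Mapping.lookup (adj_poly x) w = cnj (Poly_Mapping.lookup x (adj_word w))"
  by (simp add: adj_poly_def Poly_Mapping.map.rep_eq map_key.rep_eq[OF inj_adj_word] when_def)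

lemma adj_poly_single [simp]:
  "adj_poly (Poly_Mapping.single w c) = Poly_Mapping.single (adj_word w) (cnj c)"
proof (rule poly_mapping_eqI)
  fix v
  have "w = adj_word v \<longleftrightarrow> adj_word w = v" by auto
  then show "Poly_Mapping.lookup (adj_poly (Poly_Mapping.single w c)) v =
      Poly_Mapping.lookup (Poly_Mapping.single (adj_word w) (cnj c)) v"
    by (simp add: lookup_adj lookup_single when_def)
qed

lemma adj_poly_add: "adj_poly (x + y) = adj_poly x + adj_poly y"
  by (rule poly_mapping_eqI) (simp add: lookup_adj lookup_add)

lemma adj_poly_adj: "adj_poly (adj_poly x) = x"
  by (rule poly_mapping_eqI) (simp add: lookup_adj)

lemma adj_poly_zero [simp]: "adj_poly 0 = 0"
  by (rule poly_mapping_eqI) (simp add: lookup_adj)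

lemma poly_sum_single:
  fixes x :: "'a \<Rightarrow>\<^sub>0 'b::comm_monoid_add"
  shows "x = (\<Sum>w\<in>Poly_Mapping.keys x. Poly_Mapping.single w (Poly_Mapping.lookup x w))"
proof (rule poly_mapping_eqI)
  fix v
  have "Poly_Mapping.lookup (\<Sum>w\<in>Poly_Mapping.keys x. Poly_Mapping.single w (Poly_Mapping.lookup x w)) v =
      (\<Sum>w\<in>Poly_Mapping.keys x. if w = v then Poly_Mapping.lookup x w else 0)"
    by (simp add: lookup_sum lookup_single when_def)
  also have "\<dots> = Poly_Mapping.lookup x v" by (simp add: sum.delta' in_keys_iff)
  finally show "Poly_Mapping.lookup x v =
      Poly_Mapping.lookup (\<Sum>w\<in>Poly_Mapping.keys x. Poly_Mapping.single w (Poly_Mapping.lookup x w)) v" ..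
qed

definition words_over :: "'g set \<Rightarrow> 'g word set" where
  "words_over G = {w. base ` set (letters w) \<subseteq> G}"

lemma free_simps [simp]:
  "mult (free_star_alg G) = (*)" "one (free_star_alg G) = 1" "zero (free_star_alg G) = 0"
  "add (free_star_alg G) = (+)" "smult (free_star_alg G) = (\<lambda>c x. Poly_Mapping.single 0 c * x)"
  "star (free_star_alg G) = adj_poly"
  by (simp_all add: free_star_alg_def)

lemma free_carrier: "x \<in> carrier (free_star_alg G) \<longleftrightarrow> Poly_Mapping.keys x \<subseteq> words_over G"
  by (auto simp: free_star_alg_def words_over_def)

lemma words_over_zero [simp]: "0 \<in> words_over G"
  by (simp add: words_over_def zero_word_def)

lemma words_over_plus: "v \<in> words_over G \<Longrightarrow> w \<in> words_over G \<Longrightarrow> v + w \<in> words_over G"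
  by (auto simp: words_over_def plus_word_def)

lemma words_over_adj: "w \<in> words_over G \<Longrightarrow> adj_word w \<in> words_over G"
  by (auto simp: words_over_def adj_word_def)

lemma free_zero [simp]: "0 \<in> carrier (free_star_alg G)"
  and free_one [simp]: "1 \<in> carrier (free_star_alg G)"
  by (simp_all add: free_carrier)

lemma free_single: "w \<in> words_over G \<Longrightarrow> Poly_Mapping.single w c \<in> carrier (free_star_alg G)"
  by (simp add: free_carrier)

lemma free_add: "x \<in> carrier (free_star_alg G) \<Longrightarrow> y \<in> carrier (free_star_alg G) \<Longrightarrow> x + y \<in> carrier (free_star_alg G)"
  using keys_add[of x y] by (auto simp: free_carrier)

lemma free_mult: "x \<in> carrier (free_star_alg G) \<Longrightarrow> y \<in> carrier (free_star_alg G) \<Longrightarrow> x * y \<in> carrier (free_star_alg G)"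
  using keys_mult[of x y] words_over_plus by (fastforce simp: free_carrier)

lemma free_uminus: "x \<in> carrier (free_star_alg G) \<Longrightarrow> - x \<in> carrier (free_star_alg G)"
  by (simp add: free_carrier)

lemma free_adj: "x \<in> carrier (free_star_alg G) \<Longrightarrow> adj_poly x \<in> carrier (free_star_alg G)"
  unfolding free_carrier
proof
  fix w assume x: "Poly_Mapping.keys x \<subseteq> words_over G" and w: "w \<in> Poly_Mapping.keys (adj_poly x)"
  then have "adj_word w \<in> words_over G" by (auto simp: in_keys_iff lookup_adj)
  from words_over_adj[OF this] show "w \<in> words_over G" by simp
qed

lemma free_induct [consumes 1, case_names zero single add]:
  assumes x: "x \<in> carrier (free_star_alg G)"
    and 0: "P 0" and s: "\<And>w c. w \<in> words_over G \<Longrightarrow> P (Poly_Mapping.single w c)"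
    and a: "\<And>x y. x \<in> carrier (free_star_alg G) \<Longrightarrow> y \<in> carrier (free_star_alg G) \<Longrightarrow> P x \<Longrightarrow> P y \<Longrightarrow> P (x + y)"
  shows "P x"
proof -
  have "W \<subseteq> words_over G \<Longrightarrow>
      P (\<Sum>w\<in>W. Poly_Mapping.single w (Poly_Mapping.lookup x w)) \<and>
      (\<Sum>w\<in>W. Poly_Mapping.single w (Poly_Mapping.lookup x w)) \<in> carrier (free_star_alg G)"
    if "finite W" for W
    using that
  proof (induction W rule: finite_induct)
    case (insert v W)
    then show ?case using s[of v "Poly_Mapping.lookup x v"]
      by (auto intro!: a free_add free_single)
  qed (use 0 in simp)
  from this[of "Poly_Mapping.keys x"] show ?thesis
    using x poly_sum_single[of x] by (simp add: free_carrier)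
qed

lemma free_UNIV: "x \<in> carrier (free_star_alg UNIV)"
  by (simp add: free_carrier words_over_def)

lemma const_commute: "Poly_Mapping.single 0 c * x = x * Poly_Mapping.single 0 c" for x :: "'g star_poly"
  using free_UNIV[of x]
  by (induction x rule: free_induct) (simp_all add: mult_single mult.commute distrib_left distrib_right)

lemma adj_poly_mult: "adj_poly (x * y) = adj_poly y * adj_poly x"
  using free_UNIV[of x]
proof (induction x rule: free_induct)
  case (single w c)
  show ?case using free_UNIV[of y]
    by (induction y rule: free_induct)
      (simp_all add: mult_single adj_word_plus adj_poly_add distrib_left distrib_right mult.commute)
qed (simp_all add: adj_poly_add distrib_left distrib_right)

lemma star_algebra_free: "star_algebra (free_star_alg G)"
proof -
  have "ring (free_star_alg G)"
  proof (rule ringI)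
    show "abelian_group (free_star_alg G)"
    proof (rule abelian_groupI)
      show "\<exists>y\<in>carrier (free_star_alg G). y \<oplus>\<^bsub>free_star_alg G\<^esub> x = \<zero>\<^bsub>free_star_alg G\<^esub>"
        if "x \<in> carrier (free_star_alg G)" for x
        using free_uminus[OF that] by (intro bexI[of _ "- x"]) simp_all
    qed (simp_all add: free_add add.assoc add.commute)
    show "Group.monoid (free_star_alg G)"
      by (rule monoidI) (simp_all add: free_mult mult.assoc)
  qed (simp_all add: distrib_left distrib_right)
  then interpret F: ring "free_star_alg G" .
  show ?thesis
  proof unfold_locales
    fix x y :: "'a star_poly" and c d :: complex
    show "(c + d) \<odot>\<^bsub>free_star_alg G\<^esub> x = c \<odot>\<^bsub>free_star_alg G\<^esub> x \<oplus>\<^bsub>free_star_alg G\<^esub> d \<odot>\<^bsub>free_star_alg G\<^esub> x"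
      by (simp add: single_add distrib_right)
    show "(c * d) \<odot>\<^bsub>free_star_alg G\<^esub> x = c \<odot>\<^bsub>free_star_alg G\<^esub> (d \<odot>\<^bsub>free_star_alg G\<^esub> x)"
      by (simp add: mult_single flip: mult.assoc)
    show "1 \<odot>\<^bsub>free_star_alg G\<^esub> x = x" by simp
    show "x \<otimes>\<^bsub>free_star_alg G\<^esub> (c \<odot>\<^bsub>free_star_alg G\<^esub> y) = c \<odot>\<^bsub>free_star_alg G\<^esub> (x \<otimes>\<^bsub>free_star_alg G\<^esub> y)"
      by (simp add: const_commute mult.assoc)
    show "star (free_star_alg G) (c \<odot>\<^bsub>free_star_alg G\<^esub> x) = cnj c \<odot>\<^bsub>free_star_alg G\<^esub> star (free_star_alg G) x"
      by (simp add: adj_poly_mult const_commute)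
  qed (simp_all add: free_mult free_adj free_single distrib_left mult.assoc adj_poly_adj adj_poly_add adj_poly_mult)
qed

lemma gen_poly_closed [simp]: "g \<in> G \<Longrightarrow> gen_poly g \<in> carrier (free_star_alg G)"
  by (auto simp: gen_poly_def free_carrier words_over_def)

lemma free_minus:
  assumes "x \<in> carrier (free_star_alg G)" "y \<in> carrier (free_star_alg G)"
  shows "x \<ominus>\<^bsub>free_star_alg G\<^esub> y = x - y"
proof -
  interpret F: star_algebra "free_star_alg G" by (rule star_algebra_free)
  have "\<ominus>\<^bsub>free_star_alg G\<^esub> y = - y"
    using assms(2) by (intro F.minus_equality) (simp_all add: free_uminus)
  then show ?thesis by (simp add: a_minus_def)
qed

subsection \<open>Universal C*-algebras\<close>

lemma word_seminorm_le:
  assumes q: "cstar_seminorm (free_star_alg G) q" and g: "\<And>g. g \<in> G \<Longrightarrow> q (gen_poly g) \<le> 1"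
    and w: "w \<in> words_over G"
  shows "q (Poly_Mapping.single w 1) \<le> 1"
proof -
  interpret Q: cstar_seminormed_algebra "with_norm (free_star_alg G) q"
    by (rule cstar_seminormed_with_norm[OF star_algebra_free q])
  have "base ` set ls \<subseteq> G \<Longrightarrow> q (Poly_Mapping.single (Word ls) 1) \<le> 1" for ls
  proof (induction ls)
    case Nil
    show ?case using Q.nrm_one_le by (simp flip: zero_word_def single_one)
  next
    case (Cons l ls)
    have c: "Poly_Mapping.single (Word [l]) 1 \<in> carrier (free_star_alg G)"
      "Poly_Mapping.single (Word ls) 1 \<in> carrier (free_star_alg G)"
      using Cons.prems by (auto simp: free_carrier words_over_def)
    have l: "q (Poly_Mapping.single (Word [l]) 1) \<le> 1"
    proof (cases l)
      case (Gen h)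
      then show ?thesis using g[of h] Cons.prems by (simp add: gen_poly_def)
    next
      case (Adj h)
      then have "Poly_Mapping.single (Word [l]) 1 = adj_poly (gen_poly h)"
        by (simp add: gen_poly_def adj_word_def)
      then show ?thesis using Q.nrm_star[of "gen_poly h"] g[of h] Cons.prems Adj by simp
    qed
    have "Poly_Mapping.single (Word (l # ls)) 1 =
        Poly_Mapping.single (Word [l]) 1 * Poly_Mapping.single (Word ls) (1::complex)"
      by (simp add: mult_single plus_word_def)
    then have "q (Poly_Mapping.single (Word (l # ls)) 1) \<le>
        q (Poly_Mapping.single (Word [l]) 1) * q (Poly_Mapping.single (Word ls) 1)"
      using Q.nrm_mult[OF c[folded with_norm_simps(1)[of _ q]]] by simp
    also have "\<dots> \<le> 1 * 1"
      using l Cons c Q.nrm_nonneg by (intro mult_mono) auto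
    finally show ?case by simp
  qed
  from this[of "letters w"] show ?thesis using w by (simp add: words_over_def)
qed

lemma rel_seminorms_bounded:
  assumes g: "\<And>q g. q \<in> rel_seminorms G R \<Longrightarrow> g \<in> G \<Longrightarrow> q (gen_poly g) \<le> 1"
    and x: "x \<in> carrier (free_star_alg G)"
  shows "\<exists>K. \<forall>q\<in>rel_seminorms G R. q x \<le> K"
  using x
proof (induction x rule: free_induct)
  case zero
  have "q 0 = 0" if "q \<in> rel_seminorms G R" for q
  proof -
    interpret Q: cstar_seminormed_algebra "with_norm (free_star_alg G) q"
      using that by (intro cstar_seminormed_with_norm star_algebra_free) (simp add: rel_seminorms_def)
    show ?thesis using Q.nrm_zero by simp
  qed
  then have "\<forall>q\<in>rel_seminorms G R. q 0 \<le> 0" by (metis order_refl)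
  then show ?case by blast
next
  case (single w c)
  have "q (Poly_Mapping.single w c) \<le> cmod c" if q: "q \<in> rel_seminorms G R" for q
  proof -
    have qs: "cstar_seminorm (free_star_alg G) q" using q by (simp add: rel_seminorms_def)
    interpret Q: cstar_seminormed_algebra "with_norm (free_star_alg G) q"
      by (rule cstar_seminormed_with_norm[OF star_algebra_free qs])
    have "q (Poly_Mapping.single w c) = cmod c * q (Poly_Mapping.single w 1)"
      using Q.nrm_smult[of "Poly_Mapping.single w 1" c] free_single[OF single] by (simp add: mult_single)
    also have "\<dots> \<le> cmod c * 1"
      using word_seminorm_le[OF qs g[OF q] single] by (intro mult_left_mono) simp_all
    finally show ?thesis by simp
  qed
  then show ?case by blast
next
  case (add x y)
  then obtain K L where KL: "\<forall>q\<in>rel_seminorms G R. q x \<le> K" "\<forall>q\<in>rel_seminorms G R. q y \<le> L" by blast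
  have "q (x + y) \<le> K + L" if q: "q \<in> rel_seminorms G R" for q
  proof -
    have "q (x + y) \<le> q x + q y"
      using q add.hyps by (simp add: rel_seminorms_def cstar_seminorm_def)
    then show ?thesis using KL q by force
  qed
  then show ?case by blast
qed

lemma zero_rel_seminorm: "(\<lambda>_. 0) \<in> rel_seminorms G R"
  by (simp add: rel_seminorms_def cstar_seminorm_def)

context
  fixes G :: "'g set" and R :: "'g star_poly set"
  assumes bnd: "\<And>x. x \<in> carrier (free_star_alg G) \<Longrightarrow> \<exists>K. \<forall>q\<in>rel_seminorms G R. q x \<le> K"
begin

lemma universal_bdd: "x \<in> carrier (free_star_alg G) \<Longrightarrow> bdd_above ((\<lambda>q. q x) ` rel_seminorms G R)"
  using bnd by (force simp: bdd_above_def)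

lemma universal_upper:
  "q \<in> rel_seminorms G R \<Longrightarrow> x \<in> carrier (free_star_alg G) \<Longrightarrow> q x \<le> (SUP q\<in>rel_seminorms G R. q x)"
  by (rule cSUP_upper[OF _ universal_bdd])

lemma universal_least:
  "(\<And>q. q \<in> rel_seminorms G R \<Longrightarrow> q x \<le> K) \<Longrightarrow> (SUP q\<in>rel_seminorms G R. q x) \<le> K"
  using zero_rel_seminorm by (intro cSUP_least) auto

lemma universal_seminorm: "cstar_seminorm (free_star_alg G) (\<lambda>x. SUP q\<in>rel_seminorms G R. q x)"
proof -
  interpret F: star_algebra "free_star_alg G" by (rule star_algebra_free)
  let ?A = "free_star_alg G" and ?N = "\<lambda>x. SUP q\<in>rel_seminorms G R. q x"
  have nonneg: "0 \<le> ?N x" if "x \<in> carrier ?A" for x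
    using universal_upper[OF zero_rel_seminorm that] .
  show ?thesis
    unfolding cstar_seminorm_def
  proof (intro conjI ballI allI)
    fix x assume x: "x \<in> carrier ?A"
    show "0 \<le> ?N x" by (rule nonneg[OF x])
    show "?N (c \<odot>\<^bsub>?A\<^esub> x) = cmod c * ?N x" for c
    proof (rule antisym)
      show "?N (c \<odot>\<^bsub>?A\<^esub> x) \<le> cmod c * ?N x"
      proof (rule universal_least)
        fix q assume q: "q \<in> rel_seminorms G R"
        then have "q (c \<odot>\<^bsub>?A\<^esub> x) = cmod c * q x" using x by (simp add: rel_seminorms_def cstar_seminorm_def)
        then show "q (c \<odot>\<^bsub>?A\<^esub> x) \<le> cmod c * ?N x"
          using universal_upper[OF q x] by (simp add: mult_left_mono)
      qed
      have div: "?N x \<le> ?N (c \<odot>\<^bsub>?A\<^esub> x) / cmod c" if "c \<noteq> 0"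
      proof (rule universal_least)
        fix q assume q: "q \<in> rel_seminorms G R"
        have "q (c \<odot>\<^bsub>?A\<^esub> x) = cmod c * q x" using x q by (simp add: rel_seminorms_def cstar_seminorm_def)
        then have "q x * cmod c \<le> ?N (c \<odot>\<^bsub>?A\<^esub> x)"
          using universal_upper[OF q F.smult_closed[OF x, of c]] by (simp only: mult.commute)
        moreover have "cmod c > 0" using that by simp
        ultimately show "q x \<le> ?N (c \<odot>\<^bsub>?A\<^esub> x) / cmod c" by (simp only: pos_le_divide_eq)
      qed
      show "cmod c * ?N x \<le> ?N (c \<odot>\<^bsub>?A\<^esub> x)"
      proof (cases "c = 0")
        case True
        then show ?thesis using nonneg[OF F.smult_closed[OF x, of c]] by simp
      next
        case False
        then have "cmod c > 0" by simp
        with div[OF False] have "?N x * cmod c \<le> ?N (c \<odot>\<^bsub>?A\<^esub> x)" by (simp only: pos_le_divide_eq)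
        then show ?thesis by (simp only: mult.commute)
      qed
    qed
    show "?N (star ?A x \<otimes>\<^bsub>?A\<^esub> x) = (?N x)\<^sup>2"
    proof (rule antisym)
      have *: "q (star ?A x \<otimes>\<^bsub>?A\<^esub> x) = (q x)\<^sup>2" "0 \<le> q x" if "q \<in> rel_seminorms G R" for q
        using that x by (simp_all add: rel_seminorms_def cstar_seminorm_def)
      show "?N (star ?A x \<otimes>\<^bsub>?A\<^esub> x) \<le> (?N x)\<^sup>2"
      proof (rule universal_least)
        fix q assume q: "q \<in> rel_seminorms G R"
        show "q (star ?A x \<otimes>\<^bsub>?A\<^esub> x) \<le> (?N x)\<^sup>2"
          unfolding *(1)[OF q] by (rule power_mono[OF universal_upper[OF q x] *(2)[OF q]])
      qed
      have c: "star ?A x \<otimes>\<^bsub>?A\<^esub> x \<in> carrier ?A" using x by blast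
      have "?N x \<le> sqrt (?N (star ?A x \<otimes>\<^bsub>?A\<^esub> x))"
        by (rule universal_least) (use * universal_upper[OF _ c] in \<open>metis real_le_rsqrt\<close>)
      then have "(?N x)\<^sup>2 \<le> (sqrt (?N (star ?A x \<otimes>\<^bsub>?A\<^esub> x)))\<^sup>2"
        by (rule power_mono) (rule nonneg[OF x])
      then show "(?N x)\<^sup>2 \<le> ?N (star ?A x \<otimes>\<^bsub>?A\<^esub> x)"
        using nonneg[OF c] by (simp only: real_sqrt_pow2)
    qed
    fix y assume y: "y \<in> carrier ?A"
    show "?N (x \<oplus>\<^bsub>?A\<^esub> y) \<le> ?N x + ?N y"
    proof (rule universal_least)
      fix q assume q: "q \<in> rel_seminorms G R"
      have "q (x \<oplus>\<^bsub>?A\<^esub> y) \<le> q x + q y" using x y q by (simp add: rel_seminorms_def cstar_seminorm_def)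
      then show "q (x \<oplus>\<^bsub>?A\<^esub> y) \<le> ?N x + ?N y"
        using universal_upper[OF q x] universal_upper[OF q y] by linarith
    qed
    show "?N (x \<otimes>\<^bsub>?A\<^esub> y) \<le> ?N x * ?N y"
    proof (rule universal_least)
      fix q assume q: "q \<in> rel_seminorms G R"
      have *: "q (x \<otimes>\<^bsub>?A\<^esub> y) \<le> q x * q y" "0 \<le> q x" "0 \<le> q y"
        using x y q by (simp_all add: rel_seminorms_def cstar_seminorm_def)
      have "q x * q y \<le> ?N x * ?N y"
        by (rule mult_mono[OF universal_upper[OF q x] universal_upper[OF q y] nonneg[OF x] *(3)])
      with *(1) show "q (x \<otimes>\<^bsub>?A\<^esub> y) \<le> ?N x * ?N y" by linarith
    qed
  qed
qed

lemma presented_cstar: "cstar_seminormed_algebra (presented_alg G R)"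
  unfolding presented_alg_def
  by (rule cstar_seminormed_with_norm[OF star_algebra_free universal_seminorm])

lemma presented_relation:
  assumes "r \<in> R" "r \<in> carrier (free_star_alg G)" shows "nrm (presented_alg G R) r = 0"
proof -
  have "(SUP q\<in>rel_seminorms G R. q r) \<le> 0"
    by (rule universal_least) (use assms in \<open>simp add: rel_seminorms_def\<close>)
  then show ?thesis
    using universal_upper[OF zero_rel_seminorm assms(2)] by (simp add: presented_alg_def)
qed

theorem universal_cstar_is_cstar: "unital_cstar_algebra (universal_cstar G R)"
  unfolding universal_cstar_def
  by (rule cstar_seminormed_algebra.completion_is_cstar[OF presented_cstar])

theorem universal_cstar_relation:
  assumes "r \<in> R" "r \<in> carrier (free_star_alg G)"
  shows "to_completion (presented_alg G R) r = \<zero>\<^bsub>universal_cstar G R\<^esub>"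
proof -
  interpret P: cstar_seminormed_algebra "presented_alg G R" by (rule presented_cstar)
  interpret U: unital_cstar_algebra "universal_cstar G R" by (rule universal_cstar_is_cstar)
  have r: "r \<in> carrier (presented_alg G R)" using assms(2) by (simp add: presented_alg_def)
  show ?thesis
    using P.nrm_to_completion[OF r] presented_relation[OF assms] P.to_completion_closed[OF r]
    by (intro U.nrm_definite) (simp_all add: universal_cstar_def)
qed

theorem universal_cstar_extend:
  assumes B: "unital_cstar_algebra B" and f: "f \<in> star_hom (free_star_alg G) B"
    and R: "\<And>r. r \<in> R \<Longrightarrow> f r = \<zero>\<^bsub>B\<^esub>"
  shows "\<exists>F\<in>star_hom (universal_cstar G R) B. \<forall>g\<in>G. F (universal_gen G R g) = f (gen_poly g)"
proof -
  interpret B: unital_cstar_algebra B by fact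
  interpret P: cstar_seminormed_algebra "presented_alg G R" by (rule presented_cstar)
  interpret F: star_algebra "free_star_alg G" by (rule star_algebra_free)
  have q: "(\<lambda>x. nrm B (f x)) \<in> rel_seminorms G R"
    unfolding rel_seminorms_def cstar_seminorm_def
    using star_homD[OF f] F.star_closed by (auto simp: R B.nrm_triangle B.nrm_smult B.nrm_mult B.nrm_cstar_id simp del: free_simps)
  have f': "f \<in> star_hom (presented_alg G R) B"
    using f by (simp add: star_hom_def ring_hom_def presented_alg_def)
  have "\<exists>F\<in>star_hom (hausdorff_completion (presented_alg G R)) B.
      (\<forall>a\<in>carrier (presented_alg G R). F (to_completion (presented_alg G R) a) = f a) \<and>
      (\<forall>C\<in>carrier (hausdorff_completion (presented_alg G R)).
          nrm B (F C) \<le> nrm (hausdorff_completion (presented_alg G R)) C)"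
  proof (rule completion_extend[OF presented_cstar B f'])
    fix x assume "x \<in> carrier (presented_alg G R)"
    then have "x \<in> carrier (free_star_alg G)" by (simp add: presented_alg_def)
    from universal_upper[OF q this] show "nrm B (f x) \<le> nrm (presented_alg G R) x"
      by (simp add: presented_alg_def)
  qed
  then obtain F where F: "F \<in> star_hom (hausdorff_completion (presented_alg G R)) B"
    "\<And>a. a \<in> carrier (presented_alg G R) \<Longrightarrow> F (to_completion (presented_alg G R) a) = f a" by blast
  have "F (universal_gen G R g) = f (gen_poly g)" if "g \<in> G" for g
    using F(2)[of "gen_poly g"] that by (simp add: universal_gen_def presented_alg_def)
  then show ?thesis using F(1) unfolding universal_cstar_def by blast
qed

end

subsection \<open>Evaluation of *-polynomials\<close>

context star_algebra begin

primrec ev_letter :: "('g \<Rightarrow> 'a) \<Rightarrow> 'g letter \<Rightarrow> 'a" where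
  "ev_letter b (Gen g) = b g"
| "ev_letter b (Adj g) = star A (b g)"

primrec ev_list :: "('g \<Rightarrow> 'a) \<Rightarrow> 'g letter list \<Rightarrow> 'a" where
  "ev_list b [] = \<one>"
| "ev_list b (l # ls) = ev_letter b l \<otimes> ev_list b ls"

definition ev_word :: "('g \<Rightarrow> 'a) \<Rightarrow> 'g word \<Rightarrow> 'a" where
  "ev_word b w = ev_list b (letters w)"

definition ev_poly :: "('g \<Rightarrow> 'a) \<Rightarrow> 'g star_poly \<Rightarrow> 'a" where
  "ev_poly b x = (\<Oplus>w\<in>Poly_Mapping.keys x. Poly_Mapping.lookup x w \<odot> ev_word b w)"

lemma smult_zero_right [simp]: "c \<odot> \<zero> = \<zero>"
  using smult_r_distr[of \<zero> \<zero> c] by (simp add: add.l_cancel_one')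

lemma smult_left_commute: "x \<in> carrier A \<Longrightarrow> c \<odot> (d \<odot> x) = d \<odot> (c \<odot> x)"
  by (metis mult.commute smult_assoc)

lemma star_zero [simp]: "star A \<zero> = \<zero>"
  using star_smult[of \<zero> 0] by simp

lemma star_one [simp]: "star A \<one> = \<one>"
  by (metis l_one one_closed r_one star_closed star_mult star_star)

context
  fixes G :: "'g set" and b :: "'g \<Rightarrow> 'a"
  assumes b [simp]: "\<And>g. g \<in> G \<Longrightarrow> b g \<in> carrier A"
begin

lemma ev_letter_closed [simp]: "base l \<in> G \<Longrightarrow> ev_letter b l \<in> carrier A"
  by (cases l) auto

lemma ev_list_closed [simp]: "base ` set ls \<subseteq> G \<Longrightarrow> ev_list b ls \<in> carrier A"
  by (induction ls) auto

lemma ev_word_closed [simp]: "w \<in> words_over G \<Longrightarrow> ev_word b w \<in> carrier A"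
  by (simp add: ev_word_def words_over_def)

lemma ev_list_append: "base ` set ls \<subseteq> G \<Longrightarrow> base ` set ms \<subseteq> G \<Longrightarrow>
    ev_list b (ls @ ms) = ev_list b ls \<otimes> ev_list b ms"
  by (induction ls) (auto simp: m_assoc)

lemma ev_letter_adj: "base l \<in> G \<Longrightarrow> ev_letter b (adj_letter l) = star A (ev_letter b l)"
  by (cases l) (auto simp: star_star)

lemma ev_list_adj: "base ` set ls \<subseteq> G \<Longrightarrow>
    ev_list b (rev (map adj_letter ls)) = star A (ev_list b ls)"
proof (induction ls)
  case (Cons l ls)
  have "base ` set (rev (map adj_letter ls)) \<subseteq> G" using Cons.prems by auto
  then show ?case using Cons by (simp add: ev_list_append star_mult ev_letter_adj)
qed simp

lemma ev_word_plus: "v \<in> words_over G \<Longrightarrow> w \<in> words_over G \<Longrightarrow> ev_word b (v + w) = ev_word b v \<otimes> ev_word b w"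
  by (simp add: ev_word_def words_over_def plus_word_def ev_list_append)

lemma ev_word_adj: "w \<in> words_over G \<Longrightarrow> ev_word b (adj_word w) = star A (ev_word b w)"
  by (simp add: ev_word_def words_over_def adj_word_def ev_list_adj)

lemma ev_word_zero [simp]: "ev_word b 0 = \<one>"
  by (simp add: ev_word_def zero_word_def)

lemma ev_poly_superset:
  assumes "finite W" "Poly_Mapping.keys x \<subseteq> W" "W \<subseteq> words_over G"
  shows "ev_poly b x = (\<Oplus>w\<in>W. Poly_Mapping.lookup x w \<odot> ev_word b w)"
  unfolding ev_poly_def
proof (rule add.finprod_mono_neutral_cong_left)
  show "\<And>i. i \<in> W - Poly_Mapping.keys x \<Longrightarrow> Poly_Mapping.lookup x i \<odot> ev_word b i = \<zero>"
    using assms by (auto simp: in_keys_iff)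
qed (use assms in auto)

lemma ev_poly_closed: "x \<in> carrier (free_star_alg G) \<Longrightarrow> ev_poly b x \<in> carrier A"
  unfolding ev_poly_def free_carrier by (rule finsum_closed) auto

lemma ev_poly_zero [simp]: "ev_poly b 0 = \<zero>"
  by (simp add: ev_poly_def)

lemma ev_poly_single:
  assumes w: "w \<in> words_over G" shows "ev_poly b (Poly_Mapping.single w c) = c \<odot> ev_word b w"
proof -
  have "ev_poly b (Poly_Mapping.single w c) =
      (\<Oplus>v\<in>{w}. Poly_Mapping.lookup (Poly_Mapping.single w c) v \<odot> ev_word b v)"
    using w by (intro ev_poly_superset) auto
  also have "\<dots> = c \<odot> ev_word b w" using w by (simp add: lookup_single)
  finally show ?thesis .
qed

lemma ev_poly_add:
  assumes x: "x \<in> carrier (free_star_alg G)" and y: "y \<in> carrier (free_star_alg G)"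
  shows "ev_poly b (x + y) = ev_poly b x \<oplus> ev_poly b y"
proof -
  let ?W = "Poly_Mapping.keys x \<union> Poly_Mapping.keys y"
  have W: "finite ?W" "?W \<subseteq> words_over G" using x y by (auto simp: free_carrier)
  have c: "ev_word b w \<in> carrier A" if "w \<in> ?W" for w using W that by auto
  have "ev_poly b (x + y) = (\<Oplus>w\<in>?W. Poly_Mapping.lookup (x + y) w \<odot> ev_word b w)"
    using W keys_add[of x y] by (intro ev_poly_superset) auto
  also have "\<dots> = (\<Oplus>w\<in>?W. Poly_Mapping.lookup x w \<odot> ev_word b w \<oplus> Poly_Mapping.lookup y w \<odot> ev_word b w)"
    by (rule add.finprod_cong') (use c in \<open>auto simp: lookup_add smult_l_distr\<close>)
  also have "\<dots> = (\<Oplus>w\<in>?W. Poly_Mapping.lookup x w \<odot> ev_word b w) \<oplus> (\<Oplus>w\<in>?W. Poly_Mapping.lookup y w \<odot> ev_word b w)"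
    by (rule finsum_addf) (use c in auto)
  also have "\<dots> = ev_poly b x \<oplus> ev_poly b y"
    using W by (simp add: ev_poly_superset[of ?W x] ev_poly_superset[of ?W y])
  finally show ?thesis .
qed

lemma ev_poly_mult:
  assumes x: "x \<in> carrier (free_star_alg G)" and y: "y \<in> carrier (free_star_alg G)"
  shows "ev_poly b (x * y) = ev_poly b x \<otimes> ev_poly b y"
  using x
proof (induction x rule: free_induct)
  case zero
  show ?case using ev_poly_closed[OF y] by simp
next
  case (single v c)
  show ?case using y
  proof (induction y rule: free_induct)
    case zero
    show ?case using single by (simp add: ev_poly_single)
  next
    case (single w d)
    then show ?case using \<open>v \<in> words_over G\<close>
      by (simp add: mult_single ev_poly_single words_over_plus ev_word_plus smult_mult_l smult_mult_r smult_assoc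
        smult_left_commute)
  next
    case (add x y)
    have s: "Poly_Mapping.single v c \<in> carrier (free_star_alg G)" by (rule free_single[OF single])
    show ?case
      using add s by (simp add: distrib_left ev_poly_add free_mult r_distr ev_poly_closed)
  qed
next
  case (add x z)
  then show ?case using y by (simp add: distrib_right ev_poly_add free_mult l_distr ev_poly_closed)
qed

lemma ev_poly_adj:
  assumes x: "x \<in> carrier (free_star_alg G)"
  shows "ev_poly b (adj_poly x) = star A (ev_poly b x)"
  using x
proof (induction x rule: free_induct)
  case (single w c)
  then show ?case by (simp add: ev_poly_single words_over_adj ev_word_adj star_smult)
next
  case (add x y)
  then show ?case by (simp add: adj_poly_add ev_poly_add free_adj star_add ev_poly_closed)
qed simp

lemma ev_poly_hom: "ev_poly b \<in> star_hom (free_star_alg G) A"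
proof -
  have "ev_poly b (Poly_Mapping.single 0 c * x) = c \<odot> ev_poly b x" if "x \<in> carrier (free_star_alg G)" for c x
    using that by (simp add: ev_poly_mult free_single ev_poly_single smult_mult_l ev_poly_closed)
  moreover have "ev_poly b 1 = \<one>"
    using ev_poly_single[of 0 1] by (simp add: smult_one)
  ultimately show ?thesis
    by (simp add: star_hom_def ring_hom_def ev_poly_closed ev_poly_add ev_poly_mult ev_poly_adj)
qed

lemma ev_poly_gen: "g \<in> G \<Longrightarrow> ev_poly b (gen_poly g) = b g"
  by (simp add: gen_poly_def ev_poly_single words_over_def ev_word_def smult_one)

end

end

subsection \<open>The algebra of a magic unitary\<close>

lemma free_sum: "(\<And>i. i \<in> I \<Longrightarrow> f i \<in> carrier (free_star_alg G)) \<Longrightarrow> sum f I \<in> carrier (free_star_alg G)"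
  by (induction I rule: infinite_finite_induct) (auto intro: free_add)

lemma free_diff: "x \<in> carrier (free_star_alg G) \<Longrightarrow> y \<in> carrier (free_star_alg G) \<Longrightarrow>
    x - y \<in> carrier (free_star_alg G)"
  using free_add[of x G "- y"] free_uminus[of y G] by simp

lemma star_hom_sum:
  assumes f: "f \<in> star_hom (free_star_alg G) B" and B: "star_algebra B" and "finite I"
    and x: "\<And>i. i \<in> I \<Longrightarrow> x i \<in> carrier (free_star_alg G)"
  shows "f (\<Sum>i\<in>I. x i) = (\<Oplus>\<^bsub>B\<^esub>i\<in>I. f (x i))"
proof -
  interpret B: star_algebra B by fact
  have 0: "f 0 = \<zero>\<^bsub>B\<^esub>"
    using star_homD(5)[OF f free_zero, of 0] star_homD(1)[OF f free_zero] by simp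
  show ?thesis using \<open>finite I\<close> x
  proof (induction I rule: finite_induct)
    case (insert i I)
    then show ?case
      using star_homD(2)[OF f, of "x i" "sum x I"] star_homD(1)[OF f]
      by (simp add: free_sum Pi_def)
  qed (simp add: 0)
qed

lemma magic_relations_closed:
  assumes "r \<in> magic_relations V" shows "r \<in> carrier (free_star_alg (V \<times> V))"
  using assms unfolding magic_relations_def Let_def
  by (auto intro!: free_diff free_mult free_adj free_sum gen_poly_closed)

lemma magic_gen_le:
  assumes q: "q \<in> rel_seminorms (V \<times> V) (magic_relations V)" and g: "g \<in> V \<times> V"
  shows "q (gen_poly g) \<le> 1"
proof -
  let ?F = "free_star_alg (V \<times> V)"
  interpret F: star_algebra ?F by (rule star_algebra_free)
  have qs: "cstar_seminorm ?F q" using q by (simp add: rel_seminorms_def)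
  interpret Q: cstar_seminormed_algebra "with_norm ?F q"
    by (rule cstar_seminormed_with_norm[OF star_algebra_free qs])
  obtain i j where ij: "g = (i, j)" "i \<in> V" "j \<in> V" using g by blast
  define u where "u = (gen_poly g :: ('a \<times> 'a) star_poly)"
  have u [simp]: "u \<in> carrier ?F" using g by (simp add: u_def)
  have "adj_poly u - u \<in> magic_relations V" "u * u - u \<in> magic_relations V"
    using ij(2,3) unfolding magic_relations_def Let_def u_def ij(1) by blast+
  then have r: "q (adj_poly u - u) = 0" "q (u * u - u) = 0"
    using q unfolding rel_seminorms_def by blast+
  have c: "adj_poly u - u \<in> carrier ?F" "u * u - u \<in> carrier ?F"
    by (simp_all add: free_diff free_adj free_mult)
  have "(q u)\<^sup>2 = q (adj_poly u * u)" using Q.nrm_cstar_id[of u] by simp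
  also have "adj_poly u * u = (adj_poly u - u) * u + ((u * u - u) + u)" by (simp add: algebra_simps)
  also have "q \<dots> \<le> q ((adj_poly u - u) * u) + q ((u * u - u) + u)"
    using Q.nrm_triangle[of "(adj_poly u - u) * u" "(u * u - u) + u"] c
    by (simp add: free_mult free_add)
  also have "q ((adj_poly u - u) * u) \<le> 0"
    using Q.nrm_mult[of "adj_poly u - u" u] c r by simp
  also have "q ((u * u - u) + u) \<le> q u"
    using Q.nrm_triangle[of "u * u - u" u] c r by simp
  finally have "q u * q u \<le> q u" by (simp add: power2_eq_square)
  then show ?thesis
    using Q.nrm_nonneg[of u] mult_le_cancel_left2[of "q u" "q u"] unfolding u_def[symmetric] by fastforce
qed

lemma A_s_bounded: "x \<in> carrier (free_star_alg (V \<times> V)) \<Longrightarrow>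
    \<exists>K. \<forall>q\<in>rel_seminorms (V \<times> V) (magic_relations V). q x \<le> K"
  using rel_seminorms_bounded[where G = "V \<times> V" and R = "magic_relations V" and x = x] magic_gen_le
  by blast

theorem A_s_is_cstar: "unital_cstar_algebra (A_s V)"
  unfolding A_s_def by (rule universal_cstar_is_cstar[OF A_s_bounded])

lemma to_completion_hom:
  assumes "cstar_seminormed_algebra A"
  shows "to_completion A \<in> star_hom A (hausdorff_completion A)"
proof -
  interpret A: cstar_seminormed_algebra A by fact
  show ?thesis
    by (simp add: star_hom_def ring_hom_def A.to_completion_add A.to_completion_mult A.to_completion_one
        A.to_completion_smult A.to_completion_star)
qed

text \<open>A unital *-homomorphism on the free *-algebra kills the relations iff it sends the
  generators to a magic unitary.\<close>

lemma magic_iff: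
  assumes f: "f \<in> star_hom (free_star_alg (V \<times> V)) B" and B: "star_algebra B" and V: "finite V"
  shows "magic_unitary B V (\<lambda>i j. f (gen_poly (i, j))) \<longleftrightarrow> (\<forall>r\<in>magic_relations V. f r = \<zero>\<^bsub>B\<^esub>)"
proof -
  interpret B: star_algebra B by fact
  let ?F = "free_star_alg (V \<times> V)" and ?u = "\<lambda>i j. gen_poly (i, j)"
  have fc: "f x \<in> carrier B" if "x \<in> carrier ?F" for x using star_homD(1)[OF f that] .
  have fdiff: "f (x - y) = \<zero>\<^bsub>B\<^esub> \<longleftrightarrow> f x = f y" if "x \<in> carrier ?F" "y \<in> carrier ?F" for x y
  proof -
    have "f (x - y) = f x \<ominus>\<^bsub>B\<^esub> f y"
      using star_hom_diff[OF f star_algebra_free B that] by (simp add: free_minus that)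
    moreover have "f x \<ominus>\<^bsub>B\<^esub> f y = \<zero>\<^bsub>B\<^esub> \<longleftrightarrow> f x = f y"
      using fc[OF that(1)] fc[OF that(2)]
      by (metis B.minus_equality a_minus_def B.a_inv_closed B.minus_minus B.r_neg)
    ultimately show ?thesis by simp
  qed
  have fmult: "f (x * y) = f x \<otimes>\<^bsub>B\<^esub> f y" if "x \<in> carrier ?F" "y \<in> carrier ?F" for x y
    using star_homD(3)[OF f that] by simp
  have fadj: "f (adj_poly x) = star B (f x)" if "x \<in> carrier ?F" for x
    using star_homD(6)[OF f that] by simp
  have f1: "f 1 = \<one>\<^bsub>B\<^esub>" using star_homD(4)[OF f] by simp
  have fsum: "f (\<Sum>i\<in>V. x i) = (\<Oplus>\<^bsub>B\<^esub>i\<in>V. f (x i))" if "\<And>i. i \<in> V \<Longrightarrow> x i \<in> carrier ?F" for x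
    using star_hom_sum[OF f B V that] .
  have u: "?u i j \<in> carrier ?F" if "i \<in> V" "j \<in> V" for i j using that by simp
  have us: "(\<Sum>j\<in>V. ?u i j) \<in> carrier ?F" "(\<Sum>j\<in>V. ?u j i) \<in> carrier ?F" if "i \<in> V" for i
    using that by (auto intro!: free_sum)
  have e1: "(\<forall>r\<in>{adj_poly (?u i j) - ?u i j | i j. i \<in> V \<and> j \<in> V}. f r = \<zero>\<^bsub>B\<^esub>) \<longleftrightarrow>
      (\<forall>i\<in>V. \<forall>j\<in>V. star B (f (?u i j)) = f (?u i j))" (is "?l \<longleftrightarrow> _")
  proof -
    have "?l \<longleftrightarrow> (\<forall>i\<in>V. \<forall>j\<in>V. f (adj_poly (?u i j) - ?u i j) = \<zero>\<^bsub>B\<^esub>)" by blast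
    also have "\<dots> \<longleftrightarrow> (\<forall>i\<in>V. \<forall>j\<in>V. star B (f (?u i j)) = f (?u i j))"
      by (intro ball_cong refl) (simp only: fdiff[OF free_adj[OF u] u] fadj[OF u])
    finally show ?thesis .
  qed
  have e2: "(\<forall>r\<in>{?u i j * ?u i j - ?u i j | i j. i \<in> V \<and> j \<in> V}. f r = \<zero>\<^bsub>B\<^esub>) \<longleftrightarrow>
      (\<forall>i\<in>V. \<forall>j\<in>V. f (?u i j) \<otimes>\<^bsub>B\<^esub> f (?u i j) = f (?u i j))" (is "?l \<longleftrightarrow> _")
  proof -
    have "?l \<longleftrightarrow> (\<forall>i\<in>V. \<forall>j\<in>V. f (?u i j * ?u i j - ?u i j) = \<zero>\<^bsub>B\<^esub>)" by blast
    also have "\<dots> \<longleftrightarrow> (\<forall>i\<in>V. \<forall>j\<in>V. f (?u i j) \<otimes>\<^bsub>B\<^esub> f (?u i j) = f (?u i j))"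
      by (intro ball_cong refl) (simp only: fdiff[OF free_mult[OF u u] u] fmult[OF u u])
    finally show ?thesis .
  qed
  have e3: "(\<forall>r\<in>{?u i j * ?u i k | i j k. i \<in> V \<and> j \<in> V \<and> k \<in> V \<and> j \<noteq> k}. f r = \<zero>\<^bsub>B\<^esub>) \<longleftrightarrow>
      (\<forall>i\<in>V. \<forall>j\<in>V. \<forall>k\<in>V. j \<noteq> k \<longrightarrow> f (?u i j) \<otimes>\<^bsub>B\<^esub> f (?u i k) = \<zero>\<^bsub>B\<^esub>)" (is "?l \<longleftrightarrow> _")
  proof -
    have "?l \<longleftrightarrow> (\<forall>i\<in>V. \<forall>j\<in>V. \<forall>k\<in>V. j \<noteq> k \<longrightarrow> f (?u i j * ?u i k) = \<zero>\<^bsub>B\<^esub>)" by blast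
    also have "\<dots> \<longleftrightarrow> (\<forall>i\<in>V. \<forall>j\<in>V. \<forall>k\<in>V. j \<noteq> k \<longrightarrow> f (?u i j) \<otimes>\<^bsub>B\<^esub> f (?u i k) = \<zero>\<^bsub>B\<^esub>)"
      by (intro ball_cong refl) (simp only: fmult[OF u u])
    finally show ?thesis .
  qed
  have e4: "(\<forall>r\<in>{?u j i * ?u k i | i j k. i \<in> V \<and> j \<in> V \<and> k \<in> V \<and> j \<noteq> k}. f r = \<zero>\<^bsub>B\<^esub>) \<longleftrightarrow>
      (\<forall>i\<in>V. \<forall>j\<in>V. \<forall>k\<in>V. j \<noteq> k \<longrightarrow> f (?u j i) \<otimes>\<^bsub>B\<^esub> f (?u k i) = \<zero>\<^bsub>B\<^esub>)" (is "?l \<longleftrightarrow> _")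
  proof -
    have "?l \<longleftrightarrow> (\<forall>i\<in>V. \<forall>j\<in>V. \<forall>k\<in>V. j \<noteq> k \<longrightarrow> f (?u j i * ?u k i) = \<zero>\<^bsub>B\<^esub>)" by blast
    also have "\<dots> \<longleftrightarrow> (\<forall>i\<in>V. \<forall>j\<in>V. \<forall>k\<in>V. j \<noteq> k \<longrightarrow> f (?u j i) \<otimes>\<^bsub>B\<^esub> f (?u k i) = \<zero>\<^bsub>B\<^esub>)"
      by (intro ball_cong refl) (simp only: fmult[OF u u])
    finally show ?thesis .
  qed
  have e5: "(\<forall>r\<in>{(\<Sum>j\<in>V. ?u i j) - 1 | i. i \<in> V}. f r = \<zero>\<^bsub>B\<^esub>) \<longleftrightarrow>
      (\<forall>i\<in>V. (\<Oplus>\<^bsub>B\<^esub>j\<in>V. f (?u i j)) = \<one>\<^bsub>B\<^esub>)" (is "?l \<longleftrightarrow> _")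
  proof -
    have "?l \<longleftrightarrow> (\<forall>i\<in>V. f ((\<Sum>j\<in>V. ?u i j) - 1) = \<zero>\<^bsub>B\<^esub>)" by blast
    also have "\<dots> \<longleftrightarrow> (\<forall>i\<in>V. (\<Oplus>\<^bsub>B\<^esub>j\<in>V. f (?u i j)) = \<one>\<^bsub>B\<^esub>)"
      by (intro ball_cong refl) (simp only: fdiff[OF us(1) free_one] f1 fsum[OF u])
    finally show ?thesis .
  qed
  have e6: "(\<forall>r\<in>{(\<Sum>j\<in>V. ?u j i) - 1 | i. i \<in> V}. f r = \<zero>\<^bsub>B\<^esub>) \<longleftrightarrow>
      (\<forall>i\<in>V. (\<Oplus>\<^bsub>B\<^esub>j\<in>V. f (?u j i)) = \<one>\<^bsub>B\<^esub>)" (is "?l \<longleftrightarrow> _")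
  proof -
    have "?l \<longleftrightarrow> (\<forall>i\<in>V. f ((\<Sum>j\<in>V. ?u j i) - 1) = \<zero>\<^bsub>B\<^esub>)" by blast
    also have "\<dots> \<longleftrightarrow> (\<forall>i\<in>V. (\<Oplus>\<^bsub>B\<^esub>j\<in>V. f (?u j i)) = \<one>\<^bsub>B\<^esub>)"
      by (intro ball_cong refl) (simp only: fdiff[OF us(2) free_one] f1 fsum[OF u])
    finally show ?thesis .
  qed
  have uc: "\<forall>i\<in>V. \<forall>j\<in>V. f (?u i j) \<in> carrier B" using fc u by blast
  show ?thesis
    unfolding magic_relations_def Let_def ball_Un e1 e2 e3 e4 e5 e6 magic_unitary_def
      ball_conj_distrib imp_conjR
    using uc by argo
qed

theorem A_s_magic:
  assumes V: "finite V" shows "magic_unitary (A_s V) V (A_s_gen V)"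
proof -
  let ?G = "V \<times> V" and ?R = "magic_relations V"
  have P: "cstar_seminormed_algebra (presented_alg ?G ?R)" by (rule presented_cstar[OF A_s_bounded])
  have "to_completion (presented_alg ?G ?R) \<in> star_hom (presented_alg ?G ?R) (A_s V)"
    unfolding A_s_def universal_cstar_def by (rule to_completion_hom[OF P])
  then have h: "to_completion (presented_alg ?G ?R) \<in> star_hom (free_star_alg ?G) (A_s V)"
    by (simp add: star_hom_def ring_hom_def presented_alg_def)
  interpret U: unital_cstar_algebra "A_s V" by (rule A_s_is_cstar)
  have "to_completion (presented_alg ?G ?R) r = \<zero>\<^bsub>A_s V\<^esub>" if "r \<in> ?R" for r
    unfolding A_s_def by (rule universal_cstar_relation[OF A_s_bounded that magic_relations_closed[OF that]])
  then have "magic_unitary (A_s V) V (\<lambda>i j. to_completion (presented_alg ?G ?R) (gen_poly (i, j)))"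
    using magic_iff[OF h U.star_algebra_axioms V] by blast
  then show ?thesis by (simp add: A_s_gen_def[abs_def] universal_gen_def)
qed

theorem A_s_universal:
  assumes V: "finite V" and B: "unital_cstar_algebra B" and v: "magic_unitary B V v"
  shows "\<exists>F\<in>star_hom (A_s V) B. \<forall>i\<in>V. \<forall>j\<in>V. F (A_s_gen V i j) = v i j"
proof -
  interpret B: unital_cstar_algebra B by fact
  let ?e = "B.ev_poly (\<lambda>(i, j). v i j)"
  have vc: "(\<lambda>(i, j). v i j) g \<in> carrier B" if "g \<in> V \<times> V" for g
    using v that by (auto simp: magic_unitary_def)
  have e: "?e \<in> star_hom (free_star_alg (V \<times> V)) B" by (rule B.ev_poly_hom[OF vc])
  have g: "?e (gen_poly (i, j)) = v i j" if "i \<in> V" "j \<in> V" for i j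
    using B.ev_poly_gen[OF vc, where g = "(i, j)"] that by simp
  have s: "(\<Oplus>\<^bsub>B\<^esub>j\<in>V. ?e (gen_poly (i, j))) = (\<Oplus>\<^bsub>B\<^esub>j\<in>V. v i j)"
    "(\<Oplus>\<^bsub>B\<^esub>j\<in>V. ?e (gen_poly (j, i))) = (\<Oplus>\<^bsub>B\<^esub>j\<in>V. v j i)" if "i \<in> V" for i
    using that vc by (auto intro!: B.finsum_cong' g)
  have "magic_unitary B V (\<lambda>i j. ?e (gen_poly (i, j))) \<longleftrightarrow> magic_unitary B V v"
    unfolding magic_unitary_def by (simp add: g s cong: ball_cong)
  then have "\<And>r. r \<in> magic_relations V \<Longrightarrow> ?e r = \<zero>\<^bsub>B\<^esub>"
    using magic_iff[OF e B.star_algebra_axioms V] v by blast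
  from universal_cstar_extend[OF A_s_bounded B e this]
  obtain F where "F \<in> star_hom (A_s V) B" "\<forall>g\<in>V \<times> V. F (universal_gen (V \<times> V) (magic_relations V) g) = ?e (gen_poly g)"
    unfolding A_s_def by blast
  then show ?thesis using g by (intro bexI[of _ F]) (auto simp: A_s_gen_def)
qed

subsection \<open>Well-definedness of the quotient\<close>

lemma closed_star_ideal_generated:
  assumes "star_algebra A" "T \<subseteq> carrier A"
  shows "closed_star_ideal A (gen_closed_star_ideal A T)"
proof -
  interpret A: star_algebra A by fact
  have "closed_star_ideal A (carrier A)"
    unfolding closed_star_ideal_def using A.oneideal by simp
  then have ne: "{J. closed_star_ideal A J \<and> T \<subseteq> J} \<noteq> {}" using assms(2) by blast
  have "ideal (gen_closed_star_ideal A T) A"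
    unfolding gen_closed_star_ideal_def
    by (rule A.i_Intersect[OF _ ne]) (auto simp: closed_star_ideal_def)
  then show ?thesis
    unfolding closed_star_ideal_def gen_closed_star_ideal_def by blast
qed

theorem A_graph_star_algebra:
  assumes V: "finite (pverts X)" shows "star_algebra (A_graph X)"
proof -
  interpret U: unital_cstar_algebra "A_s (pverts X)" by (rule A_s_is_cstar)
  have u: "A_s_gen (pverts X) i j \<in> carrier (A_s (pverts X))" if "i \<in> pverts X" "j \<in> pverts X" for i j
    using A_s_magic[OF V] that by (simp add: magic_unitary_def)
  have "graph_relations X \<subseteq> carrier (A_s (pverts X))"
    unfolding graph_relations_def Let_def using u
    by (auto intro!: U.minus_closed U.finsum_closed)
  then have "closed_star_ideal (A_s (pverts X)) (gen_closed_star_ideal (A_s (pverts X)) (graph_relations X))"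
    by (rule closed_star_ideal_generated[OF U.star_algebra_axioms])
  then have "star_ideal (gen_closed_star_ideal (A_s (pverts X)) (graph_relations X)) (A_s (pverts X))"
    by (simp add: star_ideal_def star_ideal_axioms_def closed_star_ideal_def U.star_algebra_axioms)
  then show ?thesis unfolding A_graph_def by (rule star_ideal.star_algebra_quot)
qed

subsection \<open>Circulant graphs are simple graphs\<close>

lemma pair_graph_circulant:
  assumes p: "p \<ge> 3" and ks: "circulant_jumps p ks"
  shows "pair_graph (circulant_graph p ks)"
proof unfold_locales
  have "0 \<notin> connection_set p ks"
  proof
    assume "0 \<in> connection_set p ks"
    then obtain s where s: "s \<in> {1, -1} \<union> set ks \<union> uminus ` set ks" "s mod int p = 0"
      unfolding connection_set_def by (metis (no_types, lifting) imageE)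
    then have "0 < \<bar>s\<bar> \<and> \<bar>s\<bar> < int p" using p ks by (auto simp: circulant_jumps_def)
    moreover have "int p dvd s" using s(2) by (simp add: dvd_eq_mod_eq_0)
    ultimately show False using dvd_imp_le_int[of s "int p"] by auto
  qed
  then show "fst e \<noteq> snd e" if "e \<in> parcs (circulant_graph p ks)" for e
    using that by (auto simp: circulant_graph_def)
  have neg: "(- s) mod int p \<in> connection_set p ks" if "s mod int p \<in> connection_set p ks" for s
  proof -
    obtain t where t: "t \<in> {1, -1} \<union> set ks \<union> uminus ` set ks" "s mod int p = t mod int p"
      using \<open>s mod int p \<in> connection_set p ks\<close> unfolding connection_set_def
      by (metis (no_types, lifting) imageE)
    have "(- s) mod int p = (- t) mod int p" using t(2) by (metis mod_minus_eq)
    moreover have "- t \<in> {1, -1} \<union> set ks \<union> uminus ` set ks" using t(1) by auto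
    ultimately show ?thesis unfolding connection_set_def by (intro image_eqI) auto
  qed
  have "(j, i) \<in> parcs (circulant_graph p ks)" if "(i, j) \<in> parcs (circulant_graph p ks)" for i j
    using that neg[of "j - i"] by (auto simp: circulant_graph_def)
  then show "symmetric (circulant_graph p ks)"
    by (auto simp: symmetric_def sym_def)
  have "parcs (circulant_graph p ks) \<subseteq> {0..<int p} \<times> {0..<int p}"
    by (auto simp: circulant_graph_def)
  then show "finite (parcs (circulant_graph p ks))" by (rule finite_subset) simp
qed (auto simp: circulant_graph_def)

end

theory Submission
  imports Defs "HOL-Number_Theory.Cong"
begin

text \<open>Let \<open>u\<close> be the magic unitary that generates the algebra \<open>A(X)\<close>, and colour the pairs \<open>(a, b)\<close> of vertices
  by the coset of \<open>b - a\<close> modulo the group \<open>E\<close> of multipliers fixing the connection set \<open>S\<close>.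

  The colouring is respected by \<open>u\<close>: if \<open>u i j u k l \<noteq> 0\<close> then \<open>(i, k)\<close> and \<open>(j, l)\<close> have the same colour
  (\<open>nonzero_product_multiplier_equiv\<close>).  Call a matrix \<open>M\<close> invariant if \<open>u i j u k l = 0\<close> whenever
  \<open>M i k \<noteq> M j l\<close>.  The adjacency matrix is invariant, and invariance is preserved by matrix products and by
  functions applied to the entries.  The \<open>q\<close>-th power of a 0/1 circulant, reduced modulo a prime \<open>q \<noteq> p\<close>, is the
  circulant dilated by \<open>q\<close>, by the Frobenius identity in the group ring of \<open>\<int>/p\<close>.  As the primes below \<open>p\<close>
  generate the units, the circulants of all dilates of \<open>S\<close> by units are invariant, and these dilates separate
  the cosets of \<open>E\<close>.

  The hypothesis provides a triangle \<open>(0, 1, w)\<close> which is determined by each of its edges and the colours of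
  its sides; by scaling, every edge \<open>(i, k)\<close> belongs to such a triangle \<open>(i, k, m)\<close>.  If \<open>(j, l)\<close> has the
  colour of \<open>(i, k)\<close> and \<open>(j, l, n)\<close> is the corresponding triangle, then \<open>P = u i j\<close>, \<open>Q = u k l\<close>,
  \<open>R = u m n\<close> satisfy \<open>P Q = P R Q\<close>, \<open>P R = P Q R\<close> and \<open>Q R = Q P R\<close>: insert the row of the missing vertex
  and use uniqueness.  It follows that \<open>P Q\<close> is idempotent (\<open>generator_product_idem\<close>), and likewise \<open>Q P\<close>, whence
  \<open>(P Q - Q P)\<^sup>3 = 0\<close>.

  In a C*-algebra a skew-adjoint nilpotent element vanishes.  Here \<open>A(X)\<close> is a quotient of the C*-algebra
  \<open>A\<^sub>s\<close> by a closed ideal, and the statement required is that a commutator of projections whose cube lies in a closed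
  ideal lies in the ideal itself (\<open>commutator_mem_closed_ideal\<close>).  It has an elementary proof, since the
  commutator is a quarter of \<open>w - w\<^sup>*\<close> for the unitary \<open>w = (2 P - 1) (2 Q - 1)\<close>.  Thus all generators commute
  modulo the ideal, and by density and closedness the quotient is commutative
  (\<open>commutative_quotient_of_A_s\<close>).\<close>


section \<open>Closed ideals in C*-algebras\<close>

lemma closed_star_ideal_star_ideal:
  assumes "star_algebra A" "closed_star_ideal A J" shows "star_ideal J A"
  using assms by (simp add: star_ideal_def star_ideal_axioms_def closed_star_ideal_def)

context star_algebra begin

lemma star_pow: "x \<in> carrier A \<Longrightarrow> star A (x [^] (n::nat)) = star A x [^] n"
  by (induction n) (simp_all add: star_mult flip: nat_pow_Suc2)

end

context cstar_seminormed_algebra begin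

lemma nrm_isometry_le: "w \<in> carrier A \<Longrightarrow> star A w \<otimes> w = \<one> \<Longrightarrow> nrm A w \<le> 1"
  using nrm_cstar_id[of w] nrm_one_le power2_le_imp_le[of "nrm A w" 1] by simp

lemma nrm_pow_le:
  assumes "x \<in> carrier A" "nrm A x \<le> 1" shows "nrm A (x [^] (n::nat)) \<le> 1"
proof (induction n)
  case 0 show ?case using nrm_one_le by simp
next
  case (Suc n)
  have "nrm A (x [^] n) * nrm A x \<le> 1 * 1" using Suc assms by (intro mult_mono) auto
  then show ?case using nrm_mult[of "x [^] n" x] assms by simp
qed

text \<open>If \<open>w = exp (i t)\<close> then \<open>x = i sin t\<close>, so \<open>1 - x\<^sup>* x\<close> is \<open>cos\<^sup>2 t\<close>.  The norm bound
  holds because \<open>1 - x\<^sup>* x\<close> is the average \<open>(1 + 1 + w\<^sup>2 + (w\<^sup>*)\<^sup>2) / 4\<close> of unitaries.\<close>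

lemma one_minus_sine_square_le:
  assumes w: "w \<in> carrier A" and u: "star A w \<otimes> w = \<one>" "w \<otimes> star A w = \<one>"
    and x: "x = (1/2) \<odot> (w \<ominus> star A w)"
  shows "nrm A (\<one> \<ominus> star A x \<otimes> x) \<le> 1"
proof -
  note [simp] = w
  define v where "v = star A w"
  have v [simp]: "v \<in> carrier A" and sv: "star A v = w" and sw: "star A w = v"
    by (simp_all add: v_def star_star)
  have vw: "v \<otimes> w = \<one>" "w \<otimes> v = \<one>" using u by (simp_all add: v_def)
  have nw: "nrm A w \<le> 1" "nrm A v \<le> 1"
    using nrm_isometry_le[of w] nrm_isometry_le[of v] vw by (simp_all add: sw sv)
  have sx: "star A x = (1/2) \<odot> (v \<ominus> w)"
    by (simp add: x star_smult star_diff sv sw)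
  have xx: "star A x \<otimes> x = (1/4) \<odot> ((v \<ominus> w) \<otimes> (w \<ominus> v))"
    unfolding sx unfolding x sw by (simp add: smult_mult_l smult_mult_r flip: smult_assoc)
  have e: "(v \<ominus> w) \<otimes> (w \<ominus> v) = (\<one> \<oplus> \<one>) \<ominus> (w \<otimes> w \<oplus> v \<otimes> v)"
    by (simp add: a_minus_def l_distr r_distr l_minus r_minus vw minus_add a_ac)
  have one4: "\<one> = (1/4) \<odot> (\<one> \<oplus> \<one> \<oplus> (\<one> \<oplus> \<one>))"
  proof -
    have "(1/4) \<odot> (\<one> \<oplus> \<one> \<oplus> (\<one> \<oplus> \<one>)) = (1/4 + 1/4 + (1/4 + 1/4)) \<odot> \<one>"
      by (simp only: smult_l_distr smult_r_distr one_closed add.m_closed)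
    then show ?thesis by (simp add: smult_one)
  qed
  have "\<one> \<ominus> star A x \<otimes> x = (1/4) \<odot> ((\<one> \<oplus> \<one> \<oplus> (\<one> \<oplus> \<one>)) \<ominus> ((\<one> \<oplus> \<one>) \<ominus> (w \<otimes> w \<oplus> v \<otimes> v)))"
    unfolding xx e by (subst one4) (simp add: smult_diff)
  also have "(\<one> \<oplus> \<one> \<oplus> (\<one> \<oplus> \<one>)) \<ominus> ((\<one> \<oplus> \<one>) \<ominus> (w \<otimes> w \<oplus> v \<otimes> v)) = \<one> \<oplus> \<one> \<oplus> (w \<otimes> w \<oplus> v \<otimes> v)"
    by (simp add: a_minus_def minus_add a_assoc r_neg2 r_neg1 r_neg l_neg)
  finally have "nrm A (\<one> \<ominus> star A x \<otimes> x) = 1/4 * nrm A (\<one> \<oplus> \<one> \<oplus> (w \<otimes> w \<oplus> v \<otimes> v))"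
    by (simp add: nrm_smult norm_divide)
  moreover have "nrm A (w \<otimes> w) \<le> 1" "nrm A (v \<otimes> v) \<le> 1"
    using nw nrm_mult[of w w] nrm_mult[of v v]
      mult_mono[of "nrm A w" 1 "nrm A w" 1] mult_mono[of "nrm A v" 1 "nrm A v" 1] by simp_all
  ultimately show ?thesis
    using nrm_one_le nrm_triangle[of "\<one>" "\<one>"] nrm_triangle[of "w \<otimes> w" "v \<otimes> v"]
      nrm_triangle[of "\<one> \<oplus> \<one>" "w \<otimes> w \<oplus> v \<otimes> v"] by simp
qed

text \<open>The quotient of a C*-algebra by a closed ideal has no nonzero element with \<open>x x\<^sup>* x = 0\<close>;
  this is the case in which \<open>1 - x\<^sup>* x\<close> is a contraction.  Put \<open>h = x\<^sup>* x\<close> and let \<open>q\<close> be the average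
  of \<open>(1 - h)\<^sup>i\<close> for \<open>i < n\<close>.  Every power of \<open>h\<close> is killed by \<open>x\<close> modulo the ideal, so \<open>x q\<close> and
  \<open>x\<close> agree modulo the ideal.  On the other hand \<open>h q = (1 - (1 - h)\<^sup>n) / n\<close> telescopes, hence
  \<open>|x q|\<^sup>2 = |q h q| \<le> 2 / n\<close>, and \<open>x\<close> is the limit of the elements \<open>x - x q\<close> of the ideal.\<close>

lemma cube_mem_closed_ideal:
  assumes J: "closed_star_ideal A J" and x: "x \<in> carrier A"
    and le: "nrm A (\<one> \<ominus> star A x \<otimes> x) \<le> 1" and mem: "x \<otimes> (star A x \<otimes> x) \<in> J"
  shows "x \<in> J"
proof -
  interpret J: star_ideal J A by (rule closed_star_ideal_star_ideal[OF star_algebra_axioms J])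
  note [simp] = x
  define h where "h = star A x \<otimes> x"
  define d where "d = \<one> \<ominus> h"
  define s where "s = rec_nat \<zero> (\<lambda>n z. z \<oplus> d [^] (n::nat))"
  have s0: "s 0 = \<zero>" and sS: "s (Suc n) = s n \<oplus> d [^] n" for n by (simp_all add: s_def)
  have h [simp]: "h \<in> carrier A" and d [simp]: "d \<in> carrier A" by (simp_all add: h_def d_def)
  have s [simp]: "s n \<in> carrier A" for n by (induction n) (simp_all add: s0 sS)
  have hd: "h = \<one> \<ominus> d" by (simp add: d_def a_minus_def minus_add r_neg2)
  have sh: "star A h = h" by (simp add: h_def star_mult star_star)
  have sd: "star A d = d" by (simp add: d_def star_diff sh)
  have ss: "star A (s n) = s n" for n
    by (induction n) (simp_all add: s0 sS star_add star_pow sd)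
  have nd: "nrm A (d [^] n) \<le> 1" for n :: nat
    by (rule nrm_pow_le) (use le in \<open>simp_all add: d_def h_def\<close>)
  have ns: "nrm A (s n) \<le> real n" for n
  proof (induction n)
    case (Suc n)
    then show ?case using nrm_triangle[of "s n" "d [^] n"] nd[of n] by (simp add: sS)
  qed (simp add: s0)
  have hs: "h \<otimes> s n = \<one> \<ominus> d [^] n" for n
  proof (induction n)
    case 0 show ?case by (simp add: s0 a_minus_def r_neg)
  next
    case (Suc n)
    have "h \<otimes> s (Suc n) = (\<one> \<ominus> d [^] n) \<oplus> (\<one> \<ominus> d) \<otimes> d [^] n"
      using Suc by (simp add: sS r_distr) (simp add: hd)
    also have "\<dots> = \<one> \<ominus> d \<otimes> d [^] n"
      by (simp add: a_minus_def l_distr l_minus a_assoc r_neg2 r_neg1)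
    also have "d \<otimes> d [^] n = d [^] Suc n" by (simp only: nat_pow_Suc2 d)
    finally show ?case .
  qed
  have nhs: "nrm A (h \<otimes> s n) \<le> 2" for n
    using hs[of n] nrm_diff_triangle[of \<one> "d [^] n"] nd[of n] nrm_one_le by simp
  have nxs: "(nrm A (x \<otimes> s n))\<^sup>2 \<le> 2 * real n" for n
  proof -
    have "star A (x \<otimes> s n) \<otimes> (x \<otimes> s n) = s n \<otimes> (h \<otimes> s n)"
      by (simp add: star_mult ss h_def m_assoc)
    then have "(nrm A (x \<otimes> s n))\<^sup>2 \<le> nrm A (s n) * nrm A (h \<otimes> s n)"
      using nrm_cstar_id[of "x \<otimes> s n"] nrm_mult[of "s n" "h \<otimes> s n"] by simp
    also have "\<dots> \<le> real n * 2" by (intro mult_mono ns nhs) auto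
    finally show ?thesis by simp
  qed
  have xd: "x \<otimes> d [^] n \<ominus> x \<in> J" for n :: nat
  proof (induction n)
    case 0 show ?case using J.I.zero_closed by (simp add: a_minus_def r_neg)
  next
    case (Suc n)
    have "x \<otimes> d [^] Suc n \<ominus> x = (x \<otimes> d [^] n \<ominus> x) \<otimes> d \<oplus> \<ominus> (x \<otimes> h)"
      by (simp add: a_minus_def l_distr l_minus m_assoc d_def r_distr r_minus minus_add a_ac r_neg r_neg1 r_neg2)
    moreover have "x \<otimes> h \<in> J" using mem by (simp add: h_def)
    ultimately show ?case using Suc J.I.I_r_closed J.I.a_inv_closed J.I.a_closed by simp
  qed
  have xs: "x \<otimes> s n \<ominus> of_nat n \<odot> x \<in> J" for n
  proof (induction n)
    case 0 show ?case using J.I.zero_closed by (simp add: a_minus_def s0 r_neg)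
  next
    case (Suc n)
    have "x \<otimes> s (Suc n) \<ominus> of_nat (Suc n) \<odot> x = (x \<otimes> s n \<ominus> of_nat n \<odot> x) \<oplus> (x \<otimes> d [^] n \<ominus> x)"
      by (simp add: sS r_distr add.commute[of 1] smult_l_distr smult_one add_diff)
    then show ?case using Suc xd J.I.a_closed by simp
  qed
  \<comment> \<open>The elements of the ideal that converge to the given one; the index is shifted to avoid a division by zero.\<close>
  define X where "X n = x \<ominus> (1 / of_nat (Suc n)) \<odot> (x \<otimes> s (Suc n))" for n
  have Xc [simp]: "X n \<in> carrier A" for n by (simp add: X_def)
  have XJ: "X n \<in> J" for n
  proof -
    have "(- (1 / of_nat (Suc n))) \<odot> (x \<otimes> s (Suc n) \<ominus> of_nat (Suc n) \<odot> x) \<in> J"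
      using J.smult_mem xs by blast
    also have "(- (1 / of_nat (Suc n))) \<odot> (x \<otimes> s (Suc n) \<ominus> of_nat (Suc n) \<odot> x)
      = (- (1 / of_nat (Suc n))) \<odot> (x \<otimes> s (Suc n)) \<ominus> (-1) \<odot> x"
      by (simp add: smult_diff del: of_nat_Suc flip: smult_assoc)
    also have "(-1) \<odot> x = \<ominus> x" by (rule smult_minus_one) simp
    also have "(- (1 / of_nat (Suc n))) \<odot> (x \<otimes> s (Suc n)) = \<ominus> ((1 / of_nat (Suc n)) \<odot> (x \<otimes> s (Suc n)))"
      using smult_assoc[of "x \<otimes> s (Suc n)" "-1" "1 / of_nat (Suc n)"] by (simp add: smult_minus_one)
    finally show ?thesis by (simp add: X_def a_minus_def a_comm)
  qed
  have "nrm A (X n \<ominus> x) \<le> sqrt (2 / real (Suc n))" for n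
  proof -
    have "nrm A (X n \<ominus> x) = nrm A (x \<otimes> s (Suc n)) / real (Suc n)"
    proof -
      have "X n \<ominus> x = \<ominus> ((1 / of_nat (Suc n)) \<odot> (x \<otimes> s (Suc n)))"
        by (simp add: X_def a_minus_def a_ac r_neg1 r_neg2)
      then show ?thesis by (simp add: nrm_smult norm_divide del: of_nat_Suc)
    qed
    then have "(nrm A (X n \<ominus> x))\<^sup>2 = (nrm A (x \<otimes> s (Suc n)))\<^sup>2 / (real (Suc n))\<^sup>2"
      by (simp add: power_divide)
    also have "\<dots> \<le> 2 * real (Suc n) / (real (Suc n))\<^sup>2"
      by (intro divide_right_mono nxs) simp
    also have "\<dots> = 2 / real (Suc n)" by (simp add: power2_eq_square del: of_nat_Suc)
    finally have "(nrm A (X n \<ominus> x))\<^sup>2 \<le> 2 / real (Suc n)" .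
    then show ?thesis by (rule real_le_rsqrt)
  qed
  moreover have "(\<lambda>n. sqrt (2 / real (Suc n))) \<longlonglongrightarrow> 0"
  proof -
    have "(\<lambda>n. 2 * inverse (real (Suc n))) \<longlonglongrightarrow> 2 * 0"
      by (intro tendsto_mult tendsto_const LIMSEQ_inverse_real_of_nat)
    from tendsto_real_sqrt[OF this] show ?thesis by (simp add: divide_inverse)
  qed
  ultimately have "conv_to X x" by (intro conv_toI[where f = "\<lambda>n. sqrt (2 / real (Suc n))"]) simp_all
  then show ?thesis using J XJ x unfolding closed_star_ideal_def conv_to_def by blast
qed

end

text \<open>Applied below to \<open>a = P Q\<close> and \<open>b = Q P\<close> for projections \<open>P\<close> and \<open>Q\<close> in an algebra where
  \<open>z z\<^sup>* = 0\<close> need not imply \<open>z = 0\<close>: there the idempotence of \<open>P Q\<close> only makes the commutator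
  nilpotent.\<close>

lemma (in ring) difference_of_idempotents_cube:
  assumes [simp]: "a \<in> carrier R" "b \<in> carrier R"
    and a: "a \<otimes> a = a" and b: "b \<otimes> b = b" and aba: "a \<otimes> b \<otimes> a = a" and bab: "b \<otimes> a \<otimes> b = b"
  shows "(a \<ominus> b) \<otimes> ((a \<ominus> b) \<otimes> (a \<ominus> b)) = \<zero>"
proof -
  have [simp]: "a \<otimes> (b \<otimes> a) = a" "b \<otimes> (a \<otimes> b) = b" "a \<otimes> (a \<otimes> b) = a \<otimes> b" "b \<otimes> (b \<otimes> a) = b \<otimes> a"
    using aba bab a b by (simp_all flip: m_assoc)
  have "(a \<ominus> b) \<otimes> (a \<ominus> b) = (a \<oplus> b) \<ominus> (a \<otimes> b \<oplus> b \<otimes> a)"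
    by (simp add: a_minus_def l_distr r_distr l_minus r_minus a b minus_add a_ac)
  moreover have "(a \<ominus> b) \<otimes> ((a \<oplus> b) \<ominus> (a \<otimes> b \<oplus> b \<otimes> a)) = \<zero>"
    by (simp add: a_minus_def l_distr r_distr l_minus r_minus a b minus_add a_ac r_neg r_neg1 r_neg2 l_neg)
  ultimately show ?thesis by simp
qed

text \<open>The symmetries \<open>2 P - 1\<close> and \<open>2 Q - 1\<close> are unitary, hence so is their product \<open>w\<close>, and
  \<open>w - w\<^sup>* = 4 (P Q - Q P)\<close>.  Thus twice the commutator plays the role of \<open>i sin t\<close> above, and it is
  skew-adjoint, so that membership of its cube in the ideal is enough.\<close>

lemma (in cstar_seminormed_algebra) commutator_mem_closed_ideal:
  assumes J: "closed_star_ideal A J"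
    and [simp]: "P \<in> carrier A" "Q \<in> carrier A" and star: "star A P = P" "star A Q = Q"
    and idem: "P \<otimes> P = P" "Q \<otimes> Q = Q"
    and k: "k = P \<otimes> Q \<ominus> Q \<otimes> P" and mem: "k \<otimes> (k \<otimes> k) \<in> J"
  shows "k \<in> J"
proof -
  interpret J: star_ideal J A by (rule closed_star_ideal_star_ideal[OF star_algebra_axioms J])
  have [simp]: "k \<in> carrier A" by (simp add: k)
  define r where "r = P \<oplus> P \<ominus> \<one>"
  define s where "s = Q \<oplus> Q \<ominus> \<one>"
  have [simp]: "r \<in> carrier A" "s \<in> carrier A" by (simp_all add: r_def s_def)
  have rs: "star A r = r" "star A s = s" by (simp_all add: r_def s_def star_diff star_add star)
  have sq: "(x \<oplus> x \<ominus> \<one>) \<otimes> (x \<oplus> x \<ominus> \<one>) = \<one>" if x: "x \<in> carrier A" and "x \<otimes> x = x" for x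
  proof -
    define t where "t = x \<oplus> x"
    have t: "t \<in> carrier A" using x by (simp add: t_def)
    have "t \<otimes> t = t \<oplus> t" using x that(2) by (simp add: t_def l_distr r_distr)
    then have "(t \<ominus> \<one>) \<otimes> t = t" using t by (simp add: a_minus_def l_distr l_minus a_assoc r_neg)
    then have "(t \<ominus> \<one>) \<otimes> (t \<ominus> \<one>) = t \<ominus> (t \<ominus> \<one>)"
      using t r_distr[of t "\<ominus> \<one>" "t \<ominus> \<one>"] by (simp add: a_minus_def r_minus)
    then show ?thesis using t by (simp add: t_def[symmetric] a_minus_def minus_add r_neg2)
  qed
  have rr: "r \<otimes> r = \<one>" "s \<otimes> s = \<one>" using sq idem by (simp_all add: r_def s_def)
  define w where "w = r \<otimes> s"
  have [simp]: "w \<in> carrier A" by (simp add: w_def)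
  have sw: "star A w = s \<otimes> r" by (simp add: w_def star_mult rs)
  have u1: "star A w \<otimes> w = \<one>"
  proof -
    have "star A w \<otimes> w = s \<otimes> (r \<otimes> r) \<otimes> s" unfolding sw unfolding w_def by (simp add: m_assoc)
    then show ?thesis by (simp add: rr)
  qed
  have u2: "w \<otimes> star A w = \<one>"
  proof -
    have "w \<otimes> star A w = r \<otimes> (s \<otimes> s) \<otimes> r" unfolding sw unfolding w_def by (simp add: m_assoc)
    then show ?thesis by (simp add: rr)
  qed
  have "w \<ominus> star A w = (P \<oplus> P) \<otimes> (Q \<oplus> Q) \<ominus> (Q \<oplus> Q) \<otimes> (P \<oplus> P)"
  proof -
    have *: "(a \<ominus> \<one>) \<otimes> (b \<ominus> \<one>) = a \<otimes> b \<oplus> (\<one> \<ominus> (a \<oplus> b))" if "a \<in> carrier A" "b \<in> carrier A" for a b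
      using that by (simp add: a_minus_def l_distr r_distr l_minus r_minus minus_add a_ac)
    have **: "(a \<oplus> c) \<ominus> (b \<oplus> c) = a \<ominus> b" if "a \<in> carrier A" "b \<in> carrier A" "c \<in> carrier A" for a b c
      using that by (simp add: add_diff) (simp add: a_minus_def r_neg)
    show ?thesis unfolding sw unfolding w_def r_def s_def
      by (simp add: * ** a_comm[of "Q \<oplus> Q" "P \<oplus> P"])
  qed
  also have "\<dots> = k \<oplus> k \<oplus> (k \<oplus> k)"
    unfolding k by (simp add: a_minus_def l_distr r_distr minus_add a_ac)
  also have "\<dots> = 4 \<odot> k"
    using smult_l_distr[of k 1 1] smult_l_distr[of k 2 2] by (simp add: smult_one)
  finally have x: "2 \<odot> k = (1/2) \<odot> (w \<ominus> star A w)" by (simp flip: smult_assoc)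
  have sk: "star A k = \<ominus> k"
    by (simp add: k star_diff star_mult star) (simp add: a_minus_def minus_add a_ac)
  have "(2 \<odot> k) \<otimes> (star A (2 \<odot> k) \<otimes> (2 \<odot> k)) = \<ominus> (8 \<odot> (k \<otimes> (k \<otimes> k)))"
    by (simp add: star_smult sk smult_mult_l smult_mult_r l_minus r_minus smult_minus flip: smult_assoc)
  also have "\<dots> \<in> J" using J.smult_mem[OF mem] J.I.a_inv_closed by blast
  finally have "2 \<odot> k \<in> J"
    using cube_mem_closed_ideal[OF J _ one_minus_sine_square_le[OF _ u1 u2 x]] by simp
  from J.smult_mem[OF this, of "1/2"] show ?thesis by (simp add: smult_one flip: smult_assoc)
qed

section \<open>Magic unitaries and invariant matrices\<close>

context star_algebra begin

lemma finsum_eq_single: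
  assumes "finite I" "a \<in> I" "\<And>m. m \<in> I \<Longrightarrow> f m \<in> carrier A" "\<And>m. m \<in> I \<Longrightarrow> m \<noteq> a \<Longrightarrow> f m = \<zero>"
  shows "(\<Oplus>m\<in>I. f m) = f a"
proof -
  have "(\<Oplus>m\<in>I. f m) = (\<Oplus>m\<in>I. if a = m then f m else \<zero>)"
    using assms by (intro finsum_cong') auto
  also have "\<dots> = f a" using assms by (intro finsum_singleton) auto
  finally show ?thesis .
qed

lemma finsum_swap:
  assumes "finite I" "finite K" "\<And>m n. m \<in> I \<Longrightarrow> n \<in> K \<Longrightarrow> f m n \<in> carrier A"
  shows "(\<Oplus>m\<in>I. \<Oplus>n\<in>K. f m n) = (\<Oplus>n\<in>K. \<Oplus>m\<in>I. f m n)"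
  using assms(1,3)
proof (induction I rule: finite_induct)
  case empty show ?case by (simp add: finsum_zero)
next
  case (insert a I)
  have f: "f a n \<in> carrier A" "(\<Oplus>m\<in>I. f m n) \<in> carrier A" if "n \<in> K" for n
    using insert.prems that by (auto intro!: finsum_closed)
  have r: "(\<Oplus>n\<in>K. f m n) \<in> carrier A" if "m \<in> insert a I" for m
    using insert.prems that by (auto intro!: finsum_closed)
  have "(\<Oplus>m\<in>insert a I. \<Oplus>n\<in>K. f m n) = (\<Oplus>n\<in>K. f a n) \<oplus> (\<Oplus>m\<in>I. \<Oplus>n\<in>K. f m n)"
    using insert.hyps r by (intro finsum_insert) auto
  also have "(\<Oplus>m\<in>I. \<Oplus>n\<in>K. f m n) = (\<Oplus>n\<in>K. \<Oplus>m\<in>I. f m n)"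
    by (rule insert.IH) (use insert.prems in blast)
  also have "(\<Oplus>n\<in>K. f a n) \<oplus> (\<Oplus>n\<in>K. \<Oplus>m\<in>I. f m n) = (\<Oplus>n\<in>K. f a n \<oplus> (\<Oplus>m\<in>I. f m n))"
    using f by (intro finsum_addf[symmetric]) auto
  also have "\<dots> = (\<Oplus>n\<in>K. \<Oplus>m\<in>insert a I. f m n)"
  proof (rule finsum_cong'[OF refl])
    show "(\<lambda>n. \<Oplus>m\<in>insert a I. f m n) \<in> K \<rightarrow> carrier A"
      using insert.prems by (blast intro: finsum_closed)
    show "f a n \<oplus> (\<Oplus>m\<in>I. f m n) = (\<Oplus>m\<in>insert a I. f m n)" if "n \<in> K" for n
      using insert.hyps insert.prems that by (intro finsum_insert[symmetric]) auto
  qed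
  finally show ?case .
qed

lemma smult_finsum:
  assumes "finite I" "\<And>m. m \<in> I \<Longrightarrow> f m \<in> carrier A"
  shows "c \<odot> (\<Oplus>m\<in>I. f m) = (\<Oplus>m\<in>I. c \<odot> f m)"
  using assms by (induction I rule: finite_induct) (auto simp: smult_r_distr finsum_closed Pi_def)

lemma sum_smult:
  assumes "finite I" "x \<in> carrier A"
  shows "(\<Sum>m\<in>I. g m) \<odot> x = (\<Oplus>m\<in>I. g m \<odot> x)"
  using assms by (induction I rule: finite_induct) (auto simp: smult_l_distr finsum_closed Pi_def)

lemma smult_cancel:
  assumes x: "x \<in> carrier A" and eq: "c \<odot> x = d \<odot> x" and "c \<noteq> d" shows "x = \<zero>"
proof -
  have "(c - d) \<odot> x = \<zero>"
    using smult_l_distr[OF x, of c "- d"] smult_l_distr[OF x, of d "- d"] eq x by simp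
  then have "(inverse (c - d) * (c - d)) \<odot> x = \<zero>" using x by (simp add: smult_assoc)
  then show ?thesis using \<open>c \<noteq> d\<close> x by (simp add: smult_one)
qed

end

text \<open>The ambient algebra is only a *-algebra, so that the quotient of \<open>A\<^sub>s\<close> by the graph relations is an
  instance.\<close>

locale magic_algebra = star_algebra A for A (structure) +
  fixes V :: "'v set" and u :: "'v \<Rightarrow> 'v \<Rightarrow> 'a"
  assumes fin: "finite V" and magic: "magic_unitary A V u"
begin

lemma u_closed [simp]: "i \<in> V \<Longrightarrow> j \<in> V \<Longrightarrow> u i j \<in> carrier A"
  and u_star: "i \<in> V \<Longrightarrow> j \<in> V \<Longrightarrow> star A (u i j) = u i j"
  and u_idem: "i \<in> V \<Longrightarrow> j \<in> V \<Longrightarrow> u i j \<otimes> u i j = u i j"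
  and u_row: "i \<in> V \<Longrightarrow> j \<in> V \<Longrightarrow> k \<in> V \<Longrightarrow> j \<noteq> k \<Longrightarrow> u i j \<otimes> u i k = \<zero>"
  and u_col: "i \<in> V \<Longrightarrow> j \<in> V \<Longrightarrow> k \<in> V \<Longrightarrow> j \<noteq> k \<Longrightarrow> u j i \<otimes> u k i = \<zero>"
  and row_sum: "i \<in> V \<Longrightarrow> (\<Oplus>j\<in>V. u i j) = \<one>"
  and col_sum: "i \<in> V \<Longrightarrow> (\<Oplus>j\<in>V. u j i) = \<one>"
  using magic by (auto simp: magic_unitary_def)

lemma insert_row:
  assumes "m \<in> V" "a \<in> carrier A" "b \<in> carrier A"
  shows "a \<otimes> b = (\<Oplus>n\<in>V. a \<otimes> u m n \<otimes> b)"
proof -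
  have "a \<otimes> b = a \<otimes> (\<Oplus>n\<in>V. u m n) \<otimes> b" using assms by (simp add: row_sum)
  also have "\<dots> = (\<Oplus>n\<in>V. a \<otimes> u m n \<otimes> b)"
    using assms fin by (subst finsum_rdistr, simp_all add: Pi_def) (subst finsum_ldistr, simp_all add: Pi_def)
  finally show ?thesis .
qed

lemma insert_col:
  assumes "n \<in> V" "a \<in> carrier A" "b \<in> carrier A"
  shows "a \<otimes> b = (\<Oplus>m\<in>V. a \<otimes> u m n \<otimes> b)"
proof -
  have "a \<otimes> b = a \<otimes> (\<Oplus>m\<in>V. u m n) \<otimes> b" using assms by (simp add: col_sum)
  also have "\<dots> = (\<Oplus>m\<in>V. a \<otimes> u m n \<otimes> b)"
    using assms fin by (subst finsum_rdistr, simp_all add: Pi_def) (subst finsum_ldistr, simp_all add: Pi_def)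
  finally show ?thesis .
qed

text \<open>A row sums to 1, so one may insert the whole row between two factors; orthogonality often
  leaves a single entry.\<close>

lemma insert_unique:
  assumes "m \<in> V" "n \<in> V" "a \<in> carrier A" "b \<in> carrier A"
    and "\<And>n'. n' \<in> V \<Longrightarrow> n' \<noteq> n \<Longrightarrow> a \<otimes> u m n' = \<zero> \<or> u m n' \<otimes> b = \<zero>"
  shows "a \<otimes> b = a \<otimes> u m n \<otimes> b"
proof -
  have "a \<otimes> u m n' \<otimes> b = \<zero>" if "n' \<in> V" "n' \<noteq> n" for n'
    using assms(5)[OF that]
  proof
    assume "u m n' \<otimes> b = \<zero>"
    then show ?thesis using assms that by (simp add: m_assoc)
  qed (use assms in simp)
  then show ?thesis
    unfolding insert_row[OF assms(1,3,4)] using assms fin by (intro finsum_eq_single) auto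
qed

text \<open>For complex \<open>M\<close> this is equivalent to \<open>M u = u M\<close>.  The form chosen here makes sense for entries
  of any type and is visibly stable under functions applied entry by entry.\<close>

definition invariant_matrix :: "('v \<Rightarrow> 'v \<Rightarrow> 'c) \<Rightarrow> bool" where
  "invariant_matrix M \<longleftrightarrow> (\<forall>i\<in>V. \<forall>j\<in>V. \<forall>k\<in>V. \<forall>l\<in>V. M i k \<noteq> M j l \<longrightarrow> u i j \<otimes> u k l = \<zero>)"

lemma invariant_matrixD:
  "invariant_matrix M \<Longrightarrow> i \<in> V \<Longrightarrow> j \<in> V \<Longrightarrow> k \<in> V \<Longrightarrow> l \<in> V \<Longrightarrow> M i k \<noteq> M j l \<Longrightarrow> u i j \<otimes> u k l = \<zero>"
  unfolding invariant_matrix_def by blast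

lemma invariant_matrix_comp: "invariant_matrix M \<Longrightarrow> invariant_matrix (\<lambda>i k. f (M i k))"
  unfolding invariant_matrix_def by metis

lemma invariant_matrix_cong: "invariant_matrix M \<Longrightarrow> (\<And>i k. i \<in> V \<Longrightarrow> k \<in> V \<Longrightarrow> N i k = M i k) \<Longrightarrow> invariant_matrix N"
  unfolding invariant_matrix_def by simp

text \<open>Multiplying the intertwiner relation by \<open>u i j\<close> on the left and by \<open>u k l\<close> on the right leaves
  one term on each side, by orthogonality in rows and in columns.\<close>

lemma invariant_matrix_intertwiner:
  assumes eq: "\<And>i l. i \<in> V \<Longrightarrow> l \<in> V \<Longrightarrow> (\<Oplus>m\<in>V. d i m \<odot> u m l) = (\<Oplus>m\<in>V. d m l \<odot> u i m)"
  shows "invariant_matrix d"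
  unfolding invariant_matrix_def
proof (intro ballI impI)
  fix i j k l assume V [simp]: "i \<in> V" "j \<in> V" "k \<in> V" "l \<in> V" and ne: "d i k \<noteq> d j l"
  have "d i k \<odot> (u i j \<otimes> u k l) = u i j \<otimes> (\<Oplus>m\<in>V. d i m \<odot> u m l) \<otimes> u k l"
  proof -
    have "u i j \<otimes> (\<Oplus>m\<in>V. d i m \<odot> u m l) \<otimes> u k l = (\<Oplus>m\<in>V. u i j \<otimes> (d i m \<odot> u m l) \<otimes> u k l)"
      using fin by (subst finsum_rdistr, simp_all add: Pi_def) (subst finsum_ldistr, simp_all add: Pi_def)
    also have "\<dots> = u i j \<otimes> (d i k \<odot> u k l) \<otimes> u k l"
      using fin by (intro finsum_eq_single) (auto simp: m_assoc smult_mult_l smult_mult_r u_col)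
    finally show ?thesis by (simp add: m_assoc smult_mult_l smult_mult_r u_idem)
  qed
  also have "\<dots> = u i j \<otimes> (\<Oplus>m\<in>V. d m l \<odot> u i m) \<otimes> u k l" by (simp add: eq)
  also have "\<dots> = d j l \<odot> (u i j \<otimes> u k l)"
  proof -
    have "u i j \<otimes> (\<Oplus>m\<in>V. d m l \<odot> u i m) \<otimes> u k l = (\<Oplus>m\<in>V. u i j \<otimes> (d m l \<odot> u i m) \<otimes> u k l)"
      using fin by (subst finsum_rdistr, simp_all add: Pi_def) (subst finsum_ldistr, simp_all add: Pi_def)
    also have "\<dots> = u i j \<otimes> (d j l \<odot> u i j) \<otimes> u k l"
      using fin by (intro finsum_eq_single) (auto simp: smult_mult_l smult_mult_r u_row)
    finally show ?thesis by (simp add: smult_mult_l smult_mult_r u_idem)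
  qed
  finally show "u i j \<otimes> u k l = \<zero>" using ne by (intro smult_cancel[where c = "d i k" and d = "d j l"]) auto
qed

text \<open>Insert the double sum of the triple products \<open>u i j u m n u k l\<close>, summing over \<open>n\<close> for fixed
  \<open>m\<close>, or over \<open>m\<close> for fixed \<open>n\<close>.  A nonzero triple product forces \<open>M i m = M j n\<close> and
  \<open>N m k = N n l\<close>, so both entries of the matrix product act on \<open>u i j u k l\<close> in the same way.\<close>

lemma invariant_matrix_mult:
  fixes M N :: "'v \<Rightarrow> 'v \<Rightarrow> int"
  assumes M: "invariant_matrix M" and N: "invariant_matrix N"
  shows "invariant_matrix (\<lambda>i k. \<Sum>m\<in>V. M i m * N m k)"
  unfolding invariant_matrix_def
proof (intro ballI impI)
  fix i j k l assume V [simp]: "i \<in> V" "j \<in> V" "k \<in> V" "l \<in> V"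
    and ne: "(\<Sum>m\<in>V. M i m * N m k) \<noteq> (\<Sum>m\<in>V. M j m * N m l)"
  let ?x = "u i j \<otimes> u k l" and ?T = "\<lambda>m n. u i j \<otimes> u m n \<otimes> u k l"
  let ?a = "\<lambda>m. complex_of_int (M i m * N m k)" and ?b = "\<lambda>n. complex_of_int (M j n * N n l)"
  have T: "?a m \<odot> ?T m n = ?b n \<odot> ?T m n" if "m \<in> V" "n \<in> V" for m n
  proof (cases "M i m = M j n \<and> N m k = N n l")
    case False
    then have "u i j \<otimes> u m n = \<zero> \<or> u m n \<otimes> u k l = \<zero>"
      using invariant_matrixD[OF M, of i j m n] invariant_matrixD[OF N, of m n k l] that by auto
    then have "?T m n = \<zero>"
    proof
      assume "u m n \<otimes> u k l = \<zero>"
      then show ?thesis using that by (simp add: m_assoc)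
    qed simp
    then show ?thesis by (simp only: smult_zero_right)
  qed simp
  have "(\<Sum>m\<in>V. ?a m) \<odot> ?x = (\<Oplus>m\<in>V. \<Oplus>n\<in>V. ?a m \<odot> ?T m n)"
  proof -
    have "(\<Sum>m\<in>V. ?a m) \<odot> ?x = (\<Oplus>m\<in>V. ?a m \<odot> ?x)" using fin by (simp add: sum_smult)
    also have "\<dots> = (\<Oplus>m\<in>V. \<Oplus>n\<in>V. ?a m \<odot> ?T m n)"
    proof (rule finsum_cong'[OF refl])
      show "?a m \<odot> ?x = (\<Oplus>n\<in>V. ?a m \<odot> ?T m n)" if "m \<in> V" for m
        using insert_row[OF that, of "u i j" "u k l"] smult_finsum[OF fin, of "\<lambda>n. ?T m n" "?a m"] that by simp
    qed (auto intro!: finsum_closed)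
    finally show ?thesis .
  qed
  also have "\<dots> = (\<Oplus>m\<in>V. \<Oplus>n\<in>V. ?b n \<odot> ?T m n)"
    by (intro finsum_cong' refl T) (auto intro!: finsum_closed)
  also have "\<dots> = (\<Oplus>n\<in>V. \<Oplus>m\<in>V. ?b n \<odot> ?T m n)"
    using fin by (intro finsum_swap) auto
  also have "\<dots> = (\<Sum>n\<in>V. ?b n) \<odot> ?x"
  proof -
    have "(\<Sum>n\<in>V. ?b n) \<odot> ?x = (\<Oplus>n\<in>V. ?b n \<odot> ?x)" using fin by (simp add: sum_smult)
    also have "\<dots> = (\<Oplus>n\<in>V. \<Oplus>m\<in>V. ?b n \<odot> ?T m n)"
    proof (rule finsum_cong'[OF refl])
      show "?b n \<odot> ?x = (\<Oplus>m\<in>V. ?b n \<odot> ?T m n)" if "n \<in> V" for n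
        using insert_col[OF that, of "u i j" "u k l"] smult_finsum[OF fin, of "\<lambda>m. ?T m n" "?b n"] that by simp
    qed (auto intro!: finsum_closed)
    finally show ?thesis by simp
  qed
  finally have "(\<Sum>m\<in>V. ?a m) \<odot> ?x = (\<Sum>n\<in>V. ?b n) \<odot> ?x" .
  moreover have "(\<Sum>m\<in>V. ?a m) \<noteq> (\<Sum>n\<in>V. ?b n)"
    using ne by (metis of_int_eq_iff of_int_sum)
  ultimately show "?x = \<zero>" by (intro smult_cancel) auto
qed

end

section \<open>The Frobenius identity for circulants\<close>

text \<open>The usual Frobenius identity in characteristic \<open>q\<close>, as a divisibility, so that it can be used
  for integer polynomials.\<close>

lemma freshmans_dream_dvd:
  fixes x y :: "'a::comm_ring_1"
  assumes q: "prime (q::nat)"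
  shows "of_nat q dvd (x + y) ^ q - (x ^ q + y ^ q)"
proof -
  have q0: "q > 0" using q by (simp add: prime_gt_0_nat)
  have "(x + y) ^ q = (\<Sum>k\<le>q. of_nat (q choose k) * x ^ k * y ^ (q - k))" by (rule binomial_ring)
  also have "{..q} = insert 0 (insert q {0<..<q})" using q0 by auto
  also have "(\<Sum>k\<in>\<dots>. of_nat (q choose k) * x ^ k * y ^ (q - k))
      = x ^ q + y ^ q + (\<Sum>k\<in>{0<..<q}. of_nat (q choose k) * x ^ k * y ^ (q - k))"
    using q0 by simp
  finally have "(x + y) ^ q - (x ^ q + y ^ q) = (\<Sum>k\<in>{0<..<q}. of_nat (q choose k) * x ^ k * y ^ (q - k))"
    by simp
  also have "of_nat q dvd \<dots>"
  proof (rule dvd_sum)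
    fix k assume "k \<in> {0<..<q}"
    then have "q dvd q choose k" using q by (intro dvd_choose_prime) auto
    then have "of_nat q dvd (of_nat (q choose k) :: 'a)" by (metis dvd_def of_nat_mult)
    then show "of_nat q dvd of_nat (q choose k) * x ^ k * y ^ (q - k)" by (simp add: dvd_mult2)
  qed
  finally show ?thesis .
qed

lemma freshmans_dream_sum_dvd:
  fixes f :: "'b \<Rightarrow> 'a::comm_ring_1"
  assumes q: "prime (q::nat)" and "finite I"
  shows "of_nat q dvd (\<Sum>i\<in>I. f i) ^ q - (\<Sum>i\<in>I. f i ^ q)"
  using assms(2)
proof (induction I rule: finite_induct)
  case empty
  show ?case using prime_gt_0_nat[OF q] by (simp add: power_0_left)
next
  case (insert a I)
  have "(\<Sum>i\<in>insert a I. f i) ^ q - (\<Sum>i\<in>insert a I. f i ^ q)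
     = ((f a + (\<Sum>i\<in>I. f i)) ^ q - (f a ^ q + (\<Sum>i\<in>I. f i) ^ q)) + ((\<Sum>i\<in>I. f i) ^ q - (\<Sum>i\<in>I. f i ^ q))"
    using insert by simp
  also have "of_nat q dvd \<dots>"
    by (intro dvd_add freshmans_dream_dvd[OF q] insert.IH)
  finally show ?case .
qed

text \<open>The coefficient of \<open>X\<^sup>x\<close> after reduction modulo \<open>X\<^sup>p - 1\<close>: integer polynomials stand for
  elements of the group ring of the cyclic group, whose product is convolution.\<close>

definition cyclic_coeff :: "nat \<Rightarrow> int poly \<Rightarrow> int \<Rightarrow> int" where
  "cyclic_coeff p G x = (\<Sum>n\<le>degree G. if [int n = x] (mod int p) then coeff G n else 0)"

lemma cyclic_coeff_bound:
  "degree G \<le> N \<Longrightarrow> cyclic_coeff p G x = (\<Sum>n\<le>N. if [int n = x] (mod int p) then coeff G n else 0)"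
  unfolding cyclic_coeff_def by (intro sum.mono_neutral_left) (auto simp: coeff_eq_0)

lemma cyclic_coeff_add: "cyclic_coeff p (G + H) x = cyclic_coeff p G x + cyclic_coeff p H x"
proof -
  let ?N = "max (degree G) (degree H)"
  have "cyclic_coeff p (G + H) x = (\<Sum>n\<le>?N. if [int n = x] (mod int p) then coeff (G + H) n else 0)"
    by (intro cyclic_coeff_bound degree_add_le_max)
  then show ?thesis
    by (simp add: cyclic_coeff_bound[of G ?N] cyclic_coeff_bound[of H ?N] flip: sum.distrib)
       (intro sum.cong, auto)
qed

lemma cyclic_coeff_zero [simp]: "cyclic_coeff p 0 x = 0"
  unfolding cyclic_coeff_def by (intro sum.neutral) auto

lemma cyclic_coeff_sum: "cyclic_coeff p (\<Sum>i\<in>I. G i) x = (\<Sum>i\<in>I. cyclic_coeff p (G i) x)"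
  by (induction I rule: infinite_finite_induct) (simp_all add: cyclic_coeff_add)

lemma cyclic_coeff_smult: "cyclic_coeff p (Polynomial.smult c G) x = c * cyclic_coeff p G x"
  by (simp add: cyclic_coeff_bound[of "Polynomial.smult c G" "degree G"] degree_smult_le)
     (simp add: cyclic_coeff_def sum_distrib_left, intro sum.cong, auto)

lemma cyclic_coeff_monom: "cyclic_coeff p (monom c n) x = (if [int n = x] (mod int p) then c else 0)"
proof -
  have "cyclic_coeff p (monom c n) x = (\<Sum>k\<le>n. if k = n then (if [int n = x] (mod int p) then c else 0) else 0)"
    unfolding cyclic_coeff_bound[OF degree_monom_le] by (intro sum.cong) auto
  then show ?thesis by simp
qed

lemma cyclic_coeff_monom_mult: "cyclic_coeff p (monom c n * G) x = c * cyclic_coeff p G (x - int n)"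
proof -
  have mm: "cyclic_coeff p (monom c n * monom d k) x = c * cyclic_coeff p (monom d k) (x - int n)" for d k
    by (simp add: mult_monom cyclic_coeff_monom cong_iff_dvd_diff algebra_simps)
  have G: "G = (\<Sum>k\<le>degree G. monom (coeff G k) k)" by (simp add: poly_as_sum_of_monoms)
  show ?thesis
    by (subst (1 2) G) (simp add: sum_distrib_left cyclic_coeff_sum mm)
qed

lemma cyclic_coeff_cong: "[x = y] (mod int p) \<Longrightarrow> cyclic_coeff p G x = cyclic_coeff p G y"
  unfolding cyclic_coeff_def by (intro sum.cong) (auto simp: cong_def)

definition cyclic_poly :: "nat \<Rightarrow> (int \<Rightarrow> int) \<Rightarrow> int poly" where
  "cyclic_poly p f = (\<Sum>t<p. monom (f (int t)) t)"

lemma cyclic_coeff_poly_mult: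
  "cyclic_coeff p (cyclic_poly p f * G) x = (\<Sum>t<p. f (int t) * cyclic_coeff p G (x - int t))"
  by (simp add: cyclic_poly_def sum_distrib_right cyclic_coeff_sum cyclic_coeff_monom_mult)

text \<open>Modulo the prime \<open>q\<close>, the \<open>q\<close>-th power of \<open>\<Sum>t. f t X\<^sup>t\<close> is \<open>\<Sum>t. f t X\<^bsup>q t\<^esup>\<close>, because
  \<open>f t\<close> is 0 or 1; and the exponent \<open>q t\<close> equals \<open>x\<close> modulo \<open>p\<close> exactly for \<open>t = q' x\<close>.\<close>

lemma frobenius_cyclic_coeff:
  assumes q: "prime q" and per: "\<And>x y. [x = y] (mod int p) \<Longrightarrow> f x = f y" and f01: "\<And>x. f x \<in> {0, 1}"
    and inv: "[int q * q' = 1] (mod int p)" and p: "p > 0"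
  shows "cyclic_coeff p (cyclic_poly p f ^ q) x mod int q = f (q' * x)"
proof -
  have "of_nat q dvd cyclic_poly p f ^ q - (\<Sum>t<p. monom (f (int t)) t ^ q)"
    unfolding cyclic_poly_def by (intro freshmans_dream_sum_dvd q) simp
  then obtain H where H: "cyclic_poly p f ^ q - (\<Sum>t<p. monom (f (int t)) t ^ q) = of_nat q * H" by (rule dvdE)
  have fq: "f y ^ q = f y" for y using f01[of y] prime_gt_0_nat[OF q] by (auto simp: power_0_left)
  define t0 where "t0 = nat ((q' * x) mod int p)"
  have t0: "t0 < p" "int t0 = (q' * x) mod int p" using p by (simp_all add: t0_def nat_less_iff)
  have iff: "[int q * int t = x] (mod int p) \<longleftrightarrow> t = t0" if "t < p" for t
  proof
    assume "[int q * int t = x] (mod int p)"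
    then have "[q' * (int q * int t) = q' * x] (mod int p)" by (rule cong_scalar_left)
    moreover have "[q' * (int q * int t) = int t] (mod int p)"
      using cong_scalar_right[OF inv, of "int t"] by (simp add: algebra_simps)
    ultimately have "[int t = q' * x] (mod int p)" by (metis cong_sym cong_trans)
    then show "t = t0" using that t0 by (simp add: cong_def)
  next
    assume "t = t0"
    then have "[int t = q' * x] (mod int p)" using t0 by simp
    then have "[int q * int t = int q * (q' * x)] (mod int p)" by (rule cong_scalar_left)
    moreover have "[int q * (q' * x) = x] (mod int p)"
      using cong_scalar_right[OF inv, of x] by (simp add: algebra_simps)
    ultimately show "[int q * int t = x] (mod int p)" by (rule cong_trans)
  qed
  have "cyclic_poly p f ^ q = (\<Sum>t<p. monom (f (int t)) (q * t)) + Polynomial.smult (int q) H"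
    using H by (simp add: monom_power fq mult.commute algebra_simps of_nat_poly)
  then have "cyclic_coeff p (cyclic_poly p f ^ q) x =
      (\<Sum>t<p. if [int q * int t = x] (mod int p) then f (int t) else 0) + int q * cyclic_coeff p H x"
    by (simp add: cyclic_coeff_add cyclic_coeff_smult cyclic_coeff_sum cyclic_coeff_monom)
  also have "(\<Sum>t<p. if [int q * int t = x] (mod int p) then f (int t) else 0) = (\<Sum>t<p. if t = t0 then f (int t) else 0)"
    using iff by (intro sum.cong) auto
  also have "\<dots> = f (q' * x)" using t0 per[of "int t0" "q' * x"] by simp
  finally have "cyclic_coeff p (cyclic_poly p f ^ q) x mod int q = f (q' * x) mod int q" by simp
  also have "\<dots> = f (q' * x)" using f01[of "q' * x"] prime_gt_1_nat[OF q] by auto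
  finally show ?thesis .
qed

section \<open>Colours of pairs modulo a prime\<close>

text \<open>For units \<open>x\<close> and \<open>y\<close> modulo \<open>p\<close> this says that \<open>x\<close> and \<open>y\<close> lie in the same coset of the group
  of multipliers that fix \<open>S\<close>: with \<open>e = y / x\<close> and \<open>n = m x\<close> it says that \<open>n\<close> is in \<open>S\<close> iff \<open>e n\<close>
  is, for every unit \<open>n\<close>.  In this form invariance under scaling by units is immediate.\<close>

definition multiplier_equiv :: "nat \<Rightarrow> int set \<Rightarrow> int \<Rightarrow> int \<Rightarrow> bool" where
  "multiplier_equiv p S x y \<longleftrightarrow>
     (\<forall>m. coprime m (int p) \<longrightarrow> ((m * x) mod int p \<in> S \<longleftrightarrow> (m * y) mod int p \<in> S))"

lemma multiplier_equiv_sym: "multiplier_equiv p S x y \<Longrightarrow> multiplier_equiv p S y x"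
  and multiplier_equiv_trans [trans]:
    "multiplier_equiv p S x y \<Longrightarrow> multiplier_equiv p S y z \<Longrightarrow> multiplier_equiv p S x z"
  by (simp_all add: multiplier_equiv_def)

lemma multiplier_equiv_mult:
  assumes "coprime m (int p)" "multiplier_equiv p S x y"
  shows "multiplier_equiv p S (m * x) (m * y)"
  unfolding multiplier_equiv_def
proof (intro allI impI)
  fix n assume "coprime n (int p)"
  with assms(1) have "coprime (n * m) (int p)" by simp
  then have "(n * m * x) mod int p \<in> S \<longleftrightarrow> (n * m * y) mod int p \<in> S"
    using assms(2) unfolding multiplier_equiv_def by blast
  then show "(n * (m * x)) mod int p \<in> S \<longleftrightarrow> (n * (m * y)) mod int p \<in> S"
    by (simp only: mult.assoc)
qed

lemma multiplier_equiv_cong: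
  assumes "[x = x'] (mod int p)" "[y = y'] (mod int p)" "multiplier_equiv p S x y"
  shows "multiplier_equiv p S x' y'"
proof -
  have "(m * x) mod int p = (m * x') mod int p" "(m * y) mod int p = (m * y') mod int p" for m
    using assms(1,2) by (metis cong_def mod_mult_right_eq)+
  then show ?thesis using assms(3) by (simp add: multiplier_equiv_def)
qed

lemma int_inverse_mod:
  assumes "coprime m (int p)"
  obtains m' where "[m * m' = 1] (mod int p)" "coprime m' (int p)"
proof -
  obtain m' where m': "[m * m' = 1] (mod int p)" using cong_solve_coprime_int[OF assms] by blast
  then have "[m' * m = 1] (mod int p)" by (simp add: mult.commute)
  then have "coprime m' (int p)" using coprime_iff_invertible_int by blast
  with m' show ?thesis by (rule that)
qed

lemma multiplier_equiv_cancel: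
  assumes "coprime m (int p)" "multiplier_equiv p S (m * x) (m * y)"
  shows "multiplier_equiv p S x y"
proof -
  obtain m' where m': "[m * m' = 1] (mod int p)" "coprime m' (int p)"
    by (rule int_inverse_mod[OF assms(1)])
  have "[m' * (m * z) = z] (mod int p)" for z
    using cong_scalar_right[OF m'(1), of z] by (simp add: algebra_simps)
  from multiplier_equiv_cong[OF this this multiplier_equiv_mult[OF m'(2) assms(2)]] show ?thesis .
qed

lemma multiplier_equiv_transport:
  assumes "multiplier_equiv p S d d'" "coprime c (int p)" "coprime d' (int p)"
    and "multiplier_equiv p S (d * c) (d' * y)"
  shows "multiplier_equiv p S c y"
proof -
  have "multiplier_equiv p S (d' * c) (d * c)"
    using multiplier_equiv_sym[OF multiplier_equiv_mult[OF assms(2,1)]] by (simp add: mult.commute)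
  then have "multiplier_equiv p S (d' * c) (d' * y)" using assms(4) by (rule multiplier_equiv_trans)
  with assms(3) show ?thesis by (rule multiplier_equiv_cancel)
qed

text \<open>Some multiple of a unit is \<open>1 \<in> S\<close>, whereas all multiples of 0 are \<open>0 \<notin> S\<close>.\<close>

lemma multiplier_equiv_coprime:
  assumes p: "prime p" and S: "1 \<in> S" "0 \<notin> S"
    and y: "coprime y (int p)" and xy: "multiplier_equiv p S x y"
  shows "coprime x (int p)"
proof (rule ccontr)
  assume "\<not> coprime x (int p)"
  moreover have "prime (int p)" using p by simp
  ultimately have "int p dvd x" using prime_imp_coprime[of "int p" x] by (auto simp: coprime_commute)
  obtain m where m: "[y * m = 1] (mod int p)" "coprime m (int p)" by (rule int_inverse_mod[OF y])
  have "(m * y) mod int p = 1"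
    using m(1) prime_gt_1_nat[OF p] by (simp add: cong_def mult.commute)
  then have "(m * x) mod int p \<in> S" using xy m(2) S(1) by (simp add: multiplier_equiv_def)
  then show False using \<open>int p dvd x\<close> S(2) by (simp add: dvd_imp_mod_0)
qed

text \<open>In the colouring of pairs \<open>(a, b)\<close> by the class of \<open>b - a\<close>, the vertex \<open>w\<close> is the only one that
  completes the edge from 0 to 1 to a triangle with the colours of the triangle \<open>(0, 1, w)\<close>.  Since all
  colours have the same valency, each of the other two edges of this triangle has the same property; the
  lemmas below show this by rescaling to the edge from 0 to 1.\<close>

locale unique_triangle =
  fixes p :: nat and S :: "int set" and w :: int
  assumes p: "prime p" and S: "1 \<in> S" "0 \<notin> S"
    and w: "coprime w (int p)" "coprime (w - 1) (int p)"
    and apex_unique: "\<And>x. multiplier_equiv p S x w \<Longrightarrow> multiplier_equiv p S (x - 1) (w - 1) \<Longrightarrow>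
        [x = w] (mod int p)"
begin

abbreviation equiv_mult (infix "\<asymp>" 50) where "x \<asymp> y \<equiv> multiplier_equiv p S x y"

lemma equiv_minus: "x \<asymp> y \<Longrightarrow> - x \<asymp> - y"
  using multiplier_equiv_mult[of "-1" p S x y] by simp

lemma third_vertex_unique:
  assumes "w \<asymp> x" "1 - w \<asymp> 1 - x" shows "[x = w] (mod int p)"
  using apex_unique[of x] assms equiv_minus[OF assms(2)] by (simp add: multiplier_equiv_sym)

lemma second_vertex_unique:
  assumes x1: "1 \<asymp> x" and wx: "w - 1 \<asymp> w - x" shows "[x = 1] (mod int p)"
proof -
  have "coprime x (int p)"
    by (rule multiplier_equiv_coprime[OF p S _ multiplier_equiv_sym[OF x1]]) simp
  then obtain x' where x': "[x * x' = 1] (mod int p)" "coprime x' (int p)" by (rule int_inverse_mod)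
  have e: "x' \<asymp> 1"
    using multiplier_equiv_cong[OF cong_refl x'(1), of S x'] multiplier_equiv_mult[OF x'(2) x1]
    by (simp add: mult.commute)
  have "w * x' \<asymp> w" using multiplier_equiv_mult[OF w(1) e] by simp
  moreover have "w * x' - 1 \<asymp> w - 1"
  proof -
    have "(w - 1) * x' \<asymp> w - 1" using multiplier_equiv_mult[OF w(2) e] by simp
    moreover have "x' * (w - 1) \<asymp> x' * (w - x)" by (rule multiplier_equiv_mult[OF x'(2) wx])
    moreover have "[x' * (w - x) = w * x' - 1] (mod int p)"
      using cong_diff[OF cong_refl x'(1), of "w * x'"] by (simp add: algebra_simps)
    ultimately show ?thesis
      by (metis mult.commute multiplier_equiv_cong[OF cong_refl] multiplier_equiv_sym multiplier_equiv_trans)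
  qed
  ultimately have "[w * x' = w * 1] (mod int p)" using apex_unique by simp
  then have "[x' = 1] (mod int p)" using cong_mult_lcancel[OF w(1)] by blast
  then have "[x * x' = x * 1] (mod int p)" by (rule cong_scalar_left)
  then show ?thesis using x'(1) by (metis cong_sym cong_trans mult.right_neutral)
qed

lemma first_vertex_unique:
  assumes x1: "- 1 \<asymp> x - 1" and wx: "w \<asymp> w - x" shows "[x = 0] (mod int p)"
proof -
  define e where "e = 1 - x"
  have e1: "1 \<asymp> e" using equiv_minus[OF x1] by (simp add: e_def)
  have "coprime e (int p)"
    by (rule multiplier_equiv_coprime[OF p S _ multiplier_equiv_sym[OF e1]]) simp
  then obtain e' where e': "[e * e' = 1] (mod int p)" "coprime e' (int p)" by (rule int_inverse_mod)
  have q: "e' \<asymp> 1"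
    using multiplier_equiv_cong[OF cong_refl e'(1), of S e'] multiplier_equiv_mult[OF e'(2) e1]
    by (simp add: mult.commute)
  have "e' * (w - x) \<asymp> w"
  proof -
    have "e' * w \<asymp> e' * (w - x)" by (rule multiplier_equiv_mult[OF e'(2) wx])
    moreover have "e' * w \<asymp> w" using multiplier_equiv_mult[OF w(1) q] by (simp add: mult.commute)
    ultimately show ?thesis using multiplier_equiv_sym multiplier_equiv_trans by blast
  qed
  moreover have "e' * (w - x) - 1 \<asymp> w - 1"
  proof -
    have "(w - 1) * e' \<asymp> w - 1" using multiplier_equiv_mult[OF w(2) q] by simp
    moreover have "[(w - 1) * e' = e' * (w - x) - 1] (mod int p)"
      using cong_diff[OF cong_refl e'(1), of "e' * (w - x)"] by (simp add: e_def algebra_simps)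
    ultimately show ?thesis using multiplier_equiv_cong[OF _ cong_refl] by blast
  qed
  ultimately have "[e' * (w - x) = w] (mod int p)" by (rule apex_unique)
  then have "[e * (e' * (w - x)) = e * w] (mod int p)" by (rule cong_scalar_left)
  moreover have "[e * (e' * (w - x)) = w - x] (mod int p)"
    using cong_scalar_right[OF e'(1), of "w - x"] by (simp add: algebra_simps)
  ultimately have "[w - x = e * w] (mod int p)" by (metis cong_sym cong_trans)
  then have "int p dvd (w - 1) * x" by (simp add: cong_iff_dvd_diff e_def algebra_simps)
  then have "int p dvd x" using w(2) by (simp add: coprime_commute coprime_dvd_mult_right_iff)
  then show ?thesis by (simp add: cong_0_iff)
qed

end

section \<open>Circulants and cyclically indexed magic unitaries\<close>

text \<open>Write the middle factor \<open>Q R Q\<close> of \<open>P Q = P Q R Q\<close> as \<open>Q P R Q = Q P Q\<close>.\<close>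

lemma (in monoid) triple_sandwich_idem:
  assumes [simp]: "P \<in> carrier G" "Q \<in> carrier G" "R \<in> carrier G"
    and pq: "P \<otimes> Q = P \<otimes> R \<otimes> Q" and pr: "P \<otimes> R = P \<otimes> Q \<otimes> R" and qr: "Q \<otimes> R = Q \<otimes> P \<otimes> R"
  shows "P \<otimes> Q \<otimes> (P \<otimes> Q) = P \<otimes> Q"
proof -
  have "P \<otimes> Q = P \<otimes> Q \<otimes> R \<otimes> Q" using pq pr by simp
  also have "\<dots> = P \<otimes> (Q \<otimes> R) \<otimes> Q" by (simp add: m_assoc)
  also have "\<dots> = P \<otimes> (Q \<otimes> P \<otimes> R) \<otimes> Q" using qr by simp
  also have "\<dots> = P \<otimes> Q \<otimes> (P \<otimes> R \<otimes> Q)" by (simp add: m_assoc)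
  also have "P \<otimes> R \<otimes> Q = P \<otimes> Q" using pq by simp
  finally show ?thesis by simp
qed

locale cyclic_magic_algebra = magic_algebra A "{0..<int p}" u
  for A (structure) and p :: nat and u :: "int \<Rightarrow> int \<Rightarrow> 'a" +
  assumes prime_p: "prime p"
begin

lemma p_pos: "p > 0" using prime_gt_0_nat[OF prime_p] .

definition invariant_circulant :: "(int \<Rightarrow> int) \<Rightarrow> bool" where
  "invariant_circulant f \<longleftrightarrow> invariant_matrix (\<lambda>i k. f (k - i))"

lemma invariant_circulant_delta: "invariant_circulant (cyclic_coeff p 1)"
proof -
  have d: "cyclic_coeff p 1 (k - i) = (if i = k then 1 else 0)" if "i \<in> {0..<int p}" "k \<in> {0..<int p}" for i k
  proof -
    have "[0 = k - i] (mod int p) \<longleftrightarrow> [i = k] (mod int p)"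
      by (simp add: cong_iff_dvd_diff dvd_diff_commute)
    also have "\<dots> \<longleftrightarrow> i = k" using that by (simp add: cong_def)
    finally show ?thesis using cyclic_coeff_monom[of p 1 0 "k - i"] by (simp add: monom_0 flip: one_pCons)
  qed
  show ?thesis
    unfolding invariant_circulant_def invariant_matrix_def
  proof (intro ballI impI)
    fix i j k l assume V: "i \<in> {0..<int p}" "j \<in> {0..<int p}" "k \<in> {0..<int p}" "l \<in> {0..<int p}"
      and ne: "cyclic_coeff p 1 (k - i) \<noteq> cyclic_coeff p 1 (l - j)"
    then have "(i = k) \<noteq> (j = l)" using d by metis
    then show "u i j \<otimes> u k l = \<zero>" using u_row[of i j l] u_col[of j i k] V by auto
  qed
qed

text \<open>Multiplying circulant matrices convolves the functions, which is multiplication of polynomials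
  modulo \<open>X\<^sup>p - 1\<close>.\<close>

lemma invariant_circulant_power:
  assumes per: "\<And>x y. [x = y] (mod int p) \<Longrightarrow> f x = f y" and f: "invariant_circulant f"
  shows "invariant_circulant (cyclic_coeff p (cyclic_poly p f ^ n))"
proof (induction n)
  case 0 show ?case using invariant_circulant_delta by simp
next
  case (Suc n)
  let ?g = "cyclic_coeff p (cyclic_poly p f ^ n)"
  have "invariant_matrix (\<lambda>i k. \<Sum>m\<in>{0..<int p}. f (m - i) * ?g (k - m))"
    using f Suc unfolding invariant_circulant_def by (rule invariant_matrix_mult)
  then show ?case unfolding invariant_circulant_def
  proof (rule invariant_matrix_cong)
    fix i k assume V: "i \<in> {0..<int p}" "k \<in> {0..<int p}"
    have "cyclic_coeff p (cyclic_poly p f ^ Suc n) (k - i) = (\<Sum>t<p. f (int t) * ?g (k - i - int t))"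
      by (simp add: cyclic_coeff_poly_mult)
    also have "\<dots> = (\<Sum>m\<in>{0..<int p}. f (m - i) * ?g (k - m))"
    proof (rule sum.reindex_bij_witness[where i = "\<lambda>m. nat ((m - i) mod int p)" and j = "\<lambda>t. (i + int t) mod int p"])
      fix t assume t: "t \<in> {..<p}"
      then show "(i + int t) mod int p \<in> {0..<int p}" using p_pos by simp
      have "((i + int t) mod int p - i) mod int p = int t"
        using t by (simp add: mod_diff_left_eq)
      then show "nat (((i + int t) mod int p - i) mod int p) = t" by simp
      have "[(i + int t) mod int p - i = int t] (mod int p)"
        using cong_diff[OF cong_mod_left[THEN iffD2, OF cong_refl] cong_refl, of "i + int t" "int p" i] by simp
      moreover have "[k - (i + int t) mod int p = k - i - int t] (mod int p)"
        using cong_diff[OF cong_refl cong_mod_left[THEN iffD2, OF cong_refl], of k "i + int t" "int p"]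
        by (simp add: algebra_simps)
      ultimately show "f ((i + int t) mod int p - i) * ?g (k - (i + int t) mod int p) = f (int t) * ?g (k - i - int t)"
        using per cyclic_coeff_cong by metis
    next
      fix m assume m: "m \<in> {0..<int p}"
      then show "nat ((m - i) mod int p) \<in> {..<p}" using p_pos by (simp add: nat_less_iff)
      show "(i + int (nat ((m - i) mod int p))) mod int p = m"
        using m p_pos by (simp add: mod_add_right_eq)
    qed
    finally show "cyclic_coeff p (cyclic_poly p f ^ Suc n) (k - i) = (\<Sum>m\<in>{0..<int p}. f (m - i) * ?g (k - m))" .
  qed
qed

text \<open>Invariance survives taking the \<open>q\<close>-th power and then reducing the entries modulo \<open>q\<close>; by the
  Frobenius identity the result is the circulant of \<open>f\<close> rescaled by a multiplier.  This is Schur's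
  multiplier argument for rings of circulants.\<close>

lemma invariant_circulant_frobenius:
  assumes q: "prime q" and per: "\<And>x y. [x = y] (mod int p) \<Longrightarrow> f x = f y" and f01: "\<And>x. f x \<in> {0, 1}"
    and inv: "[int q * q' = 1] (mod int p)" and f: "invariant_circulant f"
  shows "invariant_circulant (\<lambda>x. f (q' * x))"
proof -
  have "invariant_circulant (\<lambda>x. cyclic_coeff p (cyclic_poly p f ^ q) x mod int q)"
    using invariant_matrix_comp[OF invariant_circulant_power[OF per f, of q, unfolded invariant_circulant_def],
        of "\<lambda>z. z mod int q"]
    unfolding invariant_circulant_def by simp
  then show ?thesis using frobenius_cyclic_coeff[OF q per f01 inv p_pos] by simp
qed

text \<open>Primes \<open>q\<close> other than \<open>p\<close> are handled by the Frobenius identity, and every unit modulo \<open>p\<close> is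
  represented by a product of such primes.\<close>

lemma invariant_circulant_inverse_multiplier:
  assumes per: "\<And>x y. [x = y] (mod int p) \<Longrightarrow> f x = f y" and f01: "\<And>x. f x \<in> {0, 1}"
    and f: "invariant_circulant f"
  shows "n > 0 \<Longrightarrow> [int n * n' = 1] (mod int p) \<Longrightarrow> invariant_circulant (\<lambda>x. f (n' * x))"
proof (induction n arbitrary: n' rule: less_induct)
  case (less n)
  show ?case
  proof (cases "n = 1")
    case True
    then have "[n' * x = x] (mod int p)" for x
      using cong_scalar_right[of n' 1 "int p" x] less.prems by simp
    then have "(\<lambda>x. f (n' * x)) = f" using per by blast
    then show ?thesis using f by simp
  next
    case False
    then obtain q where q: "prime q" "q dvd n" using prime_factor_nat by blast
    then obtain m where m: "n = q * m" by blast
    then have m': "m > 0" "m < n" using less.prems(1) prime_gt_1_nat[OF q(1)] by auto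
    have im: "[int m * (int q * n') = 1] (mod int p)" and iq: "[int q * (int m * n') = 1] (mod int p)"
      using less.prems(2) by (simp_all add: m algebra_simps)
    have "invariant_circulant (\<lambda>x. f (int q * n' * x))" by (rule less.IH[OF m'(2,1) im])
    from invariant_circulant_frobenius[OF q(1) _ _ iq this]
    have "invariant_circulant (\<lambda>x. f (int q * n' * (int m * n' * x)))"
      using per f01 cong_scalar_left by blast
    moreover have "f (int q * n' * (int m * n' * x)) = f (n' * x)" for x
      using cong_scalar_right[OF iq, of "n' * x"] by (intro per) (simp add: algebra_simps)
    ultimately show ?thesis by simp
  qed
qed

lemma invariant_circulant_multiplier:
  assumes per: "\<And>x y. [x = y] (mod int p) \<Longrightarrow> f x = f y" and f01: "\<And>x. f x \<in> {0, 1}"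
    and f: "invariant_circulant f" and m: "coprime m (int p)"
  shows "invariant_circulant (\<lambda>x. f (m * x))"
proof -
  obtain m' where m': "[m * m' = 1] (mod int p)" by (rule int_inverse_mod[OF m])
  define n where "n = nat (m' mod int p)"
  have n: "int n = m' mod int p" using p_pos by (simp add: n_def)
  have "[int n * m = 1] (mod int p)"
    using m' unfolding n by (simp add: cong_def mod_simps mult.commute)
  moreover from this have "n > 0"
    using prime_gt_1_nat[OF prime_p] by (cases n) (auto simp: cong_def)
  ultimately show ?thesis using invariant_circulant_inverse_multiplier[OF per f01 f] by blast
qed

lemma nonzero_product_multiplier_equiv:
  assumes S: "invariant_circulant (\<lambda>x. if x mod int p \<in> S then 1 else 0)"
    and V: "i \<in> {0..<int p}" "j \<in> {0..<int p}" "k \<in> {0..<int p}" "l \<in> {0..<int p}"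
    and ne: "u i j \<otimes> u k l \<noteq> \<zero>"
  shows "multiplier_equiv p S (k - i) (l - j)"
  unfolding multiplier_equiv_def
proof (intro allI impI)
  fix m assume m: "coprime m (int p)"
  have "invariant_circulant (\<lambda>x. if (m * x) mod int p \<in> S then 1 else 0)"
    by (rule invariant_circulant_multiplier[OF _ _ S m]) (auto simp: cong_def)
  from invariant_matrixD[OF this[unfolded invariant_circulant_def] V]
  have "(if (m * (k - i)) mod int p \<in> S then 1 else 0 :: int) = (if (m * (l - j)) mod int p \<in> S then 1 else 0)"
    using ne by blast
  then show "(m * (k - i)) mod int p \<in> S \<longleftrightarrow> (m * (l - j)) mod int p \<in> S" by (simp split: if_splits)
qed

text \<open>Let \<open>d = k - i\<close> and \<open>d' = l - j\<close> be in the same class and nonzero, and place the third vertices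
  \<open>m = i + d w\<close> and \<open>n = j + d' w\<close> of the rescaled triangles.  Inserting row \<open>m\<close> between \<open>u i j\<close> and
  \<open>u k l\<close> leaves only column \<open>n\<close>, because a column that contributes completes the edge from \<open>j\<close> to \<open>l\<close>
  to a triangle with the right colours.  In the same way row \<open>k\<close> may be inserted between \<open>u i j\<close> and
  \<open>u m n\<close>, and row \<open>i\<close> between \<open>u k l\<close> and \<open>u m n\<close>.\<close>

lemma generator_product_idem:
  assumes T: "unique_triangle p S w"
    and inv: "invariant_circulant (\<lambda>x. if x mod int p \<in> S then 1 else 0)"
    and V: "i \<in> {0..<int p}" "j \<in> {0..<int p}" "k \<in> {0..<int p}" "l \<in> {0..<int p}"
  shows "u i j \<otimes> u k l \<otimes> (u i j \<otimes> u k l) = u i j \<otimes> u k l"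
proof (cases "u i j \<otimes> u k l = \<zero> \<or> i = k \<and> j = l")
  case True
  then show ?thesis using V u_idem by auto
next
  case False
  interpret T: unique_triangle p S w by (rule T)
  note [simp] = V
  have unit: "coprime (b - a) (int p)" if "a \<in> {0..<int p}" "b \<in> {0..<int p}" "a \<noteq> b" for a b
  proof -
    have "\<not> int p dvd b - a" using that by (auto simp: mod_eq_dvd_iff [symmetric])
    then show ?thesis using prime_p prime_imp_coprime[of "int p" "b - a"] by (auto simp: coprime_commute)
  qed
  have "i \<noteq> k" "j \<noteq> l" using False u_row[OF V(1,2,4)] u_col[OF V(2,1,3)] by auto
  define d where "d = k - i"
  define d' where "d' = l - j"
  have d: "coprime d (int p)" "coprime d' (int p)"
    using unit V \<open>i \<noteq> k\<close> \<open>j \<noteq> l\<close> by (simp_all add: d_def d'_def)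
  have dd: "multiplier_equiv p S d d'"
    using nonzero_product_multiplier_equiv[OF inv V] False by (simp add: d_def d'_def)
  define m where "m = (i + d * w) mod int p"
  define n where "n = (j + d' * w) mod int p"
  have [simp]: "m \<in> {0..<int p}" "n \<in> {0..<int p}" using p_pos by (simp_all add: m_def n_def)
  have mc: "[m = i + d * w] (mod int p)" and nc: "[n = j + d' * w] (mod int p)"
    by (simp_all add: m_def n_def)
  \<comment> \<open>Columns \<open>a\<close> are written as \<open>j + d' x\<close>, so that the triangle \<open>(j, l, n)\<close> becomes \<open>(0, 1, w)\<close>.\<close>
  obtain d'' where d'': "[d' * d'' = 1] (mod int p)" by (rule int_inverse_mod[OF d(2)])
  have coord: "[a = j + d' * (d'' * (a - j))] (mod int p)" for a
    using cong_add[OF cong_refl[of j] cong_scalar_right[OF d'', of "a - j"]] by (simp add: algebra_simps cong_sym)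
  have prod: "multiplier_equiv p S y z"
    if ne: "u a b \<otimes> u a' b' \<noteq> \<zero>" and ab: "a \<in> {0..<int p}" "b \<in> {0..<int p}" "a' \<in> {0..<int p}" "b' \<in> {0..<int p}"
      and y: "[a' - a = d * y] (mod int p)" "coprime y (int p)" and z: "[b' - b = d' * z] (mod int p)"
    for a b a' b' y z
  proof -
    have "multiplier_equiv p S (a' - a) (b' - b)"
      by (rule nonzero_product_multiplier_equiv[OF inv ab ne])
    then have "multiplier_equiv p S (d * y) (d' * z)" using multiplier_equiv_cong y(1) z by blast
    then show ?thesis by (rule multiplier_equiv_transport[OF dd y(2) d(2)])
  qed
  have eqV: "a = b" if "a \<in> {0..<int p}" "b \<in> {0..<int p}" "[a = b] (mod int p)" for a b
    using that by (simp add: cong_def)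
  have w1: "coprime (1 - w) (int p)" using T.w(2) by (metis coprime_minus_left_iff minus_diff_eq)
  \<comment> \<open>The index set has to stay folded for the closure rules to apply.\<close>
  note atLeastLessThan_iff [simp del]
  have pq: "u i j \<otimes> u k l = u i j \<otimes> u m n \<otimes> u k l"
  proof (rule insert_unique)
    fix a assume a: "a \<in> {0..<int p}" "a \<noteq> n"
    define x where "x = d'' * (a - j)"
    have ax: "[a = j + d' * x] (mod int p)" using coord by (simp add: x_def)
    show "u i j \<otimes> u m a = \<zero> \<or> u m a \<otimes> u k l = \<zero>"
    proof (rule ccontr)
      assume ne: "\<not> ?thesis"
      have "multiplier_equiv p S w x"
      proof (rule prod[of i j m a])
        show "[m - i = d * w] (mod int p)" using cong_diff[OF mc cong_refl, of i] by simp
        show "[a - j = d' * x] (mod int p)" using cong_diff[OF ax cong_refl, of j] by simp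
      qed (use ne a T.w in auto)
      moreover have "multiplier_equiv p S (1 - w) (1 - x)"
      proof (rule prod[of m a k l])
        show "[k - m = d * (1 - w)] (mod int p)"
          using cong_diff[OF cong_refl mc, of k] by (simp add: d_def algebra_simps)
        show "[l - a = d' * (1 - x)] (mod int p)"
          using cong_diff[OF cong_refl ax, of l] by (simp add: d'_def algebra_simps)
      qed (use ne a w1 in auto)
      ultimately have "[x = w] (mod int p)" by (rule T.third_vertex_unique)
      then have "[j + d' * x = j + d' * w] (mod int p)" by (intro cong_add cong_scalar_left cong_refl)
      then have "[a = n] (mod int p)" using ax nc by (metis cong_sym cong_trans)
      then show False using a eqV[of a n] by simp
    qed
  qed simp_all
  have pr: "u i j \<otimes> u m n = u i j \<otimes> u k l \<otimes> u m n"
  proof (rule insert_unique)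
    fix a assume a: "a \<in> {0..<int p}" "a \<noteq> l"
    define x where "x = d'' * (a - j)"
    have ax: "[a = j + d' * x] (mod int p)" using coord by (simp add: x_def)
    show "u i j \<otimes> u k a = \<zero> \<or> u k a \<otimes> u m n = \<zero>"
    proof (rule ccontr)
      assume ne: "\<not> ?thesis"
      have "multiplier_equiv p S 1 x"
      proof (rule prod[of i j k a])
        show "[k - i = d * 1] (mod int p)" by (simp add: d_def)
        show "[a - j = d' * x] (mod int p)" using cong_diff[OF ax cong_refl, of j] by simp
      qed (use ne a in auto)
      moreover have "multiplier_equiv p S (w - 1) (w - x)"
      proof (rule prod[of k a m n])
        show "[m - k = d * (w - 1)] (mod int p)"
          using cong_diff[OF mc cong_refl, of k] by (simp add: d_def algebra_simps)
        show "[n - a = d' * (w - x)] (mod int p)"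
          using cong_diff[OF nc ax] by (simp add: algebra_simps)
      qed (use ne a T.w in auto)
      ultimately have "[x = 1] (mod int p)" by (rule T.second_vertex_unique)
      then have "[j + d' * x = j + d' * 1] (mod int p)" by (intro cong_add cong_scalar_left cong_refl)
      then have "[a = l] (mod int p)" using cong_trans[OF ax] by (simp add: d'_def)
      then show False using a eqV[of a l] by simp
    qed
  qed simp_all
  have qr: "u k l \<otimes> u m n = u k l \<otimes> u i j \<otimes> u m n"
  proof (rule insert_unique)
    fix a assume a: "a \<in> {0..<int p}" "a \<noteq> j"
    define x where "x = d'' * (a - j)"
    have ax: "[a = j + d' * x] (mod int p)" using coord by (simp add: x_def)
    show "u k l \<otimes> u i a = \<zero> \<or> u i a \<otimes> u m n = \<zero>"
    proof (rule ccontr)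
      assume ne: "\<not> ?thesis"
      have "multiplier_equiv p S (- 1) (x - 1)"
      proof (rule prod[of k l i a])
        show "[i - k = d * - 1] (mod int p)" by (simp add: d_def)
        show "[a - l = d' * (x - 1)] (mod int p)"
          using cong_diff[OF ax cong_refl, of l] by (simp add: d'_def algebra_simps)
      qed (use ne a in auto)
      moreover have "multiplier_equiv p S w (w - x)"
      proof (rule prod[of i a m n])
        show "[m - i = d * w] (mod int p)" using cong_diff[OF mc cong_refl, of i] by simp
        show "[n - a = d' * (w - x)] (mod int p)"
          using cong_diff[OF nc ax] by (simp add: algebra_simps)
      qed (use ne a T.w in auto)
      ultimately have "[x = 0] (mod int p)" by (rule T.first_vertex_unique)
      then have "[j + d' * x = j + d' * 0] (mod int p)" by (intro cong_add cong_scalar_left cong_refl)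
      then have "[a = j] (mod int p)" using cong_trans[OF ax] by simp
      then show False using a eqV[of a j] by simp
    qed
  qed simp_all
  show ?thesis by (rule triple_sandwich_idem[OF _ _ _ pq pr qr]) simp_all
qed

end

section \<open>Quotients of the quantum permutation algebra\<close>

context star_ideal begin

lemma q_finsum:
  assumes "finite K" "\<And>m. m \<in> K \<Longrightarrow> f m \<in> carrier A"
  shows "(\<Oplus>\<^bsub>quot_alg A I\<^esub>m\<in>K. I +> f m) = I +> (\<Oplus>m\<in>K. f m)"
proof -
  interpret Q: star_algebra "quot_alg A I" by (rule star_algebra_quot)
  show ?thesis using assms
    by (induction K rule: finite_induct) (auto simp: q_zero Pi_def finsum_closed)
qed

lemma q_zero_iff: "x \<in> carrier A \<Longrightarrow> I +> x = \<zero>\<^bsub>quot_alg A I\<^esub> \<longleftrightarrow> x \<in> I"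
  by (simp add: q_zero coset_eq_iff a_minus_def)

lemma magic_unitary_quot:
  assumes V: "finite V" and u: "magic_unitary A V u"
  shows "magic_unitary (quot_alg A I) V (\<lambda>i j. I +> u i j)"
proof -
  have c: "u i j \<in> carrier A" if "i \<in> V" "j \<in> V" for i j using u that by (simp add: magic_unitary_def)
  have "(\<Oplus>\<^bsub>quot_alg A I\<^esub>j\<in>V. I +> u i j) = I +> (\<Oplus>j\<in>V. u i j)"
    "(\<Oplus>\<^bsub>quot_alg A I\<^esub>j\<in>V. I +> u j i) = I +> (\<Oplus>j\<in>V. u j i)" if "i \<in> V" for i
    using c that by (intro q_finsum V; simp)+
  then show ?thesis using u c by (simp add: magic_unitary_def q_one q_zero)
qed

end

text \<open>The generators are self-adjoint, so linear combinations of their products form the image of the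
  free *-algebra, which is dense.\<close>

lemma A_s_induct [consumes 1, case_names gen one add mult smult lim]:
  assumes x: "x \<in> carrier (A_s V)"
    and gen: "\<And>i j. i \<in> V \<Longrightarrow> j \<in> V \<Longrightarrow> Pr (A_s_gen V i j)"
    and one: "Pr \<one>\<^bsub>A_s V\<^esub>"
    and add: "\<And>x y. x \<in> carrier (A_s V) \<Longrightarrow> y \<in> carrier (A_s V) \<Longrightarrow> Pr x \<Longrightarrow> Pr y \<Longrightarrow> Pr (x \<oplus>\<^bsub>A_s V\<^esub> y)"
    and mult: "\<And>x y. x \<in> carrier (A_s V) \<Longrightarrow> y \<in> carrier (A_s V) \<Longrightarrow> Pr x \<Longrightarrow> Pr y \<Longrightarrow> Pr (x \<otimes>\<^bsub>A_s V\<^esub> y)"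
    and smult: "\<And>x c. x \<in> carrier (A_s V) \<Longrightarrow> Pr x \<Longrightarrow> Pr (c \<odot>\<^bsub>A_s V\<^esub> x)"
    and lim: "\<And>Z x. (\<And>n. Z n \<in> carrier (A_s V)) \<Longrightarrow> x \<in> carrier (A_s V) \<Longrightarrow>
        (\<lambda>n. nrm (A_s V) (Z n \<ominus>\<^bsub>A_s V\<^esub> x)) \<longlonglongrightarrow> 0 \<Longrightarrow> (\<And>n. Pr (Z n)) \<Longrightarrow> Pr x"
    and V: "finite V"
  shows "Pr x"
proof -
  let ?G = "V \<times> V"
  let ?D = "presented_alg ?G (magic_relations V)"
  let ?F = "free_star_alg ?G"
  let ?t = "to_completion ?D"
  interpret D: cstar_seminormed_algebra ?D by (rule presented_cstar[OF A_s_bounded])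
  interpret U: unital_cstar_algebra "A_s V" by (rule A_s_is_cstar)
  have D: "carrier ?D = carrier ?F" by (simp add: presented_alg_def)
  have AU: "hausdorff_completion ?D = A_s V" by (simp add: A_s_def universal_cstar_def)
  have "?t \<in> star_hom ?D (A_s V)" using to_completion_hom[OF D.cstar_seminormed_algebra_axioms] by (simp add: AU)
  then have h: "?t \<in> star_hom ?F (A_s V)" by (simp add: star_hom_def ring_hom_def presented_alg_def)
  have word: "Pr (?t (Poly_Mapping.single (Word ls) 1))" if "Word ls \<in> words_over ?G" for ls
    using that
  proof (induction ls)
    case Nil
    have "Poly_Mapping.single (Word []) 1 = (1 :: ('a \<times> 'a) star_poly)" by (simp flip: zero_word_def)
    then show ?case using star_homD(4)[OF h] one by simp
  next
    case (Cons a ls)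
    then have ls: "Word ls \<in> words_over ?G" and a: "base a \<in> ?G" by (auto simp: words_over_def)
    let ?a = "Poly_Mapping.single (Word [a]) 1 :: ('a \<times> 'a) star_poly"
    obtain i j where ij: "base a = (i, j)" "i \<in> V" "j \<in> V" using a by blast
    have g: "?t (gen_poly (i, j)) = A_s_gen V i j" by (simp add: A_s_gen_def universal_gen_def)
    have "?t ?a = A_s_gen V i j"
    proof (cases a)
      case (Gen g')
      then show ?thesis using ij g by (simp add: gen_poly_def)
    next
      case (Adj g')
      then have "?a = star ?F (gen_poly (i, j))" using ij by (simp add: gen_poly_def adj_word_def)
      then have "?t ?a = star (A_s V) (A_s_gen V i j)"
        using star_homD(6)[OF h, of "gen_poly (i, j)"] g ij by simp
      then show ?thesis using A_s_magic[OF V] ij by (simp add: magic_unitary_def)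
    qed
    then have Pa: "Pr (?t ?a)" using gen ij by simp
    have ac: "?a \<in> carrier ?F" "Poly_Mapping.single (Word ls) 1 \<in> carrier ?F"
      using a ls by (auto intro!: free_single simp: words_over_def)
    have "Poly_Mapping.single (Word (a # ls)) 1 = ?a * Poly_Mapping.single (Word ls) 1"
      by (simp add: mult_single plus_word_def)
    then have "?t (Poly_Mapping.single (Word (a # ls)) 1) = ?t ?a \<otimes>\<^bsub>A_s V\<^esub> ?t (Poly_Mapping.single (Word ls) 1)"
      using star_homD(3)[OF h ac] by simp
    then show ?case using mult[OF star_homD(1)[OF h ac(1)] star_homD(1)[OF h ac(2)] Pa Cons.IH[OF ls]] by simp
  qed
  have poly: "Pr (?t a)" if "a \<in> carrier ?F" for a
    using that
  proof (induction a rule: free_induct)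
    case zero
    have "?t 0 = 0 \<odot>\<^bsub>A_s V\<^esub> \<one>\<^bsub>A_s V\<^esub>"
      using star_homD(5)[OF h, of "\<one>\<^bsub>?F\<^esub>" 0] star_homD(4)[OF h] by simp
    then show ?case using smult[OF U.one_closed one, of 0] by simp
  next
    case (single w c)
    have "Poly_Mapping.single w c = c \<odot>\<^bsub>?F\<^esub> Poly_Mapping.single w 1" by (simp add: mult_single)
    then have "?t (Poly_Mapping.single w c) = c \<odot>\<^bsub>A_s V\<^esub> ?t (Poly_Mapping.single w 1)"
      using star_homD(5)[OF h free_single[OF single]] by simp
    then show ?case
      using smult[OF star_homD(1)[OF h free_single[OF single]], of 1 c] word[of "letters w"] single by simp
  next
    case (add a b)
    then show ?case using star_homD(2)[OF h, of a b] assms(4) star_homD(1)[OF h] by simp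
  qed
  have "\<exists>a. a \<in> carrier ?D \<and> nrm (A_s V) (x \<ominus>\<^bsub>A_s V\<^esub> ?t a) < inverse (real (Suc n))" for n
    using D.to_completion_dense[of x "inverse (real (Suc n))"] x unfolding AU by (metis inverse_positive_iff_positive of_nat_0_less_iff zero_less_Suc)
  then obtain a where a: "\<And>n. a n \<in> carrier ?D" "\<And>n. nrm (A_s V) (x \<ominus>\<^bsub>A_s V\<^esub> ?t (a n)) < inverse (real (Suc n))"
    by metis
  have tc: "?t (a n) \<in> carrier (A_s V)" for n using star_homD(1)[OF h] a(1) D by simp
  have "U.conv_to (\<lambda>n. ?t (a n)) x"
  proof (rule U.conv_toI[OF tc x LIMSEQ_inverse_real_of_nat])
    show "nrm (A_s V) (?t (a n) \<ominus>\<^bsub>A_s V\<^esub> x) \<le> inverse (real (Suc n))" for n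
      using a(2)[of n] U.nrm_diff_commute[OF tc x] by (simp add: less_imp_le)
  qed
  then show ?thesis using lim[of "\<lambda>n. ?t (a n)" x] tc x poly a(1) by (simp add: U.conv_to_def D)
qed

text \<open>For fixed \<open>y\<close>, the elements that commute with \<open>y\<close> modulo \<open>J\<close> form a closed subalgebra.  Using
  this first with \<open>y\<close> a generator and then with \<open>y\<close> arbitrary gives the claim.\<close>

lemma commutative_quotient_of_A_s:
  assumes V: "finite V" and J: "closed_star_ideal (A_s V) J"
    and gens: "\<And>i j k l. i \<in> V \<Longrightarrow> j \<in> V \<Longrightarrow> k \<in> V \<Longrightarrow> l \<in> V \<Longrightarrow>
      A_s_gen V i j \<otimes>\<^bsub>A_s V\<^esub> A_s_gen V k l \<ominus>\<^bsub>A_s V\<^esub> A_s_gen V k l \<otimes>\<^bsub>A_s V\<^esub> A_s_gen V i j \<in> J"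
  shows "commutative_alg (quot_alg (A_s V) J)"
proof -
  interpret U: unital_cstar_algebra "A_s V" by (rule A_s_is_cstar)
  interpret J: star_ideal J "A_s V" by (rule closed_star_ideal_star_ideal[OF U.star_algebra_axioms J])
  interpret Q: star_algebra "quot_alg (A_s V) J" by (rule J.star_algebra_quot)
  let ?A = "A_s V" and ?Q = "quot_alg (A_s V) J"
  let ?pi = "\<lambda>x. J +>\<^bsub>?A\<^esub> x"
  define com where "com x y \<longleftrightarrow> ?pi x \<otimes>\<^bsub>?Q\<^esub> ?pi y = ?pi y \<otimes>\<^bsub>?Q\<^esub> ?pi x" for x y
  have g: "A_s_gen V i j \<in> carrier ?A" if "i \<in> V" "j \<in> V" for i j
    using A_s_magic[OF V] that by (simp add: magic_unitary_def)
  have com_iff: "com x y \<longleftrightarrow> x \<otimes>\<^bsub>?A\<^esub> y \<ominus>\<^bsub>?A\<^esub> y \<otimes>\<^bsub>?A\<^esub> x \<in> J" if "x \<in> carrier ?A" "y \<in> carrier ?A" for x y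
    using that by (simp add: com_def J.coset_eq_iff)
  have J_lim: "a \<in> J" if "U.conv_to W a" "\<And>n. W n \<in> J" for W a
    using J that unfolding closed_star_ideal_def U.conv_to_def by blast
  have com_all: "com x y" if x: "x \<in> carrier ?A" and y: "y \<in> carrier ?A"
    and "\<And>i j. i \<in> V \<Longrightarrow> j \<in> V \<Longrightarrow> com (A_s_gen V i j) y" for x y
    using x
  proof (induction rule: A_s_induct)
    case (gen i j) then show ?case using that(3) by blast
  next
    case one show ?case using y by (simp add: com_def)
  next
    case (add x z)
    have e: "?pi (x \<oplus>\<^bsub>?A\<^esub> z) = ?pi x \<oplus>\<^bsub>?Q\<^esub> ?pi z" using add.hyps by simp
    have c: "?pi x \<in> carrier ?Q" "?pi z \<in> carrier ?Q" "?pi y \<in> carrier ?Q" using add.hyps y by simp_all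
    show ?case
      unfolding com_def e Q.l_distr[OF c] Q.r_distr[OF c]
      using add.IH unfolding com_def by simp
  next
    case (mult x z)
    have xz: "?pi (x \<otimes>\<^bsub>?A\<^esub> z) = ?pi x \<otimes>\<^bsub>?Q\<^esub> ?pi z" using mult by simp
    have c: "?pi x \<in> carrier ?Q" "?pi z \<in> carrier ?Q" "?pi y \<in> carrier ?Q" using mult y by simp_all
    have "?pi x \<otimes>\<^bsub>?Q\<^esub> ?pi z \<otimes>\<^bsub>?Q\<^esub> ?pi y = ?pi x \<otimes>\<^bsub>?Q\<^esub> (?pi z \<otimes>\<^bsub>?Q\<^esub> ?pi y)"
      by (rule Q.m_assoc[OF c])
    also have "?pi z \<otimes>\<^bsub>?Q\<^esub> ?pi y = ?pi y \<otimes>\<^bsub>?Q\<^esub> ?pi z" using mult.IH(2) unfolding com_def .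
    also have "?pi x \<otimes>\<^bsub>?Q\<^esub> (?pi y \<otimes>\<^bsub>?Q\<^esub> ?pi z) = ?pi x \<otimes>\<^bsub>?Q\<^esub> ?pi y \<otimes>\<^bsub>?Q\<^esub> ?pi z"
      by (rule Q.m_assoc[OF c(1,3,2), symmetric])
    also have "?pi x \<otimes>\<^bsub>?Q\<^esub> ?pi y = ?pi y \<otimes>\<^bsub>?Q\<^esub> ?pi x" using mult.IH(1) unfolding com_def .
    also have "?pi y \<otimes>\<^bsub>?Q\<^esub> ?pi x \<otimes>\<^bsub>?Q\<^esub> ?pi z = ?pi y \<otimes>\<^bsub>?Q\<^esub> (?pi x \<otimes>\<^bsub>?Q\<^esub> ?pi z)"
      by (rule Q.m_assoc[OF c(3,1,2)])
    finally show ?case unfolding com_def xz .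
  next
    case (smult x c)
    have e: "?pi (c \<odot>\<^bsub>?A\<^esub> x) = c \<odot>\<^bsub>?Q\<^esub> ?pi x" using smult.hyps by simp
    have c: "?pi x \<in> carrier ?Q" "?pi y \<in> carrier ?Q" using smult.hyps y by simp_all
    show ?case
      unfolding com_def e Q.smult_mult_l[OF c] Q.smult_mult_r[OF c(2,1)]
      using smult.IH unfolding com_def by simp
  next
    case (lim Z x)
    have Z: "U.conv_to Z x" using lim by (simp add: U.conv_to_def)
    have Zc: "Z n \<in> carrier ?A" for n using lim by blast
    have "U.conv_to (\<lambda>n. Z n \<otimes>\<^bsub>?A\<^esub> y \<oplus>\<^bsub>?A\<^esub> (-1) \<odot>\<^bsub>?A\<^esub> (y \<otimes>\<^bsub>?A\<^esub> Z n)) (x \<otimes>\<^bsub>?A\<^esub> y \<oplus>\<^bsub>?A\<^esub> (-1) \<odot>\<^bsub>?A\<^esub> (y \<otimes>\<^bsub>?A\<^esub> x))"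
      by (intro U.conv_add U.conv_smult U.conv_mult Z U.conv_const y)
    then have "U.conv_to (\<lambda>n. Z n \<otimes>\<^bsub>?A\<^esub> y \<ominus>\<^bsub>?A\<^esub> y \<otimes>\<^bsub>?A\<^esub> Z n) (x \<otimes>\<^bsub>?A\<^esub> y \<ominus>\<^bsub>?A\<^esub> y \<otimes>\<^bsub>?A\<^esub> x)"
      using Zc y lim(2) by (simp add: U.smult_minus_one a_minus_def)
    moreover have "Z n \<otimes>\<^bsub>?A\<^esub> y \<ominus>\<^bsub>?A\<^esub> y \<otimes>\<^bsub>?A\<^esub> Z n \<in> J" for n using lim(4)[of n] com_iff[OF Zc y] by simp
    ultimately have "x \<otimes>\<^bsub>?A\<^esub> y \<ominus>\<^bsub>?A\<^esub> y \<otimes>\<^bsub>?A\<^esub> x \<in> J"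
      using J_lim by blast
    then show ?case using com_iff lim(2) y by simp
  qed (rule V)
  have com_sym: "com x y \<Longrightarrow> com y x" for x y by (simp add: com_def)
  \<comment> \<open>Generators commute with everything: apply the principle with a generator in second place.\<close>
  have com_gen: "com (A_s_gen V i j) x" if "x \<in> carrier ?A" "i \<in> V" "j \<in> V" for x i j
  proof (rule com_sym, rule com_all[OF that(1) g[OF that(2,3)]])
    show "com (A_s_gen V k l) (A_s_gen V i j)" if "k \<in> V" "l \<in> V" for k l
      using com_iff[OF g[OF that] g[OF \<open>i \<in> V\<close> \<open>j \<in> V\<close>]] gens[OF that \<open>i \<in> V\<close> \<open>j \<in> V\<close>] by blast
  qed
  have "com x y" if "x \<in> carrier ?A" "y \<in> carrier ?A" for x y
    by (rule com_all[OF that com_gen[OF that(2)]])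
  then have comm: "?pi x \<otimes>\<^bsub>?Q\<^esub> ?pi y = ?pi y \<otimes>\<^bsub>?Q\<^esub> ?pi x" if "x \<in> carrier ?A" "y \<in> carrier ?A" for x y
    using that unfolding com_def .
  show ?thesis
    unfolding commutative_alg_def
  proof (intro ballI)
    fix C D assume "C \<in> carrier ?Q" "D \<in> carrier ?Q"
    then obtain x y where "x \<in> carrier ?A" "C = ?pi x" "y \<in> carrier ?A" "D = ?pi y"
      unfolding J.q_carrier by blast
    then show "C \<otimes>\<^bsub>?Q\<^esub> D = D \<otimes>\<^bsub>?Q\<^esub> C" using comm by blast
  qed
qed

section \<open>Orbits of circulant graphs\<close>

lemma
  assumes p: "prime p" "p \<ge> 3" and ks: "circulant_jumps p ks"
  shows one_mem_connection_set: "1 \<in> connection_set p ks"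
    and zero_notin_connection_set: "0 \<notin> connection_set p ks"
    and connection_set_subset: "connection_set p ks \<subseteq> {0..<int p}"
proof -
  show "1 \<in> connection_set p ks"
    unfolding connection_set_def using p by (intro image_eqI[of _ _ 1]) auto
  show "connection_set p ks \<subseteq> {0..<int p}"
    using p by (auto simp: connection_set_def)
  interpret G: pair_graph "circulant_graph p ks" by (rule pair_graph_circulant[OF p(2) ks])
  have "(0, 0) \<notin> parcs (circulant_graph p ks)" using G.no_loops by fastforce
  then show "0 \<notin> connection_set p ks" using p by (auto simp: circulant_graph_def)
qed

text \<open>On a finite set an injective self-map is onto, so one inclusion suffices.\<close>

lemma mult_stabilizerI:
  assumes p: "prime p" "p \<ge> 3" and ks: "circulant_jumps p ks"
    and e: "coprime e (int p)" and S: "\<And>n. n \<in> connection_set p ks \<Longrightarrow> (e * n) mod int p \<in> connection_set p ks"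
  shows "e mod int p \<in> mult_stabilizer p ks"
proof -
  let ?S = "connection_set p ks" and ?e = "e mod int p"
  have m: "(?e * n) mod int p = (e * n) mod int p" for n by (simp add: mod_mult_left_eq)
  have fin: "finite ?S" using connection_set_subset[OF p ks] finite_subset by blast
  have "inj_on (\<lambda>s. (e * s) mod int p) ?S"
  proof (rule inj_onI)
    fix s t assume st: "s \<in> ?S" "t \<in> ?S" "(e * s) mod int p = (e * t) mod int p"
    then have "[s = t] (mod int p)" using cong_mult_lcancel[OF e] by (simp add: cong_def)
    moreover have "s \<in> {0..<int p}" "t \<in> {0..<int p}" using st(1,2) connection_set_subset[OF p ks] by blast+
    ultimately show "s = t" by (simp add: cong_def)
  qed
  then have "(\<lambda>s. (e * s) mod int p) ` ?S = ?S"
    by (intro endo_inj_surj[OF fin]) (use S in auto)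
  then show ?thesis
    using e p by (simp add: mult_stabilizer_def m coprime_mod_left_iff)
qed

lemma mult_stabilizer_mult:
  assumes "a \<in> mult_stabilizer p ks" "b \<in> mult_stabilizer p ks" "p > 0"
  shows "(a * b) mod int p \<in> mult_stabilizer p ks"
proof -
  let ?S = "connection_set p ks"
  have "(\<lambda>s. ((a * b) mod int p * s) mod int p) ` ?S = (\<lambda>s. (a * s) mod int p) ` (\<lambda>s. (b * s) mod int p) ` ?S"
    by (simp add: image_image mod_simps mult.assoc)
  then show ?thesis using assms by (simp add: mult_stabilizer_def coprime_mod_left_iff)
qed

text \<open>If \<open>x - i\<close> is equivalent to \<open>z - i = y\<^sub>s b\<close>, then \<open>(x - i) / (z - i)\<close> maps \<open>S\<close> into itself: an
  element \<open>n\<close> of \<open>S\<close> is the multiple of \<open>z - i\<close> by \<open>n / (z - i)\<close>.\<close>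

lemma circulant_orbit_multiplier_equiv:
  assumes p: "prime p" "p \<ge> 3" and ks: "circulant_jumps p ks"
    and s: "s \<noteq> 0" and ys: "coprime (y s) (int p)"
    and z: "z \<in> circulant_orbit p ks y i s"
  shows circulant_orbit_coprime: "coprime (z - i) (int p)"
    and "multiplier_equiv p (connection_set p ks) (x - i) (z - i) \<Longrightarrow> x mod int p \<in> circulant_orbit p ks y i s"
proof -
  let ?S = "connection_set p ks"
  obtain b where b: "b \<in> mult_stabilizer p ks" "z = (i + y s * b) mod int p"
    using z s by (auto simp: circulant_orbit_def)
  have zi: "[z - i = y s * b] (mod int p)"
    unfolding b(2) by (simp add: cong_def mod_simps)
  have "coprime (y s * b) (int p)" using ys b(1) by (simp add: mult_stabilizer_def)
  then show z1: "coprime (z - i) (int p)" using cong_imp_coprime[OF cong_sym[OF zi]] by simp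
  assume xz: "multiplier_equiv p ?S (x - i) (z - i)"
  have x1: "coprime (x - i) (int p)"
    by (rule multiplier_equiv_coprime[OF p(1) one_mem_connection_set[OF p ks] zero_notin_connection_set[OF p ks] z1 xz])
  obtain c where c: "[(z - i) * c = 1] (mod int p)" "coprime c (int p)" by (rule int_inverse_mod[OF z1])
  define e where "e = ((x - i) * c) mod int p"
  have "e \<in> mult_stabilizer p ks"
    unfolding e_def
  proof (rule mult_stabilizerI[OF p ks])
    show "coprime ((x - i) * c) (int p)" using x1 c(2) by simp
    fix n assume n: "n \<in> ?S"
    have n0: "n \<noteq> 0" "0 \<le> n" "n < int p"
      using n connection_set_subset[OF p ks] zero_notin_connection_set[OF p ks] by auto
    then have "\<not> int p dvd n" using zdvd_not_zless[of n "int p"] by simp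
    then have "coprime n (int p)" using p(1) prime_imp_coprime[of "int p" n] by (auto simp: coprime_commute)
    then have nc: "coprime (n * c) (int p)" using c(2) by simp
    have "[n * c * (z - i) = n] (mod int p)"
      using cong_scalar_left[OF c(1), of n] by (simp add: algebra_simps)
    then have "(n * c * (z - i)) mod int p \<in> ?S" using n n0 by (simp add: cong_def)
    then have "(n * c * (x - i)) mod int p \<in> ?S" using xz nc by (simp add: multiplier_equiv_def)
    then show "((x - i) * c * n) mod int p \<in> ?S" by (simp only: ac_simps)
  qed
  with b(1) have "(b * e) mod int p \<in> mult_stabilizer p ks" using p by (intro mult_stabilizer_mult) auto
  moreover have "x mod int p = (i + y s * ((b * e) mod int p)) mod int p"
  proof -
    have "[(y s * b) * ((x - i) * c) = (z - i) * ((x - i) * c)] (mod int p)"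
      by (rule cong_scalar_right[OF cong_sym[OF zi]])
    moreover have "[(z - i) * ((x - i) * c) = x - i] (mod int p)"
      using cong_scalar_left[OF c(1), of "x - i"] by (simp add: algebra_simps)
    ultimately have "[(y s * b) * ((x - i) * c) = x - i] (mod int p)" by (rule cong_trans)
    then have x: "[i + (y s * b) * ((x - i) * c) = x] (mod int p)"
      using cong_add[OF cong_refl[of i], of "(y s * b) * ((x - i) * c)" "x - i"] by simp
    have "[y s * ((b * e) mod int p) = (y s * b) * ((x - i) * c)] (mod int p)"
      unfolding e_def mult.assoc[of "y s"] by (intro cong_scalar_left) (simp add: cong_def mod_simps)
    from cong_trans[OF cong_add[OF cong_refl[of i] this] x]
    have "[i + y s * ((b * e) mod int p) = x] (mod int p)" .
    then show ?thesis by (simp add: cong_def)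
  qed
  ultimately show "x mod int p \<in> circulant_orbit p ks y i s"
    using s by (auto simp: circulant_orbit_def)
qed

lemma unique_triangle_of_orbits:
  assumes p: "prime p" "p \<ge> 3" and ks: "circulant_jumps p ks" and y: "coset_reps p ks r y"
    and s: "s1 \<in> {1..r}" "s2 \<in> {1..r}"
    and card: "card (circulant_orbit p ks y 0 s1 \<inter> circulant_orbit p ks y 1 s2) = 1"
  obtains w where "unique_triangle p (connection_set p ks) w"
proof -
  obtain w where w: "circulant_orbit p ks y 0 s1 \<inter> circulant_orbit p ks y 1 s2 = {w}"
    using card by (metis card_1_singletonE)
  have ys: "coprime (y t) (int p)" if "t \<in> {1..r}" for t
  proof -
    have "y ` {1..r} \<subseteq> {1..<int p}" using y unfolding coset_reps_def by (elim conjE)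
    then have "y t \<in> {1..<int p}" using that by blast
    then have "\<not> int p dvd y t" using zdvd_not_zless[of "y t" "int p"] by simp
    then show ?thesis using p(1) prime_imp_coprime[of "int p" "y t"] by (auto simp: coprime_commute)
  qed
  have s0: "s1 \<noteq> 0" "s2 \<noteq> 0" using s by auto
  note o1 = circulant_orbit_multiplier_equiv[OF p ks s0(1), of y, OF ys[OF s(1)], of w 0]
  note o2 = circulant_orbit_multiplier_equiv[OF p ks s0(2), of y, OF ys[OF s(2)], of w 1]
  have w12: "w \<in> circulant_orbit p ks y 0 s1" "w \<in> circulant_orbit p ks y 1 s2" using w by auto
  have "unique_triangle p (connection_set p ks) w"
  proof
    show "coprime w (int p)" "coprime (w - 1) (int p)" using o1(1) o2(1) w12 by simp_all
    fix x assume "multiplier_equiv p (connection_set p ks) x w"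
      "multiplier_equiv p (connection_set p ks) (x - 1) (w - 1)"
    then have "x mod int p \<in> circulant_orbit p ks y 0 s1 \<inter> circulant_orbit p ks y 1 s2"
      using o1(2)[OF w12(1), of x] o2(2)[OF w12(2), of x] by simp
    then have "x mod int p = w" unfolding w by simp
    then show "[x = w] (mod int p)" by (metis cong_mod_left cong_refl)
  qed (use p one_mem_connection_set[OF p ks] zero_notin_connection_set[OF p ks] in auto)
  then show ?thesis by (rule that)
qed

theorem theorem6p16:
  fixes p r :: nat and ks :: "int list" and y :: "nat \<Rightarrow> int"
    and X :: "int pair_pre_digraph"
  assumes "prime p" and "p \<ge> 3"
    and "circulant_jumps p ks" and "X = circulant_graph p ks"
    and "coset_reps p ks r y"
    and "\<exists>s1\<in>{1..r}. \<exists>s2\<in>{1..r}. card (circulant_orbit p ks y 0 s1 \<inter> circulant_orbit p ks y 1 s2) = 1"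
  shows "no_quantum_symmetry X"
proof -
  define V where "V = {0..<int p}"
  define S where "S = connection_set p ks"
  obtain w where T: "unique_triangle p S w"
    using assms(6) unique_triangle_of_orbits[OF assms(1,2,3,5)] unfolding S_def by metis
  have V: "finite V" "pverts X = V" by (simp_all add: V_def assms(4) circulant_graph_def)
  have adj: "adj_matrix X i k = (if (k - i) mod int p \<in> S then 1 else 0)" if "i \<in> V" "k \<in> V" for i k
    using that by (simp add: adj_matrix_def assms(4) circulant_graph_def V_def S_def)
  define J where "J = gen_closed_star_ideal (A_s V) (graph_relations X)"
  interpret U: unital_cstar_algebra "A_s V" by (rule A_s_is_cstar)
  have uc: "A_s_gen V i j \<in> carrier (A_s V)" and us: "star (A_s V) (A_s_gen V i j) = A_s_gen V i j"
    and ui: "A_s_gen V i j \<otimes>\<^bsub>A_s V\<^esub> A_s_gen V i j = A_s_gen V i j" if "i \<in> V" "j \<in> V" for i j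
    using A_s_magic[OF V(1)] that by (simp_all add: magic_unitary_def)
  have rel: "graph_relations X \<subseteq> carrier (A_s V)"
    unfolding graph_relations_def Let_def V(2) using uc
    by (auto intro!: U.minus_closed U.finsum_closed)
  have J: "closed_star_ideal (A_s V) J"
    unfolding J_def by (rule closed_star_ideal_generated[OF U.star_algebra_axioms rel])
  interpret J: star_ideal J "A_s V" by (rule closed_star_ideal_star_ideal[OF U.star_algebra_axioms J])
  let ?B = "quot_alg (A_s V) J"
  interpret B: star_algebra ?B by (rule J.star_algebra_quot)
  let ?pi = "\<lambda>x. J +>\<^bsub>A_s V\<^esub> x"
  define v where "v i j = ?pi (A_s_gen V i j)" for i j
  have "magic_unitary ?B V v"
    using J.magic_unitary_quot[OF V(1) A_s_magic[OF V(1)]] by (simp add: v_def[abs_def])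
  then interpret M: cyclic_magic_algebra ?B p v
    by unfold_locales (use V assms(1) in \<open>simp_all add: V_def\<close>)
  have "M.invariant_matrix (adj_matrix X)"
  proof (rule M.invariant_matrix_intertwiner, fold V_def)
    fix i j assume ij: "i \<in> V" "j \<in> V"
    let ?l = "\<lambda>k. adj_matrix X i k \<odot>\<^bsub>A_s V\<^esub> A_s_gen V k j"
    let ?r = "\<lambda>k. adj_matrix X k j \<odot>\<^bsub>A_s V\<^esub> A_s_gen V i k"
    have lc: "?l k \<in> carrier (A_s V)" and rc: "?r k \<in> carrier (A_s V)" if "k \<in> V" for k
      using uc ij that by simp_all
    have "(\<Oplus>\<^bsub>A_s V\<^esub>k\<in>V. ?l k) \<ominus>\<^bsub>A_s V\<^esub> (\<Oplus>\<^bsub>A_s V\<^esub>k\<in>V. ?r k) \<in> graph_relations X"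
      unfolding graph_relations_def Let_def V(2) using ij by blast
    then have "(\<Oplus>\<^bsub>A_s V\<^esub>k\<in>V. ?l k) \<ominus>\<^bsub>A_s V\<^esub> (\<Oplus>\<^bsub>A_s V\<^esub>k\<in>V. ?r k) \<in> J"
      unfolding J_def gen_closed_star_ideal_def by blast
    then have "?pi (\<Oplus>\<^bsub>A_s V\<^esub>k\<in>V. ?l k) = ?pi (\<Oplus>\<^bsub>A_s V\<^esub>k\<in>V. ?r k)"
      using lc rc by (subst J.coset_eq_iff) (auto intro!: U.finsum_closed)
    then have "(\<Oplus>\<^bsub>?B\<^esub>k\<in>V. ?pi (?l k)) = (\<Oplus>\<^bsub>?B\<^esub>k\<in>V. ?pi (?r k))"
      using J.q_finsum[OF V(1), of ?l] J.q_finsum[OF V(1), of ?r] lc rc by simp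
    moreover have "(\<Oplus>\<^bsub>?B\<^esub>k\<in>V. ?pi (?l k)) = (\<Oplus>\<^bsub>?B\<^esub>k\<in>V. adj_matrix X i k \<odot>\<^bsub>?B\<^esub> v k j)"
      using uc ij by (intro B.finsum_cong') (auto simp: v_def)
    moreover have "(\<Oplus>\<^bsub>?B\<^esub>k\<in>V. ?pi (?r k)) = (\<Oplus>\<^bsub>?B\<^esub>k\<in>V. adj_matrix X k j \<odot>\<^bsub>?B\<^esub> v i k)"
      using uc ij by (intro B.finsum_cong') (auto simp: v_def)
    ultimately show "(\<Oplus>\<^bsub>?B\<^esub>k\<in>V. adj_matrix X i k \<odot>\<^bsub>?B\<^esub> v k j) = (\<Oplus>\<^bsub>?B\<^esub>k\<in>V. adj_matrix X k j \<odot>\<^bsub>?B\<^esub> v i k)"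
      by simp
  qed
  then have "M.invariant_matrix (\<lambda>i k. if adj_matrix X i k = 1 then 1 else 0 :: int)"
    by (rule M.invariant_matrix_comp)
  then have inv: "M.invariant_circulant (\<lambda>x. if x mod int p \<in> S then 1 else 0)"
    unfolding M.invariant_circulant_def
    by (rule M.invariant_matrix_cong) (simp add: adj[unfolded V_def])
  have "commutative_alg ?B"
  proof (rule commutative_quotient_of_A_s[OF V(1) J])
    fix i j k l assume ij: "i \<in> V" "j \<in> V" and kl: "k \<in> V" "l \<in> V"
    let ?P = "A_s_gen V i j" and ?Q = "A_s_gen V k l"
    let ?k = "?P \<otimes>\<^bsub>A_s V\<^esub> ?Q \<ominus>\<^bsub>A_s V\<^esub> ?Q \<otimes>\<^bsub>A_s V\<^esub> ?P"
    let ?a = "v i j \<otimes>\<^bsub>?B\<^esub> v k l" and ?b = "v k l \<otimes>\<^bsub>?B\<^esub> v i j"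
    have vc: "v i j \<in> carrier ?B" "v k l \<in> carrier ?B" using uc ij kl by (simp_all add: v_def)
    have idem: "v i j \<otimes>\<^bsub>?B\<^esub> v i j = v i j" "v k l \<otimes>\<^bsub>?B\<^esub> v k l = v k l"
      using M.u_idem ij kl by (simp_all add: V_def)
    have a: "?a \<otimes>\<^bsub>?B\<^esub> ?a = ?a" and b: "?b \<otimes>\<^bsub>?B\<^esub> ?b = ?b"
      using M.generator_product_idem[OF T inv] ij kl unfolding V_def by blast+
    have sandwich: "x \<otimes>\<^bsub>?B\<^esub> y \<otimes>\<^bsub>?B\<^esub> (y \<otimes>\<^bsub>?B\<^esub> x) \<otimes>\<^bsub>?B\<^esub> (x \<otimes>\<^bsub>?B\<^esub> y) = x \<otimes>\<^bsub>?B\<^esub> y \<otimes>\<^bsub>?B\<^esub> (x \<otimes>\<^bsub>?B\<^esub> y)"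
      if "x \<in> carrier ?B" "y \<in> carrier ?B" and x: "x \<otimes>\<^bsub>?B\<^esub> x = x" and y: "y \<otimes>\<^bsub>?B\<^esub> y = y" for x y
    proof -
      have "x \<otimes>\<^bsub>?B\<^esub> y \<otimes>\<^bsub>?B\<^esub> (y \<otimes>\<^bsub>?B\<^esub> x) \<otimes>\<^bsub>?B\<^esub> (x \<otimes>\<^bsub>?B\<^esub> y)
          = x \<otimes>\<^bsub>?B\<^esub> (y \<otimes>\<^bsub>?B\<^esub> y) \<otimes>\<^bsub>?B\<^esub> ((x \<otimes>\<^bsub>?B\<^esub> x) \<otimes>\<^bsub>?B\<^esub> y)"
        using that(1,2) by (simp add: B.m_assoc)
      then show ?thesis by (simp add: x y)
    qed
    \<comment> \<open>The sandwich identities reduce \<open>a b a = a\<close> and \<open>b a b = b\<close> to the idempotence of \<open>a = P Q\<close> and \<open>b = Q P\<close>.\<close>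
    have cube: "(?a \<ominus>\<^bsub>?B\<^esub> ?b) \<otimes>\<^bsub>?B\<^esub> ((?a \<ominus>\<^bsub>?B\<^esub> ?b) \<otimes>\<^bsub>?B\<^esub> (?a \<ominus>\<^bsub>?B\<^esub> ?b)) = \<zero>\<^bsub>?B\<^esub>"
      using sandwich[OF vc idem] sandwich[OF vc(2,1) idem(2,1)] a b vc
      by (intro B.difference_of_idempotents_cube) simp_all
    have c: "?P \<in> carrier (A_s V)" "?Q \<in> carrier (A_s V)" using uc ij kl by simp_all
    have "?pi ?k = ?a \<ominus>\<^bsub>?B\<^esub> ?b" using c by (simp add: v_def)
    then have "?pi (?k \<otimes>\<^bsub>A_s V\<^esub> (?k \<otimes>\<^bsub>A_s V\<^esub> ?k)) = \<zero>\<^bsub>?B\<^esub>"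
      using cube c J.q_mult[of ?k ?k] J.q_mult[of ?k "?k \<otimes>\<^bsub>A_s V\<^esub> ?k"] by simp
    then have "?k \<otimes>\<^bsub>A_s V\<^esub> (?k \<otimes>\<^bsub>A_s V\<^esub> ?k) \<in> J" using c by (simp add: J.q_zero_iff)
    \<comment> \<open>The nilpotent commutator is lifted to \<open>A\<^sub>s\<close>, where the generators are projections in a C*-algebra.\<close>
    then show "?k \<in> J"
      by (intro U.commutator_mem_closed_ideal[OF J c us[OF ij] us[OF kl] ui[OF ij] ui[OF kl] refl])
  qed
  then show ?thesis
    unfolding no_quantum_symmetry_def A_graph_def V(2) J_def .
qed

end
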